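(* Consider the separable constraint-coupled problem $$\min_{\mathrm{x}=(x_1,\dots,x_N)}\ \sum_{i=1}^N f_i^0(x_i,\theta_i)\quad\text{s.t. } x_i\in\mathcal{C}_i(\theta_i)\ (i=1,\dots,N),\quad \sum_{i=1}^N H_i(x_i,\theta_c)=0,\quad \sum_{i=1}^N F_i(x_i,\theta_c)\le 0,$$ with $N$ convex local problems, and a solution $(\mathrm{x}^\star,\nu^\star,\lambda^\star)$ at parameter value $\theta^0$ (together with the multipliers of the local constraints). Assume that, at this solution: (A1) all functions defining the problem are twice continuously differentiable in $\mathrm{x}$ and $\theta$ in a neighborhood of $\mathrm{x}^\star(\theta^0)$; (A2) the first order KKT conditions of the global problem hold; (A4) the gradients (with respect to $\mathrm{x}$) of all binding constraints of the global problem (local and coupling) are linearly independent; (A5) strict complementary slackness holds for the global problem: the dual variable of every binding inequality constraint (local and coupling) is strictly positive; (A3, local) for each $i=1,\dots,N$, the second order conditions hold for subproblem $i$ individually (as defined in the context). Then all $N$ local Jacobians and the coupling Jacobian exist, are unique and invertible. That is: for each $i$ the matrix $\partial_{z_i}G_i$ is invertible at the solution, so that the local Jacobian $\partial_{\bar\theta_i}x_i^\star=-[I_{n_i}\ 0](\partial_{z_i}G_i)^{-1}\partial_{\bar\theta_i}G_i$ exists and is uniquely determined; and the matrix $\partial C$ of the coupling system is invertible, so that the Jacobian $y=[D_\theta\nu^T\ D_\theta\lambda^T]^T$ exists and is the unique solution of $\partial C\,y=q$.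
   Context: Setting. $x_i\in\mathbb{R}^{n_i}$, $\theta=(\theta_1,\dots,\theta_N,\theta_c)$, $f_i^0(\cdot,\theta_i)$ is convex, $\mathcal{C}_i(\theta_i)$ is a convex set described by local inequality constraints $g_i^{\rm loc}(x_i,\theta_i)\le 0$ and local equality constraints $h_i^{\rm loc}(x_i,\theta_i)=0$. $H_i(\cdot,\theta_c)$ takes values in $\mathbb{R}^{\Lambda_H}$ and $F_i(\cdot,\theta_c)$ in $\mathbb{R}^{\Lambda_F}$. The dual variables of the coupling equality and inequality constraints are $\nu\in\mathbb{R}^{\Lambda_H}$ and $\lambda\in\mathbb{R}^{\Lambda_F}$. Subproblem $i$ is obtained by dualizing only the coupling constraints: $$\min_{x_i\in\mathcal{C}_i(\theta_i)} f_i^0(x_i,\theta_i)+\nu^TH_i(x_i,\theta_c)+\lambda^TF_i(x_i,\theta_c),$$ where $\nu,\lambda$ are treated as fixed parameters; its augmented parameter vector is $\bar\theta_i=(\theta_i,\theta_c,\nu,\lambda)$, evaluated at $\nu=\nu^\star,\lambda=\lambda^\star$. Let $\pi_i,\mu_i$ be the multipliers of the local equality and inequality constraints, $z_i=(x_i,\pi_i,\mu_i)$, and let $G_i(z_i,\bar\theta_i)=0$ be the KKT equations of subproblem $i$: $$\nabla_{x_i}L_i=0,\quad h_i^{\rm loc}=0,\quad \mathrm{diag}(\mu_i)g_i^{\rm loc}=0,$$ with $L_i=f_i^0+\nu^TH_i+\lambda^TF_i+\pi_i^Th_i^{\rm loc}+\mu_i^Tg_i^{\rm loc}$. Second order conditions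 for subproblem $i$: $u^T\nabla^2_{x_i}L_i\,u>0$ at the solution for every $u\neq0$ such that $u^T\nabla g^{\rm loc}_{i,j}\le 0$ for all $j$ with $g^{\rm loc}_{i,j}=0$, $u^T\nabla g^{\rm loc}_{i,j}=0$ for all $j$ with $\mu^\star_{i,j}>0$, and $u^T\nabla h^{\rm loc}_{i,j}=0$ for all $j$. Coupling system. Set $$C(\mathrm{x},\lambda,\theta_c)=\begin{bmatrix}\sum_iH_i(x_i,\theta_c)\\ \mathrm{diag}(\lambda)\sum_iF_i(x_i,\theta_c)\end{bmatrix},$$ $$\partial C=-\begin{bmatrix}\partial_{\mathrm{x}}C\,\partial_\nu\mathrm{x} & \partial_{\mathrm{x}}C\,\partial_\lambda\mathrm{x}+\partial_\lambda C\end{bmatrix},\qquad q=\partial_{\mathrm{x}}C\,\partial_\theta\mathrm{x}+\partial_\theta C,$$ all evaluated at the solution, where $\partial_\nu\mathrm{x},\partial_\lambda\mathrm{x},\partial_\theta\mathrm{x}$ stack the corresponding blocks of the local Jacobians $\partial_{\bar\theta_i}x_i^\star$ (with $\partial_{\theta_j}x_i^\star=0$ for $j\ne i$). The coupling Jacobian $y=[D_\theta\nu^T\ D_\theta\lambda^T]^T$ is the derivative of the optimal coupling dual variables with respect to $\theta$, obtained from $D_\theta C=0$, i.e. $\partial C\,y=q$. *)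

theory Defs
  imports "HOL-Analysis.Analysis"
begin

section \<open>Coordinate subspaces, block vectors and block matrices\<close>

text \<open>
  The dimensions n_i of the agents' variables, the numbers of local constraints and the
  numbers of coupling constraints are arbitrary (possibly zero), so they cannot all be types.
  The space of real vectors indexed by a set S of elements of a finite type is represented by
  the coordinate subspace \<open>coord S\<close> of vectors vanishing outside S, and a matrix
  with rows and columns indexed by S by the S-by-S part of a matrix over the ambient type.
\<close>

definition coord :: "'a::finite set \<Rightarrow> (real^'a) set" where
  "coord S = {x. \<forall>k. k \<notin> S \<longrightarrow> x $ k = 0}"

definition vrestr :: "'a::finite set \<Rightarrow> real^'a \<Rightarrow> real^'a" where
  "vrestr S x = (\<chi> k. if k \<in> S then x $ k else 0)"

definition vjoin :: "real^'a::finite \<Rightarrow> real^'b::finite \<Rightarrow> real^('a + 'b)" where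
  "vjoin x y = (\<chi> k. case k of Inl a \<Rightarrow> x $ a | Inr b \<Rightarrow> y $ b)"

definition vfst :: "real^('a::finite + 'b::finite) \<Rightarrow> real^'a" where
  "vfst z = (\<chi> a. z $ Inl a)"

definition vsnd :: "real^('a::finite + 'b::finite) \<Rightarrow> real^'b" where
  "vsnd z = (\<chi> b. z $ Inr b)"

text \<open>The block matrix [A B], and the left and right column blocks of a matrix.\<close>

definition hcat :: "real^'a::finite^'r::finite \<Rightarrow> real^'b::finite^'r \<Rightarrow> real^('a + 'b)^'r" where
  "hcat A B = (\<chi> r. vjoin (A $ r) (B $ r))"

definition lcols :: "real^('a::finite + 'b::finite)^'r::finite \<Rightarrow> real^'a^'r" where
  "lcols A = (\<chi> r. vfst (A $ r))"

definition rcols :: "real^('a::finite + 'b::finite)^'r::finite \<Rightarrow> real^'b^'r" where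
  "rcols A = (\<chi> r. vsnd (A $ r))"

text \<open>
  Invertibility and inverse of the square submatrix of A with rows and columns in S.
  The inverse is extended by zero outside S (which makes it unique).
\<close>

definition is_inverse_on :: "'a::finite set \<Rightarrow> real^'a^'a \<Rightarrow> real^'a^'a \<Rightarrow> bool" where
  "is_inverse_on S A B \<longleftrightarrow>
     (\<forall>i j. i \<notin> S \<or> j \<notin> S \<longrightarrow> B $ i $ j = 0) \<and>
     (\<forall>i\<in>S. \<forall>j\<in>S. (\<Sum>k\<in>S. A $ i $ k * B $ k $ j) = (if i = j then 1 else 0)) \<and>
     (\<forall>i\<in>S. \<forall>j\<in>S. (\<Sum>k\<in>S. B $ i $ k * A $ k $ j) = (if i = j then 1 else 0))"

definition invertible_on :: "'a::finite set \<Rightarrow> real^'a^'a \<Rightarrow> bool" where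
  "invertible_on S A \<longleftrightarrow> (\<exists>B. is_inverse_on S A B)"

definition inverse_on :: "'a::finite set \<Rightarrow> real^'a^'a \<Rightarrow> real^'a^'a" where
  "inverse_on S A = (SOME B. is_inverse_on S A B)"

section \<open>Differentiation\<close>

definition grad :: "(real^'n::finite \<Rightarrow> real) \<Rightarrow> real^'n \<Rightarrow> real^'n" where
  "grad f x = (\<chi> k. frechet_derivative f (at x) (axis k 1))"

definition hessian :: "(real^'n::finite \<Rightarrow> real) \<Rightarrow> real^'n \<Rightarrow> real^'n^'n" where
  "hessian f x = jacobian (grad f) (at x)"

definition C2_near :: "('a::real_normed_vector \<Rightarrow> real) \<Rightarrow> 'a \<Rightarrow> bool" where
  "C2_near f w \<longleftrightarrow>
     (\<exists>S (f' :: 'a \<Rightarrow> 'a \<Rightarrow>\<^sub>L real) (f'' :: 'a \<Rightarrow> 'a \<Rightarrow>\<^sub>L ('a \<Rightarrow>\<^sub>L real)).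
        open S \<and> w \<in> S \<and>
        (\<forall>v\<in>S. (f has_derivative blinfun_apply (f' v)) (at v)) \<and>
        (\<forall>v\<in>S. (f' has_derivative blinfun_apply (f'' v)) (at v)) \<and>
        continuous_on S f'')"

section \<open>Separable constraint-coupled problems\<close>

text \<open>
  Type parameters: agents 'i, scalar decision variables 'v, scalar parameters 'p, local
  equality constraints 'e, local inequality constraints 'g, coupling equality constraints 'h,
  coupling inequality constraints 'k.  The stacked decision vector has type
  real^'v; every scalar variable belongs to exactly one agent, so
  n_i is the number of variables owned by i.  Every scalar parameter belongs
  to some agent (Some i) or to the common parameter (None).
  The fields \<open>leq_idx\<close>, \<open>lin_idx\<close>, \<open>ceq_idx\<close>, \<open>cin_idx\<close> list the constraints
  that are actually present; other components of the constraint functions are ignored.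
\<close>

record ('i, 'v, 'p, 'e, 'g, 'h, 'k) problem =
  var_owner :: "'v \<Rightarrow> 'i"
  par_owner :: "'p \<Rightarrow> 'i option"
  leq_idx :: "'i \<Rightarrow> 'e set"
  lin_idx :: "'i \<Rightarrow> 'g set"
  ceq_idx :: "'h set"
  cin_idx :: "'k set"
  obj_fun :: "'i \<Rightarrow> real^'v \<Rightarrow> real^'p \<Rightarrow> real"
  leq_fun :: "'i \<Rightarrow> real^'v \<Rightarrow> real^'p \<Rightarrow> real^'e"
  lin_fun :: "'i \<Rightarrow> real^'v \<Rightarrow> real^'p \<Rightarrow> real^'g"
  ceq_fun :: "'i \<Rightarrow> real^'v \<Rightarrow> real^'p \<Rightarrow> real^'h"
  cin_fun :: "'i \<Rightarrow> real^'v \<Rightarrow> real^'p \<Rightarrow> real^'k"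

definition xblk ::
  "('i::finite,'v::finite,'p::finite,'e::finite,'g::finite,'h::finite,'k::finite) problem
     \<Rightarrow> 'i \<Rightarrow> 'v set" where
  "xblk P i = {v. var_owner P v = i}"

definition pblk ::
  "('i::finite,'v::finite,'p::finite,'e::finite,'g::finite,'h::finite,'k::finite) problem
     \<Rightarrow> 'i option \<Rightarrow> 'p set" where
  "pblk P c = {k. par_owner P k = c}"

text \<open>
  The functions of agent i evaluated at the stacked vectors: they see only the block x_i and
  the block \<open>\<theta>\<close>_i (objective, local constraints) or \<open>\<theta>\<close>_c (coupling constraints).
  Gradients and derivatives with respect to the stacked vectors thus
  vanish in all other coordinates.
\<close>

definition objf ::
  "('i::finite,'v::finite,'p::finite,'e::finite,'g::finite,'h::finite,'k::finite) problem
     \<Rightarrow> 'i \<Rightarrow> real^'v \<Rightarrow> real^'p \<Rightarrow> real" where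
  "objf P i x \<theta> = obj_fun P i (vrestr (xblk P i) x) (vrestr (pblk P (Some i)) \<theta>)"

definition hloc ::
  "('i::finite,'v::finite,'p::finite,'e::finite,'g::finite,'h::finite,'k::finite) problem
     \<Rightarrow> 'i \<Rightarrow> real^'v \<Rightarrow> real^'p \<Rightarrow> real^'e" where
  "hloc P i x \<theta> = leq_fun P i (vrestr (xblk P i) x) (vrestr (pblk P (Some i)) \<theta>)"

definition gloc ::
  "('i::finite,'v::finite,'p::finite,'e::finite,'g::finite,'h::finite,'k::finite) problem
     \<Rightarrow> 'i \<Rightarrow> real^'v \<Rightarrow> real^'p \<Rightarrow> real^'g" where
  "gloc P i x \<theta> = lin_fun P i (vrestr (xblk P i) x) (vrestr (pblk P (Some i)) \<theta>)"

definition Hcp ::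
  "('i::finite,'v::finite,'p::finite,'e::finite,'g::finite,'h::finite,'k::finite) problem
     \<Rightarrow> 'i \<Rightarrow> real^'v \<Rightarrow> real^'p \<Rightarrow> real^'h" where
  "Hcp P i x \<theta> = ceq_fun P i (vrestr (xblk P i) x) (vrestr (pblk P None) \<theta>)"

definition Fcp ::
  "('i::finite,'v::finite,'p::finite,'e::finite,'g::finite,'h::finite,'k::finite) problem
     \<Rightarrow> 'i \<Rightarrow> real^'v \<Rightarrow> real^'p \<Rightarrow> real^'k" where
  "Fcp P i x \<theta> = cin_fun P i (vrestr (xblk P i) x) (vrestr (pblk P None) \<theta>)"

definition local_set ::
  "('i::finite,'v::finite,'p::finite,'e::finite,'g::finite,'h::finite,'k::finite) problem \<Rightarrow> 'i \<Rightarrow> real^'p \<Rightarrow> (real^'v) set" where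
  "local_set P i \<theta> = {x \<in> coord (xblk P i).
     (\<forall>j\<in>leq_idx P i. hloc P i x \<theta> $ j = 0) \<and> (\<forall>j\<in>lin_idx P i. gloc P i x \<theta> $ j \<le> 0)}"

definition convex_local_problems ::
  "('i::finite,'v::finite,'p::finite,'e::finite,'g::finite,'h::finite,'k::finite) problem \<Rightarrow> bool" where
  "convex_local_problems P \<longleftrightarrow>
     (\<forall>i \<theta>. convex_on (coord (xblk P i)) (\<lambda>x. objf P i x \<theta>) \<and> convex (local_set P i \<theta>))"

definition feasible ::
  "('i::finite,'v::finite,'p::finite,'e::finite,'g::finite,'h::finite,'k::finite) problem
     \<Rightarrow> real^'p \<Rightarrow> real^'v \<Rightarrow> bool" where
  "feasible P \<theta> x \<longleftrightarrow>
     (\<forall>i. vrestr (xblk P i) x \<in> local_set P i \<theta>) \<and>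
     (\<forall>j\<in>ceq_idx P. (\<Sum>i\<in>UNIV. Hcp P i x \<theta> $ j) = 0) \<and>
     (\<forall>j\<in>cin_idx P. (\<Sum>i\<in>UNIV. Fcp P i x \<theta> $ j) \<le> 0)"

definition is_minimizer ::
  "('i::finite,'v::finite,'p::finite,'e::finite,'g::finite,'h::finite,'k::finite) problem
     \<Rightarrow> real^'p \<Rightarrow> real^'v \<Rightarrow> bool" where
  "is_minimizer P \<theta> x \<longleftrightarrow> feasible P \<theta> x \<and>
     (\<forall>x'. feasible P \<theta> x' \<longrightarrow> (\<Sum>i\<in>UNIV. objf P i x \<theta>) \<le> (\<Sum>i\<in>UNIV. objf P i x' \<theta>))"

definition global_lagrangian ::
  "('i::finite,'v::finite,'p::finite,'e::finite,'g::finite,'h::finite,'k::finite) problem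
     \<Rightarrow> real^'v \<Rightarrow> ('i \<Rightarrow> real^'e) \<Rightarrow> ('i \<Rightarrow> real^'g) \<Rightarrow> real^'h \<Rightarrow> real^'k \<Rightarrow> real^'p \<Rightarrow> real" where
  "global_lagrangian P x \<pi> \<mu> \<nu> lam \<theta> =
     (\<Sum>i\<in>UNIV. objf P i x \<theta> + (\<Sum>j\<in>leq_idx P i. \<pi> i $ j * hloc P i x \<theta> $ j)
                             + (\<Sum>j\<in>lin_idx P i. \<mu> i $ j * gloc P i x \<theta> $ j))
     + (\<Sum>j\<in>ceq_idx P. \<nu> $ j * (\<Sum>i\<in>UNIV. Hcp P i x \<theta> $ j))
     + (\<Sum>j\<in>cin_idx P. lam $ j * (\<Sum>i\<in>UNIV. Fcp P i x \<theta> $ j))"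

definition global_kkt ::
  "('i::finite,'v::finite,'p::finite,'e::finite,'g::finite,'h::finite,'k::finite) problem
     \<Rightarrow> real^'p \<Rightarrow> real^'v \<Rightarrow> ('i \<Rightarrow> real^'e) \<Rightarrow> ('i \<Rightarrow> real^'g) \<Rightarrow> real^'h \<Rightarrow> real^'k \<Rightarrow> bool" where
  "global_kkt P \<theta> x \<pi> \<mu> \<nu> lam \<longleftrightarrow>
     (\<forall>i. \<pi> i \<in> coord (leq_idx P i) \<and> \<mu> i \<in> coord (lin_idx P i)) \<and>
     \<nu> \<in> coord (ceq_idx P) \<and> lam \<in> coord (cin_idx P) \<and>
     feasible P \<theta> x \<and>
     grad (\<lambda>x. global_lagrangian P x \<pi> \<mu> \<nu> lam \<theta>) x = 0 \<and>
     (\<forall>i. \<forall>j\<in>lin_idx P i. 0 \<le> \<mu> i $ j \<and> \<mu> i $ j * gloc P i x \<theta> $ j = 0) \<and>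
     (\<forall>j\<in>cin_idx P. 0 \<le> lam $ j \<and> lam $ j * (\<Sum>i\<in>UNIV. Fcp P i x \<theta> $ j) = 0)"

text \<open>Smoothness is joint in the stacked decision and parameter vectors.\<close>

definition smooth_data ::
  "('i::finite,'v::finite,'p::finite,'e::finite,'g::finite,'h::finite,'k::finite) problem
     \<Rightarrow> real^'p \<Rightarrow> real^'v \<Rightarrow> bool" where
  "smooth_data P \<theta> x \<longleftrightarrow>
     (\<forall>i. C2_near (\<lambda>(x, \<theta>). objf P i x \<theta>) (x, \<theta>) \<and>
          (\<forall>j\<in>leq_idx P i. C2_near (\<lambda>(x, \<theta>). hloc P i x \<theta> $ j) (x, \<theta>)) \<and>
          (\<forall>j\<in>lin_idx P i. C2_near (\<lambda>(x, \<theta>). gloc P i x \<theta> $ j) (x, \<theta>)) \<and>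
          (\<forall>j\<in>ceq_idx P. C2_near (\<lambda>(x, \<theta>). Hcp P i x \<theta> $ j) (x, \<theta>)) \<and>
          (\<forall>j\<in>cin_idx P. C2_near (\<lambda>(x, \<theta>). Fcp P i x \<theta> $ j) (x, \<theta>)))"

datatype ('i, 'e, 'g, 'h, 'k) con = LocEq 'i 'e | LocIn 'i 'g | CpEq 'h | CpIn 'k

primrec con_fun ::
  "('i::finite,'v::finite,'p::finite,'e::finite,'g::finite,'h::finite,'k::finite) problem
     \<Rightarrow> ('i,'e,'g,'h,'k) con \<Rightarrow> real^'v \<Rightarrow> real^'p \<Rightarrow> real" where
  "con_fun P (LocEq i j) x \<theta> = hloc P i x \<theta> $ j"
| "con_fun P (LocIn i j) x \<theta> = gloc P i x \<theta> $ j"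
| "con_fun P (CpEq j) x \<theta> = (\<Sum>i\<in>UNIV. Hcp P i x \<theta> $ j)"
| "con_fun P (CpIn j) x \<theta> = (\<Sum>i\<in>UNIV. Fcp P i x \<theta> $ j)"

definition constraints ::
  "('i::finite,'v::finite,'p::finite,'e::finite,'g::finite,'h::finite,'k::finite) problem
     \<Rightarrow> ('i,'e,'g,'h,'k) con set" where
  "constraints P =
     {LocEq i j | i j. j \<in> leq_idx P i} \<union> {LocIn i j | i j. j \<in> lin_idx P i} \<union>
     CpEq ` ceq_idx P \<union> CpIn ` cin_idx P"

definition binding ::
  "('i::finite,'v::finite,'p::finite,'e::finite,'g::finite,'h::finite,'k::finite) problem
     \<Rightarrow> real^'p \<Rightarrow> real^'v \<Rightarrow> ('i,'e,'g,'h,'k) con set" where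
  "binding P \<theta> x = {c \<in> constraints P. con_fun P c x \<theta> = 0}"

text \<open>Linear independence of the gradients as a family, hence the injectivity.\<close>

definition binding_independent ::
  "('i::finite,'v::finite,'p::finite,'e::finite,'g::finite,'h::finite,'k::finite) problem
     \<Rightarrow> real^'p \<Rightarrow> real^'v \<Rightarrow> bool" where
  "binding_independent P \<theta> x \<longleftrightarrow>
     inj_on (\<lambda>c. grad (\<lambda>x. con_fun P c x \<theta>) x) (binding P \<theta> x) \<and>
     independent ((\<lambda>c. grad (\<lambda>x. con_fun P c x \<theta>) x) ` binding P \<theta> x)"

definition strict_complementarity ::
  "('i::finite,'v::finite,'p::finite,'e::finite,'g::finite,'h::finite,'k::finite) problem
     \<Rightarrow> real^'p \<Rightarrow> real^'v \<Rightarrow> ('i \<Rightarrow> real^'g) \<Rightarrow> real^'k \<Rightarrow> bool" where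
  "strict_complementarity P \<theta> x \<mu> lam \<longleftrightarrow>
     (\<forall>i j. LocIn i j \<in> binding P \<theta> x \<longrightarrow> 0 < \<mu> i $ j) \<and>
     (\<forall>j. CpIn j \<in> binding P \<theta> x \<longrightarrow> 0 < lam $ j)"

section \<open>Subproblems and local Jacobians\<close>

text \<open>
  The primal-dual vector of subproblem i is z = vjoin x (vjoin \<open>\<pi>\<close> \<open>\<mu>\<close>) in \<open>coord (zidx P i)\<close>,
  and its augmented parameter is \<open>\<tau>\<close> = vjoin \<open>\<theta>\<close> (vjoin \<open>\<nu>\<close> lam).  The full parameter
  vector is kept in \<open>\<tau>\<close>; the columns of Jacobians belonging to other agents' parameters are zero.
\<close>

definition sub_lagrangian ::
  "('i::finite,'v::finite,'p::finite,'e::finite,'g::finite,'h::finite,'k::finite) problem \<Rightarrow> 'i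
     \<Rightarrow> real^'v \<Rightarrow> real^'e \<Rightarrow> real^'g \<Rightarrow> real^'h \<Rightarrow> real^'k \<Rightarrow> real^'p \<Rightarrow> real" where
  "sub_lagrangian P i x \<pi> \<mu> \<nu> lam \<theta> =
     objf P i x \<theta>
     + (\<Sum>j\<in>ceq_idx P. \<nu> $ j * Hcp P i x \<theta> $ j) + (\<Sum>j\<in>cin_idx P. lam $ j * Fcp P i x \<theta> $ j)
     + (\<Sum>j\<in>leq_idx P i. \<pi> $ j * hloc P i x \<theta> $ j) + (\<Sum>j\<in>lin_idx P i. \<mu> $ j * gloc P i x \<theta> $ j)"

definition second_order ::
  "('i::finite,'v::finite,'p::finite,'e::finite,'g::finite,'h::finite,'k::finite) problem \<Rightarrow> 'i
     \<Rightarrow> real^'v \<Rightarrow> real^'e \<Rightarrow> real^'g \<Rightarrow> real^'h \<Rightarrow> real^'k \<Rightarrow> real^'p \<Rightarrow> bool" where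
  "second_order P i x \<pi> \<mu> \<nu> lam \<theta> \<longleftrightarrow>
     (\<forall>u\<in>coord (xblk P i). u \<noteq> 0 \<longrightarrow>
        (\<forall>j\<in>lin_idx P i. gloc P i x \<theta> $ j = 0 \<longrightarrow> u \<bullet> grad (\<lambda>x. gloc P i x \<theta> $ j) x \<le> 0) \<longrightarrow>
        (\<forall>j\<in>lin_idx P i. 0 < \<mu> $ j \<longrightarrow> u \<bullet> grad (\<lambda>x. gloc P i x \<theta> $ j) x = 0) \<longrightarrow>
        (\<forall>j\<in>leq_idx P i. u \<bullet> grad (\<lambda>x. hloc P i x \<theta> $ j) x = 0) \<longrightarrow>
        0 < u \<bullet> (hessian (\<lambda>x. sub_lagrangian P i x \<pi> \<mu> \<nu> lam \<theta>) x *v u))"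

definition zidx ::
  "('i::finite,'v::finite,'p::finite,'e::finite,'g::finite,'h::finite,'k::finite) problem
     \<Rightarrow> 'i \<Rightarrow> ('v + 'e + 'g) set" where
  "zidx P i = xblk P i <+> (leq_idx P i <+> lin_idx P i)"

definition Gsub ::
  "('i::finite,'v::finite,'p::finite,'e::finite,'g::finite,'h::finite,'k::finite) problem \<Rightarrow> 'i
     \<Rightarrow> real^('v + 'e + 'g) \<Rightarrow> real^('p + 'h + 'k) \<Rightarrow> real^('v + 'e + 'g)" where
  "Gsub P i z \<tau> =
     (let x = vfst z; \<pi> = vfst (vsnd z); \<mu> = vsnd (vsnd z);
          \<theta> = vfst \<tau>; \<nu> = vfst (vsnd \<tau>); lam = vsnd (vsnd \<tau>)
      in vjoin (grad (\<lambda>x. sub_lagrangian P i x \<pi> \<mu> \<nu> lam \<theta>) x)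
           (vjoin (vrestr (leq_idx P i) (hloc P i x \<theta>))
                  (vrestr (lin_idx P i) (\<chi> j. \<mu> $ j * gloc P i x \<theta> $ j))))"

definition DzG ::
  "('i::finite,'v::finite,'p::finite,'e::finite,'g::finite,'h::finite,'k::finite) problem \<Rightarrow> 'i
     \<Rightarrow> real^('v + 'e + 'g) \<Rightarrow> real^('p + 'h + 'k) \<Rightarrow> real^('v + 'e + 'g)^('v + 'e + 'g)" where
  "DzG P i z \<tau> = jacobian (\<lambda>z. Gsub P i z \<tau>) (at z)"

definition DtG ::
  "('i::finite,'v::finite,'p::finite,'e::finite,'g::finite,'h::finite,'k::finite) problem \<Rightarrow> 'i
     \<Rightarrow> real^('v + 'e + 'g) \<Rightarrow> real^('p + 'h + 'k) \<Rightarrow> real^('p + 'h + 'k)^('v + 'e + 'g)" where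
  "DtG P i z \<tau> = jacobian (\<lambda>\<tau>. Gsub P i z \<tau>) (at \<tau>)"

definition local_jacobian ::
  "('i::finite,'v::finite,'p::finite,'e::finite,'g::finite,'h::finite,'k::finite) problem \<Rightarrow> 'i
     \<Rightarrow> real^('v + 'e + 'g) \<Rightarrow> real^('p + 'h + 'k) \<Rightarrow> real^('p + 'h + 'k)^'v" where
  "local_jacobian P i z \<tau> =
     - (hcat (mat 1) 0 ** inverse_on (zidx P i) (DzG P i z \<tau>) ** DtG P i z \<tau>)"

text \<open>
  A branch of primal-dual (KKT) solutions of subproblem i through z0, as the augmented
  parameter varies near \<open>\<tau>\<close>0; its primal part is the solution map whose Jacobian is meant.
\<close>

definition sub_kkt ::
  "('i::finite,'v::finite,'p::finite,'e::finite,'g::finite,'h::finite,'k::finite) problem \<Rightarrow> 'i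
     \<Rightarrow> real^('v + 'e + 'g) \<Rightarrow> real^('p + 'h + 'k) \<Rightarrow> bool" where
  "sub_kkt P i z \<tau> \<longleftrightarrow> z \<in> coord (zidx P i) \<and> Gsub P i z \<tau> = 0 \<and>
     (\<forall>j\<in>lin_idx P i. gloc P i (vfst z) (vfst \<tau>) $ j \<le> 0 \<and> 0 \<le> vsnd (vsnd z) $ j)"

definition local_branch ::
  "('i::finite,'v::finite,'p::finite,'e::finite,'g::finite,'h::finite,'k::finite) problem \<Rightarrow> 'i
     \<Rightarrow> real^('v + 'e + 'g) \<Rightarrow> real^('p + 'h + 'k) \<Rightarrow> (real^('p + 'h + 'k) \<Rightarrow> real^('v + 'e + 'g)) \<Rightarrow> bool" where
  "local_branch P i z0 \<tau>0 Z \<longleftrightarrow>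
     Z \<tau>0 = z0 \<and> isCont Z \<tau>0 \<and> (\<forall>\<^sub>F \<tau> in nhds \<tau>0. sub_kkt P i (Z \<tau>) \<tau>)"

section \<open>Coupling system\<close>

definition didx ::
  "('i::finite,'v::finite,'p::finite,'e::finite,'g::finite,'h::finite,'k::finite) problem
     \<Rightarrow> ('h + 'k) set" where
  "didx P = ceq_idx P <+> cin_idx P"

definition Ccp ::
  "('i::finite,'v::finite,'p::finite,'e::finite,'g::finite,'h::finite,'k::finite) problem
     \<Rightarrow> real^'v \<Rightarrow> real^'k \<Rightarrow> real^'p \<Rightarrow> real^('h + 'k)" where
  "Ccp P x lam \<theta> =
     vjoin (vrestr (ceq_idx P) (\<Sum>i\<in>UNIV. Hcp P i x \<theta>))
           (vrestr (cin_idx P) (\<chi> j. lam $ j * (\<Sum>i\<in>UNIV. Fcp P i x \<theta> $ j)))"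

text \<open>Row v of the stacked Jacobian comes from the local Jacobian of the agent owning v.\<close>

definition stacked_jacobian ::
  "('i::finite,'v::finite,'p::finite,'e::finite,'g::finite,'h::finite,'k::finite) problem
     \<Rightarrow> ('i \<Rightarrow> real^('v + 'e + 'g)) \<Rightarrow> real^('p + 'h + 'k) \<Rightarrow> real^('p + 'h + 'k)^'v" where
  "stacked_jacobian P z \<tau> =
     (\<chi> v. local_jacobian P (var_owner P v) (z (var_owner P v)) \<tau> $ v)"

definition z_of ::
  "('i::finite,'v::finite,'p::finite,'e::finite,'g::finite,'h::finite,'k::finite) problem
     \<Rightarrow> real^'v \<Rightarrow> ('i \<Rightarrow> real^'e) \<Rightarrow> ('i \<Rightarrow> real^'g) \<Rightarrow> 'i \<Rightarrow> real^('v + 'e + 'g)" where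
  "z_of P x \<pi> \<mu> i = vjoin (vrestr (xblk P i) x) (vjoin (\<pi> i) (\<mu> i))"

definition tau_of :: "real^'p::finite \<Rightarrow> real^'h::finite \<Rightarrow> real^'k::finite \<Rightarrow> real^('p + 'h + 'k)" where
  "tau_of \<theta> \<nu> lam = vjoin \<theta> (vjoin \<nu> lam)"

definition coupling_matrix ::
  "('i::finite,'v::finite,'p::finite,'e::finite,'g::finite,'h::finite,'k::finite) problem
     \<Rightarrow> real^'p \<Rightarrow> real^'v \<Rightarrow> ('i \<Rightarrow> real^'e) \<Rightarrow> ('i \<Rightarrow> real^'g) \<Rightarrow> real^'h \<Rightarrow> real^'k
     \<Rightarrow> real^('h + 'k)^('h + 'k)" where
  "coupling_matrix P \<theta> x \<pi> \<mu> \<nu> lam =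
     (let J = stacked_jacobian P (z_of P x \<pi> \<mu>) (tau_of \<theta> \<nu> lam);
          DxC = jacobian (\<lambda>x. Ccp P x lam \<theta>) (at x);
          DlC = jacobian (\<lambda>lam. Ccp P x lam \<theta>) (at lam)
      in - hcat (DxC ** lcols (rcols J)) (DxC ** rcols (rcols J) + DlC))"

definition coupling_rhs ::
  "('i::finite,'v::finite,'p::finite,'e::finite,'g::finite,'h::finite,'k::finite) problem
     \<Rightarrow> real^'p \<Rightarrow> real^'v \<Rightarrow> ('i \<Rightarrow> real^'e) \<Rightarrow> ('i \<Rightarrow> real^'g) \<Rightarrow> real^'h \<Rightarrow> real^'k
     \<Rightarrow> real^'p^('h + 'k)" where
  "coupling_rhs P \<theta> x \<pi> \<mu> \<nu> lam =
     (let J = stacked_jacobian P (z_of P x \<pi> \<mu>) (tau_of \<theta> \<nu> lam)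
      in jacobian (\<lambda>x. Ccp P x lam \<theta>) (at x) ** lcols J + jacobian (\<lambda>\<theta>. Ccp P x lam \<theta>) (at \<theta>))"

text \<open>
  Only the rows of y belonging to actual coupling constraints are part of the unknown.
\<close>

definition solves_coupling ::
  "('i::finite,'v::finite,'p::finite,'e::finite,'g::finite,'h::finite,'k::finite) problem
     \<Rightarrow> real^'p \<Rightarrow> real^'v \<Rightarrow> ('i \<Rightarrow> real^'e) \<Rightarrow> ('i \<Rightarrow> real^'g) \<Rightarrow> real^'h \<Rightarrow> real^'k
     \<Rightarrow> real^'p^('h + 'k) \<Rightarrow> bool" where
  "solves_coupling P \<theta> x \<pi> \<mu> \<nu> lam y \<longleftrightarrow>
     (\<forall>r. r \<notin> didx P \<longrightarrow> y $ r = 0) \<and>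
     coupling_matrix P \<theta> x \<pi> \<mu> \<nu> lam ** y = coupling_rhs P \<theta> x \<pi> \<mu> \<nu> lam"

text \<open>A branch of KKT solutions of the coupled problem through the given one, near \<open>\<theta>\<close>0.\<close>

definition global_branch ::
  "('i::finite,'v::finite,'p::finite,'e::finite,'g::finite,'h::finite,'k::finite) problem
     \<Rightarrow> real^'p \<Rightarrow> real^'v \<Rightarrow> ('i \<Rightarrow> real^'e) \<Rightarrow> ('i \<Rightarrow> real^'g) \<Rightarrow> real^'h \<Rightarrow> real^'k
     \<Rightarrow> (real^'p \<Rightarrow> real^'v) \<Rightarrow> (real^'p \<Rightarrow> 'i \<Rightarrow> real^'e) \<Rightarrow> (real^'p \<Rightarrow> 'i \<Rightarrow> real^'g)
     \<Rightarrow> (real^'p \<Rightarrow> real^'h) \<Rightarrow> (real^'p \<Rightarrow> real^'k) \<Rightarrow> bool" where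
  "global_branch P \<theta>0 x \<pi> \<mu> \<nu> lam X PI MU NU LA \<longleftrightarrow>
     X \<theta>0 = x \<and> PI \<theta>0 = \<pi> \<and> MU \<theta>0 = \<mu> \<and> NU \<theta>0 = \<nu> \<and> LA \<theta>0 = lam \<and>
     isCont X \<theta>0 \<and> (\<forall>i. isCont (\<lambda>\<theta>. PI \<theta> i) \<theta>0) \<and> (\<forall>i. isCont (\<lambda>\<theta>. MU \<theta> i) \<theta>0) \<and>
     isCont NU \<theta>0 \<and> isCont LA \<theta>0 \<and>
     (\<forall>\<^sub>F \<theta> in nhds \<theta>0. global_kkt P \<theta> (X \<theta>) (PI \<theta>) (MU \<theta>) (NU \<theta>) (LA \<theta>))"

end

(*
  Proof idea. The equations of a subproblem and of the coupled problem have the same linearization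
  pattern. If a displacement (u_i, p_i, m_i) of the local primal-dual variables and a displacement
  gamma of the coupling multipliers solve the linearized equations, pairing the stationarity rows
  with u_i and summing over the agents cancels all multiplier terms (by strict complementarity, each
  displacement of a multiplier or of its linearized constraint is zero), leaving
  sum_i u_i^T Hess(L_i) u_i = 0. The second order conditions of the subproblems give u = 0,
  and independence of the binding gradients of the global problem gives p = m = gamma = 0.
  With gamma = 0 and a single agent this is invertibility of the local matrix. The coupling matrix is
  the Schur complement of the full linearization, so it is injective as well. Branches exist by an
  open mapping argument, and strict complementarity preserves the signs along them.
*)
theory Submission
  imports Defs
begin

section \<open>Block vectors and coordinate subspaces\<close>

text \<open>Once the coupling terms are distributed over the agents, the Lagrangian is separable.
  Its second-order form splits into one term per agent, and the agents interact only through the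
  coupling multipliers; this is why conditions on each subproblem alone control the coupled
  linearization. Independence, by contrast, is assumed only for the global gradients: a coupling
  gradient is a sum of shares, so a relation among global gradients is recovered by adding up the
  stationarity rows of all agents. The derivative is computed for every continuous KKT branch, not
  just for a constructed one. The equations vanish along the branch, so its derivative solves the
  linearized equations, whose kernel is trivial; the Jacobian formulas are recognized by this
  property. Two obstacles shape the setup. Index sets are arbitrary subsets of finite types, so
  square systems live on coordinate subspaces and must be completed to the ambient space. And
  smoothness is given at the stacked point, whereas a subproblem is posed at its own block.\<close>

lemma vfst_vjoin [simp]: "vfst (vjoin x y) = x"
  and vsnd_vjoin [simp]: "vsnd (vjoin x y) = y"
  and vjoin_vfst_vsnd [simp]: "vjoin (vfst z) (vsnd z) = z"
  by (auto simp: vfst_def vsnd_def vjoin_def vec_eq_iff split: sum.splits)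

lemma vfst_nth [simp]: "vfst z $ a = z $ Inl a"
  and vsnd_nth [simp]: "vsnd z $ b = z $ Inr b"
  and vjoin_Inl [simp]: "vjoin x y $ Inl a = x $ a"
  and vjoin_Inr [simp]: "vjoin x y $ Inr b = y $ b"
  by (auto simp: vfst_def vsnd_def vjoin_def)

lemma vec_sum_eq_iff: "z = z' \<longleftrightarrow> vfst z = vfst z' \<and> vsnd z = vsnd z'"
  by (metis vjoin_vfst_vsnd)

lemma linear_vfst: "linear vfst" and linear_vsnd: "linear vsnd"
  by (auto intro!: linearI simp: vec_eq_iff)

lemma linear_vjoin: "linear (\<lambda>q. vjoin (fst q) (snd q))"
  by (auto intro!: linearI simp: vjoin_def vec_eq_iff split: sum.splits)

lemma linear_vrestr: "linear (vrestr S)"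
  by (auto intro!: linearI simp: vec_eq_iff vrestr_def)

lemmas bounded_linear_vfst = linear_conv_bounded_linear[THEN iffD1, OF linear_vfst]
  and bounded_linear_vsnd = linear_conv_bounded_linear[THEN iffD1, OF linear_vsnd]
  and bounded_linear_vjoin = linear_conv_bounded_linear[THEN iffD1, OF linear_vjoin]
  and bounded_linear_vrestr = linear_conv_bounded_linear[THEN iffD1, OF linear_vrestr]

lemmas vfst_linear [simp] = linear_add[OF linear_vfst] linear_diff[OF linear_vfst]
  linear_0[OF linear_vfst] linear_sum[OF linear_vfst] linear_scale[OF linear_vfst]
  linear_neg[OF linear_vfst]

lemmas vsnd_linear [simp] = linear_add[OF linear_vsnd] linear_diff[OF linear_vsnd]
  linear_0[OF linear_vsnd] linear_sum[OF linear_vsnd] linear_scale[OF linear_vsnd]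
  linear_neg[OF linear_vsnd]

lemma vjoin_0 [simp]: "vjoin 0 0 = 0"
  by (simp add: vec_sum_eq_iff)

lemma vjoin_add: "vjoin (a + b) (c + d) = vjoin a c + vjoin b d"
  by (simp add: vec_sum_eq_iff)

lemma vjoin_scaleR: "vjoin (r *\<^sub>R a) (r *\<^sub>R b) = r *\<^sub>R vjoin a b"
  by (simp add: vec_sum_eq_iff)

lemma coord_vjoin [simp]: "vjoin x y \<in> coord (S <+> T) \<longleftrightarrow> x \<in> coord S \<and> y \<in> coord T"
  by (auto simp: coord_def vjoin_def split: sum.splits)

lemma coord_Plus: "z \<in> coord (S <+> T) \<longleftrightarrow> vfst z \<in> coord S \<and> vsnd z \<in> coord T"
  by (metis coord_vjoin vjoin_vfst_vsnd)

lemma vrestr_nth: "vrestr S x $ k = (if k \<in> S then x $ k else 0)"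
  by (simp add: vrestr_def)

lemma vrestr_coord [simp]: "vrestr S x \<in> coord S"
  by (simp add: coord_def vrestr_def)

lemma vrestr_idem [simp]: "vrestr S (vrestr S x) = vrestr S x"
  by (simp add: vrestr_def vec_eq_iff)

lemma vrestr_eq_iff: "vrestr S x = x \<longleftrightarrow> x \<in> coord S"
  by (auto simp: coord_def vrestr_def vec_eq_iff)

lemma vrestr_ident [simp]: "x \<in> coord S \<Longrightarrow> vrestr S x = x"
  by (simp add: vrestr_eq_iff)

lemma subspace_coord: "subspace (coord S)"
  by (auto simp: subspace_def coord_def)

lemma coord_0 [simp]: "0 \<in> coord S"
  by (simp add: coord_def)

lemma in_coord_0_iff: "v \<in> coord S \<Longrightarrow> v = 0 \<longleftrightarrow> (\<forall>i\<in>S. v $ i = 0)"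
  by (auto simp: coord_def vec_eq_iff)

lemma hcat_mult_vec: "hcat A B *v z = A *v vfst z + B *v vsnd z"
  by (simp add: hcat_def matrix_vector_mult_def vec_eq_iff UNIV_Plus_UNIV[symmetric] sum.Plus
      del: UNIV_Plus_UNIV)

lemma lcols_mult_vec: "lcols A *v x = A *v vjoin x 0"
  and rcols_mult_vec: "rcols A *v y = A *v vjoin 0 y"
  by (simp_all add: lcols_def rcols_def matrix_vector_mult_def vec_eq_iff
      UNIV_Plus_UNIV[symmetric] sum.Plus del: UNIV_Plus_UNIV)

section \<open>Inverses of principal submatrices\<close>

text \<open>\<open>A\<close> is arbitrary outside the S-by-S part. Its other rows are killed by the
  zero columns of \<open>B\<close>, and its other columns by the zero entries of
  \<open>w\<close>.\<close>

lemma is_inverse_on_left: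
  assumes "is_inverse_on S A B" "w \<in> coord S"
  shows "B *v (A *v w) = w"
proof -
  have "(B *v (A *v w)) $ i = w $ i" for i
  proof (cases "i \<in> S")
    case False
    then show ?thesis
      using assms by (simp add: is_inverse_on_def matrix_vector_mult_def coord_def)
  next
    case True
    have "(B *v (A *v w)) $ i = (\<Sum>j\<in>UNIV. \<Sum>k\<in>UNIV. B $ i $ j * (A $ j $ k * w $ k))"
      by (simp add: matrix_vector_mult_def sum_distrib_left)
    also have "\<dots> = (\<Sum>j\<in>S. \<Sum>k\<in>S. B $ i $ j * (A $ j $ k * w $ k))"
      using assms by (intro sum.mono_neutral_cong_right)
        (auto simp: is_inverse_on_def coord_def intro!: sum.mono_neutral_right)
    also have "\<dots> = (\<Sum>k\<in>S. (\<Sum>j\<in>S. B $ i $ j * A $ j $ k) * w $ k)"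
      by (subst sum.swap) (simp add: sum_distrib_right mult.assoc)
    also have "\<dots> = (\<Sum>k\<in>S. if i = k then w $ k else 0)"
      using assms True by (intro sum.cong) (auto simp: is_inverse_on_def)
    also have "\<dots> = w $ i"
      using True by simp
    finally show ?thesis .
  qed
  then show ?thesis
    by (simp add: vec_eq_iff)
qed

text \<open>Here \<open>w\<close> is any vector, since \<open>B\<close> ignores its entries outside
  S. The price is that only the rows in S are controlled: the other rows of \<open>A\<close> are
  arbitrary.\<close>

lemma is_inverse_on_right:
  assumes "is_inverse_on S A B" "i \<in> S"
  shows "(A *v (B *v w)) $ i = w $ i"
proof -
  have "(A *v (B *v w)) $ i = (\<Sum>j\<in>UNIV. \<Sum>k\<in>UNIV. A $ i $ j * (B $ j $ k * w $ k))"
    by (simp add: matrix_vector_mult_def sum_distrib_left)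
  also have "\<dots> = (\<Sum>j\<in>S. \<Sum>k\<in>S. A $ i $ j * (B $ j $ k * w $ k))"
    using assms by (intro sum.mono_neutral_cong_right)
      (auto simp: is_inverse_on_def intro!: sum.mono_neutral_right)
  also have "\<dots> = (\<Sum>k\<in>S. (\<Sum>j\<in>S. A $ i $ j * B $ j $ k) * w $ k)"
    by (subst sum.swap) (simp add: sum_distrib_right mult.assoc)
  also have "\<dots> = (\<Sum>k\<in>S. if i = k then w $ k else 0)"
    using assms by (intro sum.cong) (auto simp: is_inverse_on_def)
  also have "\<dots> = w $ i"
    using assms by simp
  finally show ?thesis .
qed

lemma is_inverse_on_coord: "is_inverse_on S A B \<Longrightarrow> B *v w \<in> coord S"
  by (simp add: coord_def is_inverse_on_def matrix_vector_mult_def)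

lemma is_inverse_on_right_coord:
  assumes "is_inverse_on S A B" "w \<in> coord S" "A *v (B *v w) \<in> coord S"
  shows "A *v (B *v w) = w"
proof -
  have "(A *v (B *v w)) $ i = w $ i" for i
    using assms is_inverse_on_right[OF assms(1), of i w] by (cases "i \<in> S") (auto simp: coord_def)
  then show ?thesis by (simp add: vec_eq_iff)
qed

text \<open>Completing the S-by-S part by the identity gives a square matrix over the whole type,
  where injectivity yields a two-sided inverse; the S-by-S part of that inverse is the one
  wanted.\<close>

lemma invertible_onI:
  fixes A :: "real^'a::finite^'a"
  assumes inj: "\<And>w. w \<in> coord S \<Longrightarrow> (\<forall>i\<in>S. (A *v w) $ i = 0) \<Longrightarrow> w = 0"
  shows "invertible_on S A"
proof -
  \<comment> \<open>\<open>E\<close> is block diagonal: the S-part of \<open>A\<close> and the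
    identity on the complement. Hence a kernel vector of \<open>E\<close> vanishes outside S and is
    annihilated by the S-part of \<open>A\<close>.\<close>
  define E :: "real^'a^'a" where
    "E = (\<chi> i j. if i \<in> S \<and> j \<in> S then A $ i $ j else if i = j then 1 else 0)"
  have EU: "(\<Sum>k\<in>UNIV. E $ i $ k * f k) = (if i \<in> S then \<Sum>k\<in>S. A $ i $ k * f k else f i)" for i f
  proof (cases "i \<in> S")
    case True
    have "(\<Sum>k\<in>UNIV. E $ i $ k * f k) = (\<Sum>k\<in>S. A $ i $ k * f k)"
      using True by (intro sum.mono_neutral_cong_right) (auto simp: E_def)
    then show ?thesis using True by simp
  next
    case False
    then have "(\<Sum>k\<in>UNIV. E $ i $ k * f k) = (\<Sum>k\<in>UNIV. if i = k then f k else 0)"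
      by (intro sum.cong) (auto simp: E_def)
    then show ?thesis using False by simp
  qed
  have "w = 0" if "E *v w = 0" for w
  proof -
    have *: "(if i \<in> S then \<Sum>k\<in>S. A $ i $ k * w $ k else w $ i) = 0" for i
      using that EU[of i "\<lambda>k. w $ k"] by (simp add: matrix_vector_mult_def vec_eq_iff)
    have "w $ i = 0" if "i \<notin> S" for i
      using *[of i] that by simp
    then have w: "w \<in> coord S" by (simp add: coord_def)
    have "(A *v w) $ i = 0" if "i \<in> S" for i
    proof -
      have "(A *v w) $ i = (\<Sum>k\<in>S. A $ i $ k * w $ k)"
        using w unfolding matrix_vector_mult_def
        by (auto simp: coord_def intro!: sum.mono_neutral_right)
      then show ?thesis using *[of i] that by simp
    qed
    then show ?thesis using inj w by blast
  qed
  then have "inj ((*v) E)"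
    by (simp add: linear_injective_0)
  then obtain B where BE: "B ** E = mat 1"
    using matrix_left_invertible_injective by blast
  then have EB: "E ** B = mat 1"
    using matrix_left_right_inverse by blast
  have id: "(\<Sum>k\<in>S. A $ i $ k * B $ k $ j) = (if i = j then 1 else 0)" if "i \<in> S" for i j
  proof -
    have "(E ** B) $ i $ j = (\<Sum>k\<in>S. A $ i $ k * B $ k $ j)"
      using EU[of i "\<lambda>k. B $ k $ j"] that by (simp add: matrix_matrix_mult_def)
    then show ?thesis by (simp add: EB mat_def)
  qed
  have id': "(\<Sum>k\<in>S. B $ i $ k * A $ k $ j) = (if i = j then 1 else 0)" if "j \<in> S" for i j
  proof -
    have "(B ** E) $ i $ j = (\<Sum>k\<in>S. B $ i $ k * A $ k $ j)"
      unfolding matrix_matrix_mult_def using that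
      by (simp, intro sum.mono_neutral_cong_right) (auto simp: E_def)
    then show ?thesis by (simp add: BE mat_def)
  qed
  have "is_inverse_on S A (\<chi> i j. if i \<in> S \<and> j \<in> S then B $ i $ j else 0)"
    using id id' by (simp add: is_inverse_on_def)
  then show ?thesis
    unfolding invertible_on_def by blast
qed

lemma inverse_on: "invertible_on S A \<Longrightarrow> is_inverse_on S A (inverse_on S A)"
  unfolding invertible_on_def inverse_on_def by (rule someI_ex)

section \<open>Branches of implicit solutions\<close>

lemma isCont_nhds: "isCont f x \<Longrightarrow> (f \<longlongrightarrow> f x) (nhds x)"
  by (simp add: isCont_def tendsto_at_iff_tendsto_nhds)

text \<open>
  Differentiability of \<open>F\<close> at the base point makes every solution near it satisfy a Lipschitz bound
  in the parameter. This gives continuity of a branch whose points are chosen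
  arbitrarily, so the continuously differentiable implicit function theorem is not needed.
\<close>

lemma implicit_Lipschitz:
  fixes F :: "'a::euclidean_space \<times> 'b::euclidean_space \<Rightarrow> 'a"
  assumes deriv: "(F has_derivative F') (at (z0, t0))"
    and inj: "\<And>w. F' (w, 0) = 0 \<Longrightarrow> w = 0"
    and zero: "F (z0, t0) = 0"
  obtains K where "0 \<le> K"
    "\<forall>\<^sub>F q in nhds (z0, t0). F q = 0 \<longrightarrow> norm (fst q - z0) \<le> K * norm (snd q - t0)"
proof -
  have bl: "bounded_linear F'" using deriv by (rule has_derivative_bounded_linear)
  interpret F': bounded_linear F' by (rule bl)
  have lin: "linear (\<lambda>w. F' (w, 0))"
    by (intro linearI) (simp_all flip: F'.add F'.scaleR)
  moreover have "inj (\<lambda>w. F' (w, 0))"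
    using linear_injective_0[OF lin] inj by blast
  ultimately obtain c where c: "0 < c" "\<And>w. c * norm w \<le> norm (F' (w, 0))"
    using linear_inj_bounded_below_pos by blast
  obtain B where B: "0 \<le> B" "\<And>q. norm (F' q) \<le> norm q * B"
    using F'.nonneg_bounded by blast
  obtain e where e: "0 < e" and le: "\<And>q. norm (q - (z0, t0)) < e \<Longrightarrow>
      norm (F q - F (z0, t0) - F' (q - (z0, t0))) \<le> c / 2 * norm (q - (z0, t0))"
    using deriv c(1) unfolding has_derivative_at_alt by (meson half_gt_zero)
  \<comment> \<open>At a zero of \<open>F\<close> the remainder bound gives norm
    (\<open>F' (w, d)\<close>) \<le> c/2 (|w| + |d|). Together with the bound \<open>B\<close> for
    \<open>F' (0, d)\<close> this yields c |w| \<le> c/2 |w| + (B + c/2) |d|. The factor 1/2 lets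
    |w| be absorbed on the left.\<close>
  define K where "K = 2 / c * (B + c / 2)"
  have "norm (fst q - z0) \<le> K * norm (snd q - t0)"
    if "dist q (z0, t0) < e" and F: "F q = 0" for q
  proof -
    define w d where "w = fst q - z0" and "d = snd q - t0"
    have q: "q - (z0, t0) = (w, d)"
      by (simp add: w_def d_def prod_eq_iff)
    have n: "norm (w, d) \<le> norm w + norm d"
      by (rule norm_Pair_le)
    have 1: "norm (F' (w, d)) \<le> c / 2 * (norm w + norm d)"
      using le[of q] that zero q n c(1)
      by (simp add: dist_norm) (smt (verit, best) mult_left_mono)
    have "F' (w, 0) = F' (w, d) - F' (0, d)"
      by (simp flip: F'.diff)
    then have "c * norm w \<le> c / 2 * (norm w + norm d) + norm d * B"
      using c(2)[of w] 1 B(2)[of "(0, d)"] norm_triangle_ineq4[of "F' (w, d)" "F' (0, d)"]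
      by simp
    then have "c / 2 * norm w \<le> (B + c / 2) * norm d"
      unfolding distrib_left distrib_right by (simp add: mult.commute[of B])
    then have "norm w \<le> K * norm d"
      using c(1) by (simp add: K_def field_simps)
    then show ?thesis by (simp add: w_def d_def)
  qed
  then have "\<forall>\<^sub>F q in nhds (z0, t0). F q = 0 \<longrightarrow> norm (fst q - z0) \<le> K * norm (snd q - t0)"
    unfolding eventually_nhds_metric using e by blast
  moreover have "0 \<le> K" using B(1) c(1) by (simp add: K_def)
  ultimately show thesis by (rule that[rotated])
qed

text \<open>Recording the parameter next to \<open>F\<close> gives the square map \<open>Phi\<close>
  with invertible derivative at the base point. By the open mapping theorem its image covers all
  \<open>(0, t)\<close> with \<open>t\<close> near \<open>t0\<close>, so zeros exist for each such
  \<open>t\<close>. One is picked arbitrarily for each \<open>t\<close>, and the Lipschitz bound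
  makes the selection continuous at \<open>t0\<close>.\<close>

lemma implicit_branch_exists:
  fixes F :: "'a::euclidean_space \<times> 'b::euclidean_space \<Rightarrow> 'a"
  assumes diff: "\<forall>\<^sub>F q in nhds (z0, t0). F differentiable (at q)"
    and deriv: "(F has_derivative F') (at (z0, t0))"
    and inj: "\<And>w. F' (w, 0) = 0 \<Longrightarrow> w = 0"
    and zero: "F (z0, t0) = 0"
  shows "\<exists>Z. Z t0 = z0 \<and> isCont Z t0 \<and> (\<forall>\<^sub>F t in nhds t0. F (Z t, t) = 0)"
proof -
  obtain K where K: "0 \<le> K"
    "\<forall>\<^sub>F q in nhds (z0, t0). F q = 0 \<longrightarrow> norm (fst q - z0) \<le> K * norm (snd q - t0)"
    using implicit_Lipschitz[OF deriv inj zero] by blast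
  obtain S where S: "open S" "(z0, t0) \<in> S"
    "\<And>q. q \<in> S \<Longrightarrow> F differentiable (at q)"
    "\<And>q. q \<in> S \<Longrightarrow> F q = 0 \<Longrightarrow> norm (fst q - z0) \<le> K * norm (snd q - t0)"
    using eventually_conj[OF diff K(2)] unfolding eventually_nhds by blast
  interpret F': bounded_linear F'
    using deriv by (rule has_derivative_bounded_linear)
  define Phi where "Phi = (\<lambda>q. (F q, snd q))"
  define Phi' where "Phi' = (\<lambda>q. (F' q, snd q))"
  have d: "(Phi has_derivative Phi') (at (z0, t0))"
    unfolding Phi_def Phi'_def by (intro derivative_intros deriv)
  then have lin: "linear Phi'"
    by (rule has_derivative_linear)
  have "q = 0" if "Phi' q = 0" for q
    using that inj[of "fst q"] by (cases q) (auto simp: Phi'_def zero_prod_def)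
  then have "inj Phi'"
    using linear_injective_0[OF lin] by blast
  then obtain g where g: "linear g" "Phi' \<circ> g = id"
    using linear_injective_isomorphism[OF lin] by (auto simp: fun_eq_iff)
  have "continuous_on S Phi"
    unfolding Phi_def using S(3)
    by (intro continuous_intros continuous_at_imp_continuous_on ballI differentiable_imp_continuous_within)
  then have "Phi (z0, t0) \<in> interior (Phi ` S)"
    using sussmann_open_mapping[OF S(1) _ S(2) d _ g(2), of S] g(1) S(1,2)
    by (auto simp: linear_conv_bounded_linear interior_open)
  then have ev0: "\<forall>\<^sub>F p in nhds (0, t0). p \<in> Phi ` S"
    using zero by (auto simp: Phi_def eventually_nhds interior_def)
  have "filterlim (\<lambda>t. (0::'a, t)) (nhds (0, t0)) (nhds t0)"
    by (intro tendsto_Pair tendsto_const filterlim_ident)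
  from eventually_compose_filterlim[OF ev0 this]
  have ev: "\<forall>\<^sub>F t in nhds t0. \<exists>z. (z, t) \<in> S \<and> F (z, t) = 0"
    by (rule eventually_mono) (auto simp: Phi_def)
  define Z where "Z = (\<lambda>t. SOME z. (z, t) \<in> S \<and> F (z, t) = 0)"
  have Z: "\<forall>\<^sub>F t in nhds t0. (Z t, t) \<in> S \<and> F (Z t, t) = 0"
    using ev by (rule eventually_mono) (unfold Z_def, erule someI_ex)
  have bd: "\<forall>\<^sub>F t in nhds t0. norm (Z t - z0) \<le> K * norm (t - t0)"
    using Z by (rule eventually_mono) (use S(4) in fastforce)
  \<comment> \<open>At \<open>t = t0\<close> the bound reads norm (\<open>Z t0 - z0\<close>) \<le>
    0, so the arbitrary choice is forced to be the base point.\<close>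
  have Z0: "Z t0 = z0"
    using eventually_nhds_x_imp_x[OF bd] by simp
  have "((\<lambda>t. K * norm (t - t0)) \<longlongrightarrow> K * norm (t0 - t0)) (nhds t0)"
    by (intro tendsto_intros filterlim_ident)
  then have "((\<lambda>t. Z t - z0) \<longlongrightarrow> 0) (nhds t0)"
    by (intro Lim_null_comparison[OF bd]) simp
  then have "(Z \<longlongrightarrow> z0) (nhds t0)"
    by (simp add: LIM_zero_iff)
  then have "isCont Z t0"
    unfolding isCont_def Z0 by (rule filterlim_mono) (auto simp: at_within_def)
  then show ?thesis
    using Z0 Z by (auto elim: eventually_mono)
qed

text \<open>Applies to any continuous branch. Subtracting the linear solution, the error
  \<open>Z t - z0 - g d\<close> is mapped by \<open>F' (_, 0)\<close> to
  \<open>F' (Z t - z0, d)\<close>, which is of smaller order because \<open>F\<close> vanishes at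
  both points. The lower bound \<open>c\<close> carries this back to the error itself. The
  derivative is described only by its linearized equation, which determines it by
  injectivity.\<close>

lemma implicit_branch_has_derivative:
  fixes F :: "'a::euclidean_space \<times> 'b::euclidean_space \<Rightarrow> 'a"
  assumes deriv: "(F has_derivative F') (at (z0, t0))"
    and inj: "\<And>w. F' (w, 0) = 0 \<Longrightarrow> w = 0"
    and Z0: "Z t0 = z0" and cont: "isCont Z t0"
    and Z: "\<forall>\<^sub>F t in nhds t0. F (Z t, t) = 0"
  obtains g where "(Z has_derivative g) (at t0)" "\<And>d. F' (g d, d) = 0"
proof -
  have zero: "F (z0, t0) = 0"
    using eventually_nhds_x_imp_x[OF Z] Z0 by simp
  have bl: "bounded_linear F'" using deriv by (rule has_derivative_bounded_linear)
  interpret F': bounded_linear F' by (rule bl)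
  have lin: "linear (\<lambda>w. F' (w, 0))"
    by (intro linearI) (simp_all flip: F'.add F'.scaleR)
  have inj': "inj (\<lambda>w. F' (w, 0))"
    using linear_injective_0[OF lin] inj by blast
  then obtain c where c: "0 < c" "\<And>w. c * norm w \<le> norm (F' (w, 0))"
    using linear_inj_bounded_below_pos[OF lin] by blast
  obtain h where h: "linear h" "\<And>y. F' (h y, 0) = y"
    using linear_injective_isomorphism[OF lin inj'] by auto
  \<comment> \<open>\<open>h\<close> inverts the partial derivative in the unknown, so this is the
    solution of \<open>F' (g d, d) = 0\<close>.\<close>
  define g where "g = (\<lambda>d. - h (F' (0, d)))"
  have lin2: "linear (\<lambda>d. F' (0, d))"
    by (intro linearI) (simp_all flip: F'.add F'.scaleR)
  have "linear g"
    unfolding g_def using linear_compose[OF lin2 h(1)] by (intro linear_compose_neg) (simp add: o_def)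
  then have blg: "bounded_linear g"
    by (simp add: linear_conv_bounded_linear)
  have Fg: "F' (g d, d) = 0" for d
  proof -
    have "F' (g d, d) = F' (g d, 0) + F' (0, d)"
      by (simp flip: F'.add)
    also have "F' (g d, 0) = - F' (h (F' (0, d)), 0)"
      unfolding g_def using linear_neg[OF lin] by simp
    finally show ?thesis by (simp add: h(2))
  qed
  obtain K where K: "0 \<le> K"
    "\<forall>\<^sub>F q in nhds (z0, t0). F q = 0 \<longrightarrow> norm (fst q - z0) \<le> K * norm (snd q - t0)"
    using implicit_Lipschitz[OF deriv inj zero] by blast
  have "(Z \<longlongrightarrow> z0) (nhds t0)"
    using isCont_nhds[OF cont] Z0 by simp
  then have lim: "filterlim (\<lambda>t. (Z t, t)) (nhds (z0, t0)) (nhds t0)"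
    by (intro tendsto_Pair filterlim_ident)
  have bd: "\<forall>\<^sub>F t in nhds t0. norm (Z t - z0) \<le> K * norm (t - t0)"
    using eventually_conj[OF eventually_compose_filterlim[OF K(2) lim] Z]
    by (rule eventually_mono) simp
  have "\<exists>d>0. \<forall>t. norm (t - t0) < d \<longrightarrow> norm (Z t - Z t0 - g (t - t0)) \<le> e * norm (t - t0)"
    if e: "0 < e" for e
  proof -
    \<comment> \<open>The Lipschitz bound makes (\<open>Z t - z0\<close>, \<open>d\<close>) at most
      \<open>K + 1\<close> times as long as \<open>d\<close>, and dividing by the lower bound
      \<open>c\<close> must leave exactly \<open>e\<close>.\<close>
    define r where "r = e * c / (K + 1)"
    have r: "0 < r" using e c(1) K(1) by (simp add: r_def)
    then have "\<exists>s>0. \<forall>q. norm (q - (z0, t0)) < s \<longrightarrow>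
        norm (F q - F (z0, t0) - F' (q - (z0, t0))) \<le> r * norm (q - (z0, t0))"
      using deriv unfolding has_derivative_at_alt by blast
    then have "\<forall>\<^sub>F q in nhds (z0, t0).
        norm (F q - F (z0, t0) - F' (q - (z0, t0))) \<le> r * norm (q - (z0, t0))"
      by (simp add: eventually_nhds_metric dist_norm)
    from eventually_conj[OF eventually_compose_filterlim[OF this lim] eventually_conj[OF bd Z]]
    have "\<forall>\<^sub>F t in nhds t0. norm (Z t - Z t0 - g (t - t0)) \<le> e * norm (t - t0)"
    proof (rule eventually_mono, safe)
      fix t
      define d where "d = t - t0"
      assume b: "norm (Z t - z0) \<le> K * norm (t - t0)" and F: "F (Z t, t) = 0"
        and l: "norm (F (Z t, t) - F (z0, t0) - F' ((Z t, t) - (z0, t0))) \<le> r * norm ((Z t, t) - (z0, t0))"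
      have "F' (Z t - z0 - g d, 0) = F' (Z t - z0, d) - F' (g d, d)"
        by (simp flip: F'.diff)
      then have "c * norm (Z t - z0 - g d) \<le> norm (F' (Z t - z0, d))"
        using c(2)[of "Z t - z0 - g d"] by (simp add: Fg)
      also have "\<dots> \<le> r * norm (Z t - z0, d)"
        using l F zero by (simp add: d_def)
      also have "\<dots> \<le> r * ((K + 1) * norm d)"
        using b r norm_Pair_le[of "Z t - z0" d]
        by (intro mult_left_mono) (auto simp: d_def algebra_simps)
      also have "\<dots> = c * (e * norm d)"
        using K(1) by (simp add: r_def)
      finally show "norm (Z t - Z t0 - g (t - t0)) \<le> e * norm (t - t0)"
        using c(1) by (simp add: d_def Z0)
    qed
    then show ?thesis by (simp add: eventually_nhds_metric dist_norm)
  qed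
  then have "(Z has_derivative g) (at t0)"
    unfolding has_derivative_at_alt using blg by blast
  then show thesis using Fg that by blast
qed

section \<open>Gradients\<close>

lemma differentiable_transform_nhds:
  assumes "f differentiable (at q)" "\<forall>\<^sub>F q' in nhds q. f q' = g q'"
  shows "g differentiable (at q)"
proof -
  from assms(1) obtain f' where "(f has_derivative f') (at q)"
    unfolding differentiable_def by blast
  then have "(g has_derivative f') (at q)"
    using assms(2) eventually_nhds_x_imp_x[OF assms(2)]
    by (intro has_derivative_transform_eventually[of f f' q UNIV g])
      (auto simp: eventually_at_filter elim: eventually_mono)
  then show ?thesis unfolding differentiable_def by blast
qed

text \<open>The entries may themselves be vectors: the coupled system below stacks one primal-dual
  vector per agent.\<close>

lemma has_derivative_vecI:
  fixes f :: "'a::real_normed_vector \<Rightarrow> 'b::real_normed_vector^'n"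
  assumes "\<And>k. ((\<lambda>q. f q $ k) has_derivative (\<lambda>h. f' h $ k)) F"
  shows "(f has_derivative f') F"
proof -
  have ax: "(\<Sum>k\<in>UNIV. axis k (v $ k)) = v" for v :: "'b^'n"
    by (simp add: vec_eq_iff axis_def)
  have bl: "bounded_linear (axis k :: 'b \<Rightarrow> 'b^'n)" for k
    by (rule bounded_linear_intro[where K = 1])
      (auto simp: axis_def vec_eq_iff norm_vec_def L2_set_def if_distrib[of norm] if_distrib[of "\<lambda>x. x ^ 2"] cong: if_cong)
  have "((\<lambda>q. \<Sum>k\<in>UNIV. axis k (f q $ k)) has_derivative (\<lambda>h. \<Sum>k\<in>UNIV. axis k (f' h $ k))) F"
    by (intro has_derivative_sum bounded_linear.has_derivative[OF bl] assms)
  then show ?thesis by (simp only: ax)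
qed

lemma differentiable_vecI:
  fixes f :: "'a::real_normed_vector \<Rightarrow> 'b::real_normed_vector^'n"
  assumes "\<And>k. (\<lambda>q. f q $ k) differentiable F"
  shows "f differentiable F"
proof -
  from assms have "\<forall>k. \<exists>D. ((\<lambda>q. f q $ k) has_derivative D) F"
    by (simp add: differentiable_def)
  then obtain D where "\<And>k. ((\<lambda>q. f q $ k) has_derivative D k) F"
    by metis
  then have "(f has_derivative (\<lambda>h. \<chi> k. D k h)) F"
    by (intro has_derivative_vecI) simp
  then show ?thesis unfolding differentiable_def by blast
qed

lemma has_derivative_gradI:
  assumes "(f has_derivative (\<lambda>h. g \<bullet> h)) (at x)"
  shows "grad f x = g"
  using frechet_derivative_at[OF assms, symmetric]
  by (simp add: grad_def vec_eq_iff inner_axis)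

lemma has_derivative_grad:
  fixes f :: "real^'n \<Rightarrow> real"
  assumes "f differentiable (at x)"
  shows "(f has_derivative (\<lambda>h. grad f x \<bullet> h)) (at x)"
proof -
  have d: "(f has_derivative frechet_derivative f (at x)) (at x)"
    using assms by (simp add: frechet_derivative_works)
  have lin: "linear (frechet_derivative f (at x))"
    using d by (rule has_derivative_linear)
  have "frechet_derivative f (at x) h = grad f x \<bullet> h" for h
  proof -
    have "frechet_derivative f (at x) h = frechet_derivative f (at x) (\<Sum>k\<in>UNIV. h $ k *\<^sub>R axis k 1)"
      using basis_expansion[of h] by (simp add: scalar_mult_eq_scaleR)
    also have "\<dots> = grad f x \<bullet> h"
      by (simp add: linear_sum[OF lin] linear_scale[OF lin] grad_def inner_vec_def mult.commute)
    finally show ?thesis .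
  qed
  then have "frechet_derivative f (at x) = (\<lambda>h. grad f x \<bullet> h)" by blast
  with d show ?thesis by simp
qed

lemma grad_add:
  assumes "f differentiable (at x)" "g differentiable (at x)"
  shows "grad (\<lambda>x. f x + g x) x = grad f x + grad g x"
  using assms[THEN has_derivative_grad]
  by (intro has_derivative_gradI) (auto simp: inner_add_left intro: derivative_intros)

lemma grad_sum:
  assumes "\<And>i. i \<in> I \<Longrightarrow> f i differentiable (at x)"
  shows "grad (\<lambda>x. \<Sum>i\<in>I. f i x) x = (\<Sum>i\<in>I. grad (f i) x)"
  using assms[THEN has_derivative_grad]
  by (intro has_derivative_gradI) (auto simp: inner_sum_left intro!: derivative_intros)

lemma grad_cmult:
  assumes "f differentiable (at x)"
  shows "grad (\<lambda>x. c * f x) x = c *\<^sub>R grad f x"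
  using assms[THEN has_derivative_grad]
  by (intro has_derivative_gradI) (auto intro!: derivative_eq_intros)

lemma jacobian_mult_vec:
  fixes f :: "real^'n \<Rightarrow> real^'m"
  assumes "(f has_derivative f') (at x)"
  shows "jacobian f (at x) *v h = f' h"
proof -
  have "(f has_derivative (\<lambda>h. jacobian f (at x) *v h)) (at x)"
    unfolding jacobian_works[symmetric] differentiable_def using assms by blast
  from has_derivative_unique[OF this assms] show ?thesis by meson
qed

text \<open>Shift invariance of derivatives is what moves data from the stacked point to its blocks.\<close>

lemma has_derivative_shift_iff:
  assumes "\<And>y. f (y + c) = f y"
  shows "(f has_derivative f') (at (x + c)) \<longleftrightarrow> (f has_derivative f') (at x)"
proof -
  have *: "(f has_derivative f') (at (x + c))" if "(f has_derivative f') (at x)"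
    "\<And>y. f (y + c) = f y" for x c
  proof -
    have "((\<lambda>y. f (y - c)) has_derivative (\<lambda>h. f' h)) (at (x + c))"
      by (rule has_derivative_compose[where f = "\<lambda>y. y - c" and f' = "\<lambda>h. h"])
        (use that(1) in \<open>auto intro!: derivative_eq_intros\<close>)
    moreover have "(\<lambda>y. f (y - c)) = f"
      using that(2)[of "_ - c"] by (simp add: fun_eq_iff)
    ultimately show ?thesis by simp
  qed
  have "f (y + - c) = f y" for y
    using assms[of "y - c"] by simp
  then show ?thesis
    using *[of x c] *[of "x + c" "- c"] assms by auto
qed

text \<open>\<open>frechet_derivative\<close> is a choice among all derivatives at a point. The two
  points admit the same derivatives, so the choices agree even where \<open>f\<close> is not
  differentiable.\<close>

lemma grad_shift:
  assumes "\<And>y. f (y + c) = f y"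
  shows "grad f (x + c) = grad f x"
  unfolding grad_def frechet_derivative_def by (simp add: has_derivative_shift_iff assms)

lemma hessian_shift:
  assumes "\<And>y. f (y + c) = f y"
  shows "hessian f (x + c) = hessian f x"
  unfolding hessian_def jacobian_def frechet_derivative_def
  by (simp add: has_derivative_shift_iff grad_shift assms)

lemma C2_near_shift:
  assumes "C2_near f w" "\<And>y. f (y + c) = f y"
  shows "C2_near f (w + c)"
proof -
  from assms(1) obtain S f' f'' where S: "open S" "w \<in> S"
    "\<And>v. v \<in> S \<Longrightarrow> (f has_derivative blinfun_apply (f' v)) (at v)"
    "\<And>v. v \<in> S \<Longrightarrow> (f' has_derivative blinfun_apply (f'' v)) (at v)"
    "continuous_on S f''"
    unfolding C2_near_def by blast
  have 1: "(f has_derivative blinfun_apply (f' (v - c))) (at v)" if "v - c \<in> S" for v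
    using S(3)[OF that] has_derivative_shift_iff[of f c _ "v - c"] assms(2) by simp
  have 2: "((\<lambda>v. f' (v - c)) has_derivative blinfun_apply (f'' (v - c))) (at v)" if "v - c \<in> S" for v
    by (rule has_derivative_compose[where f = "\<lambda>y. y - c" and f' = "\<lambda>h. h"])
      (use S(4)[OF that] in \<open>auto intro!: derivative_eq_intros\<close>)
  have 3: "continuous_on ((\<lambda>v. v - c) -` S) (\<lambda>v. f'' (v - c))"
    by (rule continuous_on_compose2[OF S(5)]) (auto intro!: continuous_intros)
  have 4: "open ((\<lambda>v. v - c) -` S)"
    by (intro open_vimage S continuous_intros)
  show ?thesis
    unfolding C2_near_def
    by (rule exI[of _ "(\<lambda>v. v - c) -` S"], rule exI[of _ "\<lambda>v. f' (v - c)"],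
        rule exI[of _ "\<lambda>v. f'' (v - c)"]) (use 1 2 3 4 S(2) in auto)
qed

text \<open>\<open>f\<close> is constant along each axis outside S, so the corresponding partial
  derivatives vanish.\<close>

lemma grad_coord:
  assumes "f differentiable (at x)" "\<And>y. f (vrestr S y) = f y"
  shows "grad f x \<in> coord S"
proof -
  have "grad f x $ k = 0" if "k \<notin> S" for k
  proof -
    have "((\<lambda>t. f (x + t *\<^sub>R axis k 1)) has_derivative (\<lambda>t. grad f x \<bullet> (t *\<^sub>R axis k 1))) (at (0::real))"
      by (rule has_derivative_compose[where g = f and f = "\<lambda>t. x + t *\<^sub>R axis k 1"])
        (use has_derivative_grad[OF assms(1)] in \<open>auto intro!: derivative_eq_intros\<close>)
    moreover have "f (x + t *\<^sub>R axis k 1) = f x" for t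
    proof -
      have "vrestr S (x + t *\<^sub>R axis k 1) = vrestr S x"
        using that by (auto simp: vrestr_def vec_eq_iff axis_def)
      then show ?thesis using assms(2) by metis
    qed
    ultimately have "((\<lambda>t. f x) has_derivative (\<lambda>t. grad f x \<bullet> (t *\<^sub>R axis k 1))) (at (0::real))"
      by simp
    then have "(\<lambda>t. grad f x \<bullet> (t *\<^sub>R axis k 1)) = (\<lambda>t::real. 0)"
      by (rule has_derivative_unique) simp
    from fun_cong[OF this, of 1] show ?thesis
      by (simp add: inner_axis)
  qed
  then show ?thesis by (simp add: coord_def)
qed

section \<open>Parametrized functions with differentiable gradients\<close>

text \<open>The consequence of C2 smoothness that the KKT equations use: the function and its
  gradient in the first argument are differentiable jointly in variable and parameter. It passes
  from the data to Lagrangians whose multipliers count as parameters.\<close>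

definition grad_differentiable ::
  "(real^'n::finite \<Rightarrow> 'p::real_normed_vector \<Rightarrow> real) \<Rightarrow> (real^'n) \<times> 'p \<Rightarrow> bool" where
  "grad_differentiable f q \<longleftrightarrow>
     (\<lambda>q. f (fst q) (snd q)) differentiable (at q) \<and>
     (\<lambda>q. grad (\<lambda>x. f x (snd q)) (fst q)) differentiable (at q)"

lemma differentiable_partial:
  assumes "(\<lambda>q. f (fst q) (snd q)) differentiable (at (x, t))"
  shows "(\<lambda>x. f x t) differentiable (at x)"
proof -
  have "(\<lambda>x. (\<lambda>q. f (fst q) (snd q)) (x, t)) differentiable (at x)"
    by (rule differentiable_compose) (use assms in auto)
  then show ?thesis by simp
qed

lemma has_derivative_partial:
  assumes "((\<lambda>q. f (fst q) (snd q)) has_derivative D) (at (x, t))"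
  shows "((\<lambda>x. f x t) has_derivative (\<lambda>h. D (h, 0))) (at x)"
proof -
  have "((\<lambda>x. (\<lambda>q. f (fst q) (snd q)) (x, t)) has_derivative (\<lambda>h. D (h, 0))) (at x)"
    by (rule has_derivative_compose) (use assms in \<open>auto intro!: derivative_eq_intros\<close>)
  then show ?thesis by simp
qed

lemma has_derivative_partial2:
  assumes "((\<lambda>q. f (fst q) (snd q)) has_derivative D) (at (x, t))"
  shows "((\<lambda>t. f x t) has_derivative (\<lambda>h. D (0, h))) (at t)"
proof -
  have "((\<lambda>t. (\<lambda>q. f (fst q) (snd q)) (x, t)) has_derivative (\<lambda>h. D (0, h))) (at t)"
    by (rule has_derivative_compose) (use assms in \<open>auto intro!: derivative_eq_intros\<close>)
  then show ?thesis by simp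
qed

lemma derivative_partial_grad:
  assumes "((\<lambda>q. f (fst q) (snd q)) has_derivative D) (at (x, t))"
  shows "D (h, 0) = grad (\<lambda>x. f x t) x \<bullet> h"
proof -
  have "((\<lambda>x. f x t) has_derivative (\<lambda>h. D (h, 0))) (at x)"
    by (rule has_derivative_partial) (rule assms)
  moreover from this have "((\<lambda>x. f x t) has_derivative (\<lambda>h. grad (\<lambda>x. f x t) x \<bullet> h)) (at x)"
    by (intro has_derivative_grad) (auto simp: differentiable_def)
  ultimately show ?thesis
    using has_derivative_unique by (metis (no_types, lifting))
qed

text \<open>On a whole neighbourhood the k-th partial derivative is \<open>f'\<close> applied to the
  fixed direction \<open>(axis k 1, 0)\<close>, a bounded linear image of the differentiable map
  \<open>f'\<close>.\<close>

lemma C2_near_grad_differentiable: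
  assumes "C2_near (\<lambda>(x, t). f x t) q0"
  shows "\<forall>\<^sub>F q in nhds q0. grad_differentiable f q"
proof -
  from assms obtain S f' f'' where S: "open S" "q0 \<in> S"
    "\<And>v. v \<in> S \<Longrightarrow> ((\<lambda>(x, t). f x t) has_derivative blinfun_apply (f' v)) (at v)"
    "\<And>v. v \<in> S \<Longrightarrow> (f' has_derivative blinfun_apply (f'' v)) (at v)"
    unfolding C2_near_def by blast
  have d: "((\<lambda>q. f (fst q) (snd q)) has_derivative blinfun_apply (f' v)) (at v)" if "v \<in> S" for v
    using S(3)[OF that] by (simp add: case_prod_unfold)
  have g: "grad (\<lambda>x. f x (snd v)) (fst v) $ k = blinfun_apply (f' v) (axis k 1, 0)" if "v \<in> S" for v k
    using derivative_partial_grad[of f "blinfun_apply (f' v)" "fst v" "snd v" "axis k 1"] d[OF that]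
    by (simp add: inner_axis)
  have "grad_differentiable f v" if v: "v \<in> S" for v
  proof -
    have "(\<lambda>q. grad (\<lambda>x. f x (snd q)) (fst q) $ k) differentiable (at v)" for k
    proof (rule differentiable_transform_nhds)
      show "(\<lambda>q. blinfun_apply (f' q) (axis k 1, 0)) differentiable (at v)"
        using bounded_linear.has_derivative[OF blinfun.bounded_linear_left S(4)[OF v]]
        unfolding differentiable_def by blast
      show "\<forall>\<^sub>F q in nhds v. blinfun_apply (f' q) (axis k 1, 0) = grad (\<lambda>x. f x (snd q)) (fst q) $ k"
        using S(1) v g by (auto simp: eventually_nhds)
    qed
    from differentiable_vecI[OF this] show ?thesis
      unfolding grad_differentiable_def using d[OF v] by (auto simp: differentiable_def)
  qed
  then show ?thesis
    using S(1,2) eventually_nhds by blast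
qed

text \<open>The multipliers sit in the parameter slot, next to the data parameter, so that the
  gradient in x can be differentiated in all of them at once.\<close>

definition lagr ::
  "(real^'n \<Rightarrow> 'p \<Rightarrow> real) \<Rightarrow> ('c \<Rightarrow> real^'n \<Rightarrow> 'p \<Rightarrow> real) \<Rightarrow> 'c set \<Rightarrow> real^'n \<Rightarrow> (real^'c) \<times> 'p \<Rightarrow> real" where
  "lagr f g I x p = f x (snd p) + (\<Sum>c\<in>I. fst p $ c * g c x (snd p))"

lemma grad_lagr:
  assumes "(\<lambda>x. f x t) differentiable (at x)" "\<And>c. c \<in> I \<Longrightarrow> (\<lambda>x. g c x t) differentiable (at x)"
  shows "grad (\<lambda>x. lagr f g I x (m, t)) x =
    grad (\<lambda>x. f x t) x + (\<Sum>c\<in>I. m $ c *\<^sub>R grad (\<lambda>x. g c x t) x)"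
proof -
  have "(\<lambda>x. m $ c * g c x t) differentiable (at x)" if "c \<in> I" for c
    using assms(2)[OF that] by (intro differentiable_mult) auto
  then show ?thesis
    using assms by (simp add: lagr_def grad_add grad_sum grad_cmult)
qed

lemma grad_differentiable_lagr:
  fixes f :: "real^'n \<Rightarrow> 'p::real_normed_vector \<Rightarrow> real"
    and g :: "'c::finite \<Rightarrow> real^'n \<Rightarrow> 'p \<Rightarrow> real"
  assumes f: "\<forall>\<^sub>F q in nhds (x0, t0). grad_differentiable f q"
    and g: "\<And>c. c \<in> I \<Longrightarrow> \<forall>\<^sub>F q in nhds (x0, t0). grad_differentiable (g c) q"
  shows "\<forall>\<^sub>F q in nhds (x0, (m0, t0)). grad_differentiable (lagr f g I) q"
proof -
  define A where "A = (\<lambda>q::(real^'n) \<times> (real^'c) \<times> 'p. (fst q, snd (snd q)))"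
  have Ad: "A differentiable F" for F
    unfolding A_def by (intro bounded_linear_imp_differentiable bounded_linear_intros)
  define ok where "ok = (\<lambda>q. grad_differentiable f (A q) \<and> (\<forall>c\<in>I. grad_differentiable (g c) (A q)))"
  have lim: "filterlim A (nhds (x0, t0)) (nhds (x0, (m0, t0)))"
    using isCont_nhds[OF differentiable_imp_continuous_within[OF Ad], of "(x0, (m0, t0))"]
    by (simp only: A_def fst_conv snd_conv)
  have "\<forall>\<^sub>F q in nhds (x0, t0). grad_differentiable f q \<and> (\<forall>c\<in>I. grad_differentiable (g c) q)"
    using f g by (intro eventually_conj eventually_ball_finite) auto
  from eventually_compose_filterlim[OF this lim]
  have ok: "\<forall>\<^sub>F q in nhds (x0, (m0, t0)). ok q"
    by (simp add: ok_def)
  have diff: "(\<lambda>q. h (fst q) (snd (snd q))) differentiable (at q)"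
      "(\<lambda>x. h x (snd (snd q))) differentiable (at (fst q))"
      "(\<lambda>q. grad (\<lambda>x. h x (snd (snd q))) (fst q)) differentiable (at q)"
    if "grad_differentiable h (A q)" for h q
  proof -
    have "(\<lambda>q. (\<lambda>q. h (fst q) (snd q)) (A q)) differentiable (at q)"
      by (rule differentiable_compose[OF _ Ad]) (use that in \<open>simp add: grad_differentiable_def\<close>)
    then show "(\<lambda>q. h (fst q) (snd (snd q))) differentiable (at q)"
      by (simp add: A_def)
    have "(\<lambda>q. (\<lambda>q. grad (\<lambda>x. h x (snd q)) (fst q)) (A q)) differentiable (at q)"
      by (rule differentiable_compose[OF _ Ad]) (use that in \<open>simp add: grad_differentiable_def\<close>)
    then show "(\<lambda>q. grad (\<lambda>x. h x (snd (snd q))) (fst q)) differentiable (at q)"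
      by (simp add: A_def)
    show "(\<lambda>x. h x (snd (snd q))) differentiable (at (fst q))"
      by (rule differentiable_partial) (use that in \<open>simp add: grad_differentiable_def A_def\<close>)
  qed
  have m: "(\<lambda>q. fst (snd q) $ c) differentiable (at q)" for c and q :: "(real^'n) \<times> (real^'c) \<times> 'p"
    by (intro bounded_linear_imp_differentiable bounded_linear_compose[OF bounded_linear_vec_nth]
        bounded_linear_intros)
  have "\<forall>\<^sub>F q in nhds (x0, (m0, t0)). \<forall>\<^sub>F q' in nhds q. ok q'"
    using ok by (simp add: eventually_eventually)
  then show ?thesis
  proof (rule eventually_mono)
    \<comment> \<open>The expansion of the Lagrangian gradient is valid only where the data are
      differentiable. Differentiating it at \<open>q\<close> therefore requires \<open>ok\<close> on
      a neighbourhood of \<open>q\<close>, not just at \<open>q\<close>.\<close>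
    fix q assume ev: "\<forall>\<^sub>F q' in nhds q. ok q'"
    then have q: "ok q" by (rule eventually_nhds_x_imp_x)
    then have qf: "grad_differentiable f (A q)" and qg: "\<And>c. c \<in> I \<Longrightarrow> grad_differentiable (g c) (A q)"
      by (auto simp: ok_def)
    have "(\<lambda>q. lagr f g I (fst q) (snd q)) differentiable (at q)"
      unfolding lagr_def
      by (intro differentiable_add differentiable_sum ballI differentiable_mult m
          diff(1)[OF qf] diff(1)[OF qg]) auto
    moreover have "(\<lambda>q. grad (\<lambda>x. lagr f g I x (snd q)) (fst q)) differentiable (at q)"
    proof (rule differentiable_transform_nhds)
      show "(\<lambda>q. grad (\<lambda>x. f x (snd (snd q))) (fst q) + (\<Sum>c\<in>I. fst (snd q) $ c *\<^sub>R
          grad (\<lambda>x. g c x (snd (snd q))) (fst q))) differentiable (at q)"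
        by (intro differentiable_add differentiable_sum ballI differentiable_scaleR m
            diff(3)[OF qf] diff(3)[OF qg]) auto
      show "\<forall>\<^sub>F q in nhds q. grad (\<lambda>x. f x (snd (snd q))) (fst q) + (\<Sum>c\<in>I. fst (snd q) $ c *\<^sub>R
          grad (\<lambda>x. g c x (snd (snd q))) (fst q)) = grad (\<lambda>x. lagr f g I x (snd q)) (fst q)"
        using ev
      proof (rule eventually_mono)
        fix q assume "ok q"
        then show "grad (\<lambda>x. f x (snd (snd q))) (fst q) + (\<Sum>c\<in>I. fst (snd q) $ c *\<^sub>R
            grad (\<lambda>x. g c x (snd (snd q))) (fst q)) = grad (\<lambda>x. lagr f g I x (snd q)) (fst q)"
          using grad_lagr[of f "snd (snd q)" "fst q" I g "fst (snd q)"] diff(2)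
          by (auto simp: ok_def)
      qed
    qed
    ultimately show "grad_differentiable (lagr f g I) q"
      by (simp add: grad_differentiable_def)
  qed
qed

text \<open>The gradient is affine in the multipliers, so moving them adds a combination of
  constraint gradients, while moving x contributes the Hessian. With the data parameter at rest this
  is the stationarity row of the KKT matrix.\<close>

lemma derivative_grad_lagr:
  fixes f :: "real^'n \<Rightarrow> 'p::real_normed_vector \<Rightarrow> real"
    and g :: "'c::finite \<Rightarrow> real^'n \<Rightarrow> 'p \<Rightarrow> real"
  assumes D: "((\<lambda>q. grad (\<lambda>x. lagr f g I x (snd q)) (fst q)) has_derivative D) (at (x0, (m0, t0)))"
    and f: "(\<lambda>x. f x t0) differentiable (at x0)"
    and g: "\<And>c. c \<in> I \<Longrightarrow> (\<lambda>x. g c x t0) differentiable (at x0)"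
  shows "D (h, (dm, 0)) = hessian (\<lambda>x. lagr f g I x (m0, t0)) x0 *v h
    + (\<Sum>c\<in>I. dm $ c *\<^sub>R grad (\<lambda>x. g c x t0) x0)"
proof -
  have lin: "linear D" using D by (rule has_derivative_linear)
  have "((\<lambda>x. grad (\<lambda>x. lagr f g I x (m0, t0)) x) has_derivative (\<lambda>h. D (h, 0))) (at x0)"
    using has_derivative_partial[of "\<lambda>x p. grad (\<lambda>x. lagr f g I x p) x"] D by simp
  then have 1: "D (h, 0) = hessian (\<lambda>x. lagr f g I x (m0, t0)) x0 *v h"
    unfolding hessian_def by (simp add: jacobian_mult_vec)
  have "((\<lambda>p. grad (\<lambda>x. lagr f g I x p) x0) has_derivative (\<lambda>h. D (0, h))) (at (m0, t0))"
    using has_derivative_partial2[of "\<lambda>x p. grad (\<lambda>x. lagr f g I x p) x"] D by simp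
  then have "((\<lambda>m. (\<lambda>p. grad (\<lambda>x. lagr f g I x p) x0) (m, t0)) has_derivative (\<lambda>h. D (0, (h, 0)))) (at m0)"
    by (rule has_derivative_compose[rotated]) (auto intro!: derivative_eq_intros)
  then have "((\<lambda>m. grad (\<lambda>x. f x t0) x0 + (\<Sum>c\<in>I. m $ c *\<^sub>R grad (\<lambda>x. g c x t0) x0))
      has_derivative (\<lambda>h. D (0, (h, 0)))) (at m0)"
    using f g by (simp add: grad_lagr)
  moreover have "((\<lambda>m. grad (\<lambda>x. f x t0) x0 + (\<Sum>c\<in>I. m $ c *\<^sub>R grad (\<lambda>x. g c x t0) x0))
      has_derivative (\<lambda>h. \<Sum>c\<in>I. h $ c *\<^sub>R grad (\<lambda>x. g c x t0) x0)) (at m0)"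
    by (auto intro!: derivative_eq_intros bounded_linear.has_derivative[OF bounded_linear_vec_nth])
  ultimately have "(\<lambda>h. D (0, (h, 0))) = (\<lambda>h. \<Sum>c\<in>I. h $ c *\<^sub>R grad (\<lambda>x. g c x t0) x0)"
    by (rule has_derivative_unique)
  then have "D (0, (dm, 0)) = (\<Sum>c\<in>I. dm $ c *\<^sub>R grad (\<lambda>x. g c x t0) x0)"
    by meson
  moreover have "D (h, (dm, 0)) = D (h, 0) + D (0, (dm, 0))"
    by (simp flip: linear_add[OF lin])
  ultimately show ?thesis using 1 by simp
qed

section \<open>Subproblems as Lagrangians\<close>

text \<open>Local constraints are on the left and coupling constraints on the right. The multiplier
  vector thus becomes \<open>vjoin (vsnd z) (vsnd \<tau>)\<close>, glued from the unknown and the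
  parameter of the subproblem.\<close>

definition lcon ::
  "('i::finite,'v::finite,'p::finite,'e::finite,'g::finite,'h::finite,'k::finite) problem
     \<Rightarrow> 'i \<Rightarrow> ('e + 'g) + ('h + 'k) \<Rightarrow> real^'v \<Rightarrow> real^'p \<Rightarrow> real" where
  "lcon P i c x \<theta> = (case c of
      Inl (Inl j) \<Rightarrow> hloc P i x \<theta> $ j | Inl (Inr j) \<Rightarrow> gloc P i x \<theta> $ j
    | Inr (Inl j) \<Rightarrow> Hcp P i x \<theta> $ j | Inr (Inr j) \<Rightarrow> Fcp P i x \<theta> $ j)"

lemma lcon_simps [simp]:
  "lcon P i (Inl (Inl j)) x \<theta> = hloc P i x \<theta> $ j"
  "lcon P i (Inl (Inr j')) x \<theta> = gloc P i x \<theta> $ j'"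
  "lcon P i (Inr (Inl l)) x \<theta> = Hcp P i x \<theta> $ l"
  "lcon P i (Inr (Inr l')) x \<theta> = Fcp P i x \<theta> $ l'"
  by (simp_all add: lcon_def)

definition lidx ::
  "('i::finite,'v::finite,'p::finite,'e::finite,'g::finite,'h::finite,'k::finite) problem
     \<Rightarrow> 'i \<Rightarrow> (('e + 'g) + ('h + 'k)) set" where
  "lidx P i = (leq_idx P i <+> lin_idx P i) <+> didx P"

abbreviation sub_lagr ::
  "('i::finite,'v::finite,'p::finite,'e::finite,'g::finite,'h::finite,'k::finite) problem
     \<Rightarrow> 'i \<Rightarrow> real^'v \<Rightarrow> (real^(('e + 'g) + ('h + 'k))) \<times> (real^'p) \<Rightarrow> real" where
  "sub_lagr P i \<equiv> lagr (objf P i) (lcon P i) (lidx P i)"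

lemma sub_lagrangian_eq:
  "sub_lagrangian P i x \<pi> \<mu> \<nu> lam \<theta> = sub_lagr P i x (vjoin (vjoin \<pi> \<mu>) (vjoin \<nu> lam), \<theta>)"
  by (simp add: sub_lagrangian_def lagr_def lidx_def didx_def sum.Plus)

lemma lidx_simps [simp]:
  "Inl (Inl j) \<in> lidx P i \<longleftrightarrow> j \<in> leq_idx P i"
  "Inl (Inr j') \<in> lidx P i \<longleftrightarrow> j' \<in> lin_idx P i"
  "Inr c \<in> lidx P i \<longleftrightarrow> c \<in> didx P"
  by (auto simp: lidx_def)

lemma didx_simps [simp]:
  "Inl j \<in> didx P \<longleftrightarrow> j \<in> ceq_idx P"
  "Inr j' \<in> didx P \<longleftrightarrow> j' \<in> cin_idx P"
  by (auto simp: didx_def)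

lemma ball_didx:
  "(\<forall>c\<in>didx P. Q c) \<longleftrightarrow> (\<forall>j\<in>ceq_idx P. Q (Inl j)) \<and> (\<forall>j\<in>cin_idx P. Q (Inr j))"
  by (auto simp: didx_def)

lemma block_restr [simp]:
  "objf P i (vrestr (xblk P i) y) \<theta> = objf P i y \<theta>"
  "hloc P i (vrestr (xblk P i) y) \<theta> = hloc P i y \<theta>"
  "gloc P i (vrestr (xblk P i) y) \<theta> = gloc P i y \<theta>"
  "Hcp P i (vrestr (xblk P i) y) \<theta> = Hcp P i y \<theta>"
  "Fcp P i (vrestr (xblk P i) y) \<theta> = Fcp P i y \<theta>"
  by (simp_all add: objf_def hloc_def gloc_def Hcp_def Fcp_def)

lemma lcon_restr [simp]: "lcon P i c (vrestr (xblk P i) y) \<theta> = lcon P i c y \<theta>"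
  by (simp add: lcon_def split: sum.split)

lemma sub_lagr_restr [simp]: "sub_lagr P i (vrestr (xblk P i) y) p = sub_lagr P i y p"
  by (simp add: lagr_def)

lemma vrestr_shift: "vrestr S (y + (vrestr S x - x)) = vrestr S y"
  by (simp add: vrestr_def vec_eq_iff)

text \<open>Replacing \<open>x\<close> by its block is a translation by
  \<open>vrestr S x - x\<close>, which lives outside S and is invisible to a function of the block.
  The shift lemmas for derivatives thus apply to restriction.\<close>

lemma block_shift:
  assumes "\<And>y. f (vrestr S y) = f y"
  shows "f (y + (vrestr S x - x)) = f y"
  by (metis assms vrestr_shift)

lemma grad_block:
  assumes "\<And>y. f (vrestr S y) = f y"
  shows "grad f (vrestr S x) = grad f x"
  using grad_shift[of f "vrestr S x - x" x] block_shift[of f S _ x, OF assms] by simp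

lemma hessian_block:
  assumes "\<And>y. f (vrestr S y) = f y"
  shows "hessian f (vrestr S x) = hessian f x"
  using hessian_shift[of f "vrestr S x - x" x] block_shift[of f S _ x, OF assms] by simp

lemma C2_near_block:
  assumes "C2_near (\<lambda>(x, \<theta>). f x \<theta>) (x, \<theta>)" "\<And>y \<theta>. f (vrestr S y) \<theta> = f y \<theta>"
  shows "C2_near (\<lambda>(x, \<theta>). f x \<theta>) (vrestr S x, \<theta>)"
proof -
  have "f (y + (vrestr S x - x)) t = f y t" for y t
    using block_shift[of "\<lambda>y. f y t" S y x] assms(2) by simp
  then show ?thesis
    using C2_near_shift[OF assms(1), of "(vrestr S x - x, 0)"] by (simp add: case_prod_unfold)
qed

lemma z_of_simps [simp]:
  "vfst (z_of P x \<pi> \<mu> i) = vrestr (xblk P i) x"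
  "vsnd (z_of P x \<pi> \<mu> i) = vjoin (\<pi> i) (\<mu> i)"
  by (simp_all add: z_of_def)

lemma tau_of_simps [simp]:
  "vfst (tau_of \<theta> \<nu> lam) = \<theta>" "vsnd (tau_of \<theta> \<nu> lam) = vjoin \<nu> lam"
  by (simp_all add: tau_of_def)

lemma Gsub_simps:
  "vfst (Gsub P i z \<tau>) = grad (\<lambda>x. sub_lagr P i x (vjoin (vsnd z) (vsnd \<tau>), vfst \<tau>)) (vfst z)"
  "vfst (vsnd (Gsub P i z \<tau>)) = vrestr (leq_idx P i) (hloc P i (vfst z) (vfst \<tau>))"
  "vsnd (vsnd (Gsub P i z \<tau>)) =
     vrestr (lin_idx P i) (\<chi> j. vsnd (vsnd z) $ j * gloc P i (vfst z) (vfst \<tau>) $ j)"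
  by (simp_all only: Gsub_def Let_def vfst_vjoin vsnd_vjoin sub_lagrangian_eq vjoin_vfst_vsnd)

lemma Gsub_nth:
  "Gsub P i z \<tau> $ Inl v =
     grad (\<lambda>x. sub_lagr P i x (vjoin (vsnd z) (vsnd \<tau>), vfst \<tau>)) (vfst z) $ v"
  "Gsub P i z \<tau> $ Inr (Inl j) =
     (if j \<in> leq_idx P i then hloc P i (vfst z) (vfst \<tau>) $ j else 0)"
  "Gsub P i z \<tau> $ Inr (Inr j') =
     (if j' \<in> lin_idx P i then z $ Inr (Inr j') * gloc P i (vfst z) (vfst \<tau>) $ j' else 0)"
  using Gsub_simps[of P i z \<tau>]
  by (simp_all add: vec_eq_iff vrestr_nth)

lemma Ccp_nth:
  "Ccp P x lam \<theta> $ Inl j = (if j \<in> ceq_idx P then \<Sum>i\<in>UNIV. Hcp P i x \<theta> $ j else 0)"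
  "Ccp P x lam \<theta> $ Inr j' = (if j' \<in> cin_idx P then lam $ j' * (\<Sum>i\<in>UNIV. Fcp P i x \<theta> $ j') else 0)"
  by (simp_all add: Ccp_def vrestr_nth)

lemma Ccp_coord: "Ccp P x lam \<theta> \<in> coord (didx P)"
  by (simp add: Ccp_def didx_def)

text \<open>Exchanging the sums hands each agent its share of every coupling constraint, with the
  same coupling multiplier for all agents.\<close>

lemma global_lagrangian_eq:
  "global_lagrangian P x \<pi> \<mu> \<nu> lam \<theta> =
     (\<Sum>i\<in>UNIV. sub_lagr P i x (vjoin (vjoin (\<pi> i) (\<mu> i)) (vjoin \<nu> lam), \<theta>))"
proof -
  have "(\<Sum>j\<in>ceq_idx P. \<nu> $ j * (\<Sum>i\<in>UNIV. Hcp P i x \<theta> $ j)) =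
      (\<Sum>i\<in>UNIV. \<Sum>j\<in>ceq_idx P. \<nu> $ j * Hcp P i x \<theta> $ j)"
    by (simp add: sum_distrib_left) (rule sum.swap)
  moreover have "(\<Sum>j\<in>cin_idx P. lam $ j * (\<Sum>i\<in>UNIV. Fcp P i x \<theta> $ j)) =
      (\<Sum>i\<in>UNIV. \<Sum>j\<in>cin_idx P. lam $ j * Fcp P i x \<theta> $ j)"
    by (simp add: sum_distrib_left) (rule sum.swap)
  ultimately show ?thesis
    unfolding global_lagrangian_def sub_lagrangian_eq[symmetric] sub_lagrangian_def sum.distrib by simp
qed

lemma sum_vrestr_xblk: "(\<Sum>i\<in>UNIV. vrestr (xblk P i) x) = x"
  by (simp add: vec_eq_iff vrestr_nth xblk_def if_distrib)

lemma vrestr_xblk_sum: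
  assumes "\<And>i. u i \<in> coord (xblk P i)"
  shows "vrestr (xblk P i) (\<Sum>k\<in>UNIV. u k) = u i"
proof -
  have "vrestr (xblk P i) (u k) = (if k = i then u i else 0)" for k
    using assms[of k] by (auto simp: vec_eq_iff vrestr_nth coord_def xblk_def)
  then show ?thesis
    by (simp add: linear_sum[OF linear_vrestr])
qed

lemma vrestr_eq_0_iff: "vrestr S y = 0 \<longleftrightarrow> (\<forall>j\<in>S. y $ j = 0)"
  by (auto simp: vec_eq_iff vrestr_nth)

lemma inner_vrestr: "a \<in> coord S \<Longrightarrow> a \<bullet> vrestr S x = a \<bullet> x"
  unfolding inner_vec_def by (intro sum.cong) (auto simp: coord_def vrestr_nth)

section \<open>First order conditions\<close>

text \<open>What is needed to split gradients of sums at one point. It is stated for arbitrary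
  points because the splitting is also applied along branches, away from the given solution.\<close>

definition x_differentiable ::
  "('i::finite,'v::finite,'p::finite,'e::finite,'g::finite,'h::finite,'k::finite) problem
     \<Rightarrow> real^'v \<Rightarrow> real^'p \<Rightarrow> bool" where
  "x_differentiable P x \<theta> \<longleftrightarrow> (\<forall>i. (\<lambda>x. objf P i x \<theta>) differentiable (at x) \<and>
     (\<forall>c\<in>lidx P i. (\<lambda>x. lcon P i c x \<theta>) differentiable (at x)))"

lemma x_differentiable_sub_lagr:
  assumes "x_differentiable P x \<theta>"
  shows "(\<lambda>x. sub_lagr P i x (m, \<theta>)) differentiable (at x)"
  using assms unfolding lagr_def x_differentiable_def
  by (auto intro!: differentiable_add differentiable_sum differentiable_mult)

text \<open>The agents' gradients lie in disjoint coordinate blocks, so restricting their sum to a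
  block recovers each one.\<close>

lemma grad_global_lagrangian_eq_0_iff:
  assumes "x_differentiable P x \<theta>"
  shows "grad (\<lambda>x. global_lagrangian P x \<pi> \<mu> \<nu> lam \<theta>) x = 0 \<longleftrightarrow>
    (\<forall>i. grad (\<lambda>x. sub_lagr P i x (vjoin (vjoin (\<pi> i) (\<mu> i)) (vjoin \<nu> lam), \<theta>)) x = 0)"
    (is "?G = 0 \<longleftrightarrow> (\<forall>i. ?g i = 0)")
proof -
  have d: "(\<lambda>x. sub_lagr P i x (m, \<theta>)) differentiable (at x)" for i m
    using assms by (rule x_differentiable_sub_lagr)
  have G: "?G = (\<Sum>i\<in>UNIV. ?g i)"
    unfolding global_lagrangian_eq by (rule grad_sum) (rule d)
  have "?g i \<in> coord (xblk P i)" for i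
    by (rule grad_coord[OF d]) simp
  then have r: "vrestr (xblk P i) ?G = ?g i" for i
    unfolding G by (rule vrestr_xblk_sum)
  show ?thesis
  proof
    assume "?G = 0"
    then show "\<forall>i. ?g i = 0" using r by simp
  next
    assume "\<forall>i. ?g i = 0"
    then show "?G = 0" unfolding G by simp
  qed
qed

text \<open>Decomposes the coupled problem into the subproblems at common coupling multipliers and
  the coupling system. The block variables of \<open>z_of\<close> may replace the stacked vector
  because the data see only blocks.\<close>

lemma global_kkt_iff:
  fixes P :: "('i::finite,'v::finite,'p::finite,'e::finite,'g::finite,'h::finite,'k::finite) problem"
  assumes "x_differentiable P x \<theta>"
  shows "global_kkt P \<theta> x \<pi> \<mu> \<nu> lam \<longleftrightarrow>
    (\<forall>i. sub_kkt P i (z_of P x \<pi> \<mu> i) (tau_of \<theta> \<nu> lam)) \<and>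
    vjoin \<nu> lam \<in> coord (didx P) \<and> Ccp P x lam \<theta> = 0 \<and>
    (\<forall>j\<in>cin_idx P. (\<Sum>i\<in>UNIV. Fcp P i x \<theta> $ j) \<le> 0 \<and> 0 \<le> lam $ j)"
proof -
  have G: "Gsub P i (z_of P x \<pi> \<mu> i) (tau_of \<theta> \<nu> lam) = 0 \<longleftrightarrow>
      grad (\<lambda>x. sub_lagr P i x (vjoin (vjoin (\<pi> i) (\<mu> i)) (vjoin \<nu> lam), \<theta>)) x = 0 \<and>
      (\<forall>j\<in>leq_idx P i. hloc P i x \<theta> $ j = 0) \<and>
      (\<forall>j\<in>lin_idx P i. \<mu> i $ j * gloc P i x \<theta> $ j = 0)" for i
  proof -
    have 1: "grad (\<lambda>x. sub_lagr P i x (vjoin (vjoin (\<pi> i) (\<mu> i)) (vjoin \<nu> lam), \<theta>)) (vrestr (xblk P i) x)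
       = grad (\<lambda>x. sub_lagr P i x (vjoin (vjoin (\<pi> i) (\<mu> i)) (vjoin \<nu> lam), \<theta>)) x"
      by (rule grad_block) simp
    have 2: "y = 0 \<longleftrightarrow> vfst y = 0 \<and> vfst (vsnd y) = 0 \<and> vsnd (vsnd y) = 0"
      for y :: "real^('v + 'e + 'g)"
      by (simp only: vec_sum_eq_iff[of _ 0] vfst_linear vsnd_linear)
    show ?thesis
      unfolding 2[of "Gsub P i (z_of P x \<pi> \<mu> i) (tau_of \<theta> \<nu> lam)"] Gsub_simps z_of_simps tau_of_simps
        vsnd_vjoin 1 vrestr_eq_0_iff block_restr by simp
  qed
  have C: "Ccp P x lam \<theta> = 0 \<longleftrightarrow> (\<forall>j\<in>ceq_idx P. (\<Sum>i\<in>UNIV. Hcp P i x \<theta> $ j) = 0) \<and>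
      (\<forall>j\<in>cin_idx P. lam $ j * (\<Sum>i\<in>UNIV. Fcp P i x \<theta> $ j) = 0)"
    by (subst in_coord_0_iff[OF Ccp_coord]) (simp add: ball_didx Ccp_nth)
  have Z: "z_of P x \<pi> \<mu> i \<in> coord (zidx P i) \<longleftrightarrow> \<pi> i \<in> coord (leq_idx P i) \<and> \<mu> i \<in> coord (lin_idx P i)" for i
    by (simp add: z_of_def zidx_def)
  have S: "sub_kkt P i (z_of P x \<pi> \<mu> i) (tau_of \<theta> \<nu> lam) \<longleftrightarrow>
      \<pi> i \<in> coord (leq_idx P i) \<and> \<mu> i \<in> coord (lin_idx P i) \<and>
      grad (\<lambda>x. sub_lagr P i x (vjoin (vjoin (\<pi> i) (\<mu> i)) (vjoin \<nu> lam), \<theta>)) x = 0 \<and>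
      (\<forall>j\<in>leq_idx P i. hloc P i x \<theta> $ j = 0) \<and>
      (\<forall>j\<in>lin_idx P i. \<mu> i $ j * gloc P i x \<theta> $ j = 0) \<and>
      (\<forall>j\<in>lin_idx P i. gloc P i x \<theta> $ j \<le> 0 \<and> 0 \<le> \<mu> i $ j)" for i
    unfolding sub_kkt_def G Z z_of_simps tau_of_simps vsnd_vjoin block_restr
    by (simp only: ball_conj_distrib conj_ac)
  have F: "feasible P \<theta> x \<longleftrightarrow> (\<forall>i. (\<forall>j\<in>leq_idx P i. hloc P i x \<theta> $ j = 0) \<and>
      (\<forall>j\<in>lin_idx P i. gloc P i x \<theta> $ j \<le> 0)) \<and>
      (\<forall>j\<in>ceq_idx P. (\<Sum>i\<in>UNIV. Hcp P i x \<theta> $ j) = 0) \<and>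
      (\<forall>j\<in>cin_idx P. (\<Sum>i\<in>UNIV. Fcp P i x \<theta> $ j) \<le> 0)"
    by (simp add: feasible_def local_set_def)
  have D: "vjoin \<nu> lam \<in> coord (didx P) \<longleftrightarrow> \<nu> \<in> coord (ceq_idx P) \<and> lam \<in> coord (cin_idx P)"
    by (simp add: didx_def)
  show ?thesis
    unfolding global_kkt_def grad_global_lagrangian_eq_0_iff[OF assms] S C F D
    by (simp only: all_conj_distrib ball_conj_distrib conj_ac)
qed

section \<open>Nondegeneracy of the linearized conditions\<close>

lemma independent_familyD:
  assumes "inj_on f B" "independent (f ` B)" "finite B" "(\<Sum>b\<in>B. c b *\<^sub>R f b) = 0" "b \<in> B"
  shows "c b = 0"
proof -
  have "(\<Sum>w\<in>f ` B. c (the_inv_into B f w) *\<^sub>R w) = (\<Sum>b\<in>B. c b *\<^sub>R f b)"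
    using assms(1) by (simp add: sum.reindex the_inv_into_f_f)
  then have "c (the_inv_into B f (f b)) = 0"
    using assms by (intro independentD[where v = "f b"]) auto
  then show ?thesis
    using assms by (simp add: the_inv_into_f_f)
qed

lemma sum_constraints:
  "(\<Sum>c\<in>constraints P. f c) =
     (\<Sum>i\<in>UNIV. (\<Sum>j\<in>leq_idx P i. f (LocEq i j)) + (\<Sum>j\<in>lin_idx P i. f (LocIn i j)))
     + (\<Sum>j\<in>ceq_idx P. f (CpEq j)) + (\<Sum>j\<in>cin_idx P. f (CpIn j))"
proof -
  let ?A = "(\<lambda>(i, j). LocEq i j) ` (SIGMA i:UNIV. leq_idx P i)"
  let ?B = "(\<lambda>(i, j). LocIn i j) ` (SIGMA i:UNIV. lin_idx P i)"
  have c: "constraints P = ?A \<union> ?B \<union> CpEq ` ceq_idx P \<union> CpIn ` cin_idx P"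
    by (auto simp: constraints_def image_def)
  have "(\<Sum>c\<in>constraints P. f c) =
      sum f ?A + sum f ?B + sum f (CpEq ` ceq_idx P) + sum f (CpIn ` cin_idx P)"
    unfolding c by (subst sum.union_disjoint, auto)+
  also have "sum f ?A = (\<Sum>i\<in>UNIV. \<Sum>j\<in>leq_idx P i. f (LocEq i j))"
    by (subst sum.reindex) (auto simp: inj_on_def sum.Sigma case_prod_unfold)
  also have "sum f ?B = (\<Sum>i\<in>UNIV. \<Sum>j\<in>lin_idx P i. f (LocIn i j))"
    by (subst sum.reindex) (auto simp: inj_on_def sum.Sigma case_prod_unfold)
  also have "sum f (CpEq ` ceq_idx P) = (\<Sum>j\<in>ceq_idx P. f (CpEq j))"
    by (subst sum.reindex) (auto simp: inj_on_def)
  also have "sum f (CpIn ` cin_idx P) = (\<Sum>j\<in>cin_idx P. f (CpIn j))"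
    by (subst sum.reindex) (auto simp: inj_on_def)
  finally show ?thesis by (simp add: sum.distrib)
qed

lemma finite_constraints: "finite (constraints P)"
proof -
  have "constraints P \<subseteq> range (\<lambda>(i, j). LocEq i j) \<union> range (\<lambda>(i, j). LocIn i j) \<union> range CpEq \<union> range CpIn"
    by (auto simp: constraints_def image_def)
  then show ?thesis by (rule finite_subset) auto
qed

locale regular_kkt_point =
  fixes P :: "('i::finite,'v::finite,'p::finite,'e::finite,'g::finite,'h::finite,'k::finite) problem"
    and \<theta>0 :: "real^'p" and x :: "real^'v"
    and \<pi> :: "'i \<Rightarrow> real^'e" and \<mu> :: "'i \<Rightarrow> real^'g"
    and \<nu> :: "real^'h" and lam :: "real^'k"
  assumes smooth: "smooth_data P \<theta>0 x"
    and kkt: "global_kkt P \<theta>0 x \<pi> \<mu> \<nu> lam"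
    and indep: "binding_independent P \<theta>0 x"
    and strict: "strict_complementarity P \<theta>0 x \<mu> lam"
    and sosc: "second_order P i x (\<pi> i) (\<mu> i) \<nu> lam \<theta>0"
begin

abbreviation xi where "xi i \<equiv> vrestr (xblk P i) x"
abbreviation z0 where "z0 i \<equiv> z_of P x \<pi> \<mu> i"
abbreviation \<tau>0 where "\<tau>0 \<equiv> tau_of \<theta>0 \<nu> lam"
abbreviation m0 where "m0 i \<equiv> vjoin (vjoin (\<pi> i) (\<mu> i)) (vjoin \<nu> lam)"

definition Hs :: "'i \<Rightarrow> real^'v^'v" where
  "Hs i = hessian (\<lambda>x. sub_lagr P i x (m0 i, \<theta>0)) x"

definition gC :: "'i \<Rightarrow> ('e + 'g) + ('h + 'k) \<Rightarrow> real^'v" where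
  "gC i c = grad (\<lambda>x. lcon P i c x \<theta>0) x"

lemma C2_data:
  "C2_near (\<lambda>(x, \<theta>). objf P i x \<theta>) (x, \<theta>0)"
  "c \<in> lidx P i \<Longrightarrow> C2_near (\<lambda>(x, \<theta>). lcon P i c x \<theta>) (x, \<theta>0)"
  using smooth by (auto simp: smooth_data_def lidx_def didx_def)

lemmas data_near = C2_data[THEN C2_near_grad_differentiable]

lemma data_near_block:
  "\<forall>\<^sub>F q in nhds (xi i, \<theta>0). grad_differentiable (objf P i) q"
  "c \<in> lidx P i \<Longrightarrow> \<forall>\<^sub>F q in nhds (xi i, \<theta>0). grad_differentiable (lcon P i c) q"
  by (intro C2_near_grad_differentiable C2_near_block C2_data; simp)+

lemma sub_lagr_near:
  "\<forall>\<^sub>F q in nhds (xi i, (m0 i, \<theta>0)). grad_differentiable (sub_lagr P i) q"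
  using data_near_block by (rule grad_differentiable_lagr)

lemma x_differentiable_near: "\<forall>\<^sub>F q in nhds (x, \<theta>0). x_differentiable P (fst q) (snd q)"
proof -
  have "\<forall>\<^sub>F q in nhds (x, \<theta>0). \<forall>i\<in>UNIV. grad_differentiable (objf P i) q \<and>
      (\<forall>c\<in>lidx P i. grad_differentiable (lcon P i c) q)"
    using data_near by (intro eventually_ball_finite eventually_conj ballI) auto
  then show ?thesis
  proof (rule eventually_mono)
    fix q assume q: "\<forall>i\<in>UNIV. grad_differentiable (objf P i) q \<and>
      (\<forall>c\<in>lidx P i. grad_differentiable (lcon P i c) q)"
    have *: "(\<lambda>x. f x (snd q)) differentiable (at (fst q))" if "grad_differentiable f q" for f
      by (rule differentiable_partial) (use that in \<open>simp add: grad_differentiable_def\<close>)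
    show "x_differentiable P (fst q) (snd q)"
      unfolding x_differentiable_def using q * by blast
  qed
qed

lemma x_differentiable: "x_differentiable P x \<theta>0"
  using eventually_nhds_x_imp_x[OF x_differentiable_near] by simp

lemma lcon_differentiable: "c \<in> lidx P i \<Longrightarrow> (\<lambda>x. lcon P i c x \<theta>0) differentiable (at x)"
  using x_differentiable by (auto simp: x_differentiable_def)

lemma gC_block: "gC i c = grad (\<lambda>x. lcon P i c x \<theta>0) (xi i)"
  unfolding gC_def by (rule grad_block[symmetric]) simp

lemma gC_coord: "c \<in> lidx P i \<Longrightarrow> gC i c \<in> coord (xblk P i)"
  unfolding gC_def by (rule grad_coord[OF lcon_differentiable]) auto

lemma sub_kkt0: "sub_kkt P i (z0 i) \<tau>0" and Ccp0: "Ccp P x lam \<theta>0 = 0"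
  using kkt unfolding global_kkt_iff[OF x_differentiable] by auto

lemma feasible0: "j \<in> leq_idx P i \<Longrightarrow> hloc P i x \<theta>0 $ j = 0"
  "j' \<in> lin_idx P i \<Longrightarrow> gloc P i x \<theta>0 $ j' \<le> 0"
  "l \<in> ceq_idx P \<Longrightarrow> (\<Sum>i\<in>UNIV. Hcp P i x \<theta>0 $ l) = 0"
  "l' \<in> cin_idx P \<Longrightarrow> (\<Sum>i\<in>UNIV. Fcp P i x \<theta>0 $ l') \<le> 0"
  using kkt by (auto simp: global_kkt_def feasible_def local_set_def)

lemma complementarity:
  "j \<in> lin_idx P i \<Longrightarrow> gloc P i x \<theta>0 $ j < 0 \<and> \<mu> i $ j = 0 \<or> gloc P i x \<theta>0 $ j = 0 \<and> 0 < \<mu> i $ j"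
  "l \<in> cin_idx P \<Longrightarrow> (\<Sum>i\<in>UNIV. Fcp P i x \<theta>0 $ l) < 0 \<and> lam $ l = 0 \<or>
    (\<Sum>i\<in>UNIV. Fcp P i x \<theta>0 $ l) = 0 \<and> 0 < lam $ l"
proof -
  assume j: "j \<in> lin_idx P i"
  then have "gloc P i x \<theta>0 $ j = 0 \<Longrightarrow> LocIn i j \<in> binding P \<theta>0 x"
    by (auto simp: binding_def constraints_def)
  then have "gloc P i x \<theta>0 $ j = 0 \<Longrightarrow> 0 < \<mu> i $ j"
    using strict by (auto simp: strict_complementarity_def)
  moreover have "\<mu> i $ j * gloc P i x \<theta>0 $ j = 0"
    using kkt j by (auto simp: global_kkt_def)
  ultimately show "gloc P i x \<theta>0 $ j < 0 \<and> \<mu> i $ j = 0 \<or> gloc P i x \<theta>0 $ j = 0 \<and> 0 < \<mu> i $ j"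
    using feasible0(2)[OF j] by fastforce
next
  assume l: "l \<in> cin_idx P"
  then have "(\<Sum>i\<in>UNIV. Fcp P i x \<theta>0 $ l) = 0 \<Longrightarrow> CpIn l \<in> binding P \<theta>0 x"
    by (auto simp: binding_def constraints_def)
  then have "(\<Sum>i\<in>UNIV. Fcp P i x \<theta>0 $ l) = 0 \<Longrightarrow> 0 < lam $ l"
    using strict by (auto simp: strict_complementarity_def)
  moreover have "lam $ l * (\<Sum>i\<in>UNIV. Fcp P i x \<theta>0 $ l) = 0"
    using kkt l by (auto simp: global_kkt_def)
  ultimately show "(\<Sum>i\<in>UNIV. Fcp P i x \<theta>0 $ l) < 0 \<and> lam $ l = 0 \<or>
    (\<Sum>i\<in>UNIV. Fcp P i x \<theta>0 $ l) = 0 \<and> 0 < lam $ l"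
    using feasible0(4)[OF l] by fastforce
qed

text \<open>Adding the agents' relations reassembles the shares \<open>gC i (Inr j)\<close> into the
  gradients of the coupling constraints, with a common coefficient \<gamma>. This produces one
  relation among the gradients of the global problem, to which independence applies.\<close>

lemma gradient_combination_zero:
  assumes v: "\<And>i. v i \<in> coord (leq_idx P i <+> lin_idx P i)" and \<gamma>: "\<gamma> \<in> coord (didx P)"
    and nb: "\<And>i j. j \<in> lin_idx P i \<Longrightarrow> gloc P i x \<theta>0 $ j \<noteq> 0 \<Longrightarrow> v i $ Inr j = 0"
    and nbc: "\<And>j. j \<in> cin_idx P \<Longrightarrow> (\<Sum>i\<in>UNIV. Fcp P i x \<theta>0 $ j) \<noteq> 0 \<Longrightarrow> \<gamma> $ Inr j = 0"
    and zero: "\<And>i. (\<Sum>c\<in>lidx P i. vjoin (v i) \<gamma> $ c *\<^sub>R gC i c) = 0"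
  shows "v i = 0" "\<gamma> = 0"
proof -
  define cof where "cof = (\<lambda>c. case c of LocEq i j \<Rightarrow> v i $ Inl j | LocIn i j \<Rightarrow> v i $ Inr j
    | CpEq j \<Rightarrow> \<gamma> $ Inl j | CpIn j \<Rightarrow> \<gamma> $ Inr j)"
  define gr where "gr = (\<lambda>c. grad (\<lambda>x. con_fun P c x \<theta>0) x)"
  have gr_eq: "gr (CpEq j) = (\<Sum>i\<in>UNIV. gC i (Inr (Inl j)))" if "j \<in> ceq_idx P" for j
    unfolding gr_def gC_def con_fun.simps
    using grad_sum[of UNIV "\<lambda>i x. lcon P i (Inr (Inl j)) x \<theta>0" x] lcon_differentiable[of "Inr (Inl j)"] that by simp
  have gr_in: "gr (CpIn j) = (\<Sum>i\<in>UNIV. gC i (Inr (Inr j)))" if "j \<in> cin_idx P" for j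
    unfolding gr_def gC_def con_fun.simps
    using grad_sum[of UNIV "\<lambda>i x. lcon P i (Inr (Inr j)) x \<theta>0" x] lcon_differentiable[of "Inr (Inr j)"] that by simp
  have gr_loc: "gr (LocEq i j) = gC i (Inl (Inl j))" "gr (LocIn i j') = gC i (Inl (Inr j'))" for i j j'
    by (simp_all add: gr_def gC_def)
  have "(\<Sum>c\<in>constraints P. cof c *\<^sub>R gr c) =
      (\<Sum>i\<in>UNIV. (\<Sum>j\<in>leq_idx P i. v i $ Inl j *\<^sub>R gC i (Inl (Inl j))) +
        (\<Sum>j\<in>lin_idx P i. v i $ Inr j *\<^sub>R gC i (Inl (Inr j))))
      + (\<Sum>j\<in>ceq_idx P. \<gamma> $ Inl j *\<^sub>R (\<Sum>i\<in>UNIV. gC i (Inr (Inl j))))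
      + (\<Sum>j\<in>cin_idx P. \<gamma> $ Inr j *\<^sub>R (\<Sum>i\<in>UNIV. gC i (Inr (Inr j))))"
    unfolding sum_constraints by (simp add: cof_def gr_loc gr_eq gr_in)
  also have "(\<Sum>j\<in>ceq_idx P. \<gamma> $ Inl j *\<^sub>R (\<Sum>i\<in>UNIV. gC i (Inr (Inl j)))) =
      (\<Sum>i\<in>UNIV. \<Sum>j\<in>ceq_idx P. \<gamma> $ Inl j *\<^sub>R gC i (Inr (Inl j)))"
    by (simp add: scaleR_sum_right) (rule sum.swap)
  also have "(\<Sum>j\<in>cin_idx P. \<gamma> $ Inr j *\<^sub>R (\<Sum>i\<in>UNIV. gC i (Inr (Inr j)))) =
      (\<Sum>i\<in>UNIV. \<Sum>j\<in>cin_idx P. \<gamma> $ Inr j *\<^sub>R gC i (Inr (Inr j)))"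
    by (simp add: scaleR_sum_right) (rule sum.swap)
  finally have "(\<Sum>c\<in>constraints P. cof c *\<^sub>R gr c) =
      (\<Sum>i\<in>UNIV. \<Sum>c\<in>lidx P i. vjoin (v i) \<gamma> $ c *\<^sub>R gC i c)"
    by (simp add: lidx_def didx_def sum.Plus sum.distrib)
  then have s0: "(\<Sum>c\<in>constraints P. cof c *\<^sub>R gr c) = 0"
    using zero by simp
  \<comment> \<open>Equality constraints are binding by feasibility, so only inactive inequalities
    occur here.\<close>
  have nonbinding: "cof c = 0" if "c \<in> constraints P" "c \<notin> binding P \<theta>0 x" for c
    using that nb nbc feasible0
    by (auto simp: cof_def binding_def constraints_def)
  have "(\<Sum>c\<in>binding P \<theta>0 x. cof c *\<^sub>R gr c) = (\<Sum>c\<in>constraints P. cof c *\<^sub>R gr c)"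
    using nonbinding by (intro sum.mono_neutral_left finite_constraints) (auto simp: binding_def)
  then have "cof c = 0" if "c \<in> binding P \<theta>0 x" for c
    using indep s0 that finite_subset[OF _ finite_constraints, of "binding P \<theta>0 x" P]
    by (intro independent_familyD[of gr "binding P \<theta>0 x"])
      (auto simp: binding_independent_def gr_def binding_def)
  then have cof0: "cof c = 0" if "c \<in> constraints P" for c
    using nonbinding that by blast
  have "v i $ Inl j = 0" if "j \<in> leq_idx P i" for j
    using cof0[of "LocEq i j"] that by (simp add: cof_def constraints_def)
  moreover have "v i $ Inr j = 0" if "j \<in> lin_idx P i" for j
    using cof0[of "LocIn i j"] that by (simp add: cof_def constraints_def)
  ultimately show "v i = 0"
    using in_coord_0_iff[OF v[of i]] by auto
  have "\<gamma> $ Inl j = 0" if "j \<in> ceq_idx P" for j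
    using cof0[of "CpEq j"] that by (simp add: cof_def constraints_def)
  moreover have "\<gamma> $ Inr j = 0" if "j \<in> cin_idx P" for j
    using cof0[of "CpIn j"] that by (simp add: cof_def constraints_def)
  ultimately show "\<gamma> = 0"
    using in_coord_0_iff[OF \<gamma>] by (auto simp: didx_def)
qed

text \<open>The coupling rows enter through the products in \<open>coup\<close> and through
  \<open>nbc\<close>. Both the case \<gamma> = 0 and the linearized coupling equations supply them,
  so one argument serves the local and the coupling matrix.\<close>

lemma linearized_kkt_zero:
  assumes u: "\<And>i. u i \<in> coord (xblk P i)" and v: "\<And>i. v i \<in> coord (leq_idx P i <+> lin_idx P i)"
    and \<gamma>: "\<gamma> \<in> coord (didx P)"
    and stat: "\<And>i. Hs i *v u i + (\<Sum>c\<in>lidx P i. vjoin (v i) \<gamma> $ c *\<^sub>R gC i c) = 0"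
    and eq: "\<And>i j. j \<in> leq_idx P i \<Longrightarrow> gC i (Inl (Inl j)) \<bullet> u i = 0"
    and compl: "\<And>i j. j \<in> lin_idx P i \<Longrightarrow>
      v i $ Inr j * gloc P i x \<theta>0 $ j + \<mu> i $ j * (gC i (Inl (Inr j)) \<bullet> u i) = 0"
    and coup: "\<And>j. j \<in> didx P \<Longrightarrow> \<gamma> $ j * (\<Sum>i\<in>UNIV. gC i (Inr j) \<bullet> u i) = 0"
    and nbc: "\<And>j. j \<in> cin_idx P \<Longrightarrow> (\<Sum>i\<in>UNIV. Fcp P i x \<theta>0 $ j) \<noteq> 0 \<Longrightarrow> \<gamma> $ Inr j = 0"
  shows "u i = 0" "v i = 0" "\<gamma> = 0"
proof -
  have act: "gC i (Inl (Inr j)) \<bullet> u i = 0" if "j \<in> lin_idx P i" "gloc P i x \<theta>0 $ j = 0" for i j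
    using compl[OF that(1)] complementarity(1)[OF that(1)] that(2) by auto
  have inact: "v i $ Inr j = 0" if "j \<in> lin_idx P i" "gloc P i x \<theta>0 $ j \<noteq> 0" for i j
    using compl[OF that(1)] complementarity(1)[OF that(1)] that(2) by auto
  have loc0: "v i $ c * (gC i (Inl c) \<bullet> u i) = 0" if "c \<in> leq_idx P i <+> lin_idx P i" for i c
    using that eq act inact by force
  \<comment> \<open>\<open>act\<close> gives equality for all active linearized inequalities, hence
    the sign clause of the second order condition. A positive multiplier implies activity, which
    gives the equality clause.\<close>
  have pos: "0 < u i \<bullet> (Hs i *v u i)" if "u i \<noteq> 0" for i
  proof -
    have "hessian (\<lambda>x. sub_lagrangian P i x (\<pi> i) (\<mu> i) \<nu> lam \<theta>0) x = Hs i"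
      by (simp add: Hs_def sub_lagrangian_eq)
    moreover have "u i \<bullet> grad (\<lambda>x. gloc P i x \<theta>0 $ j) x = gC i (Inl (Inr j)) \<bullet> u i"
      "u i \<bullet> grad (\<lambda>x. hloc P i x \<theta>0 $ j') x = gC i (Inl (Inl j')) \<bullet> u i" for j j'
      by (simp_all add: gC_def inner_commute)
    ultimately show ?thesis
      using sosc[of i] u[of i] that act eq complementarity(1)
      unfolding second_order_def by (metis less_irrefl order.refl)
  qed
  have ui: "u i \<bullet> (Hs i *v u i) = - (\<Sum>j\<in>didx P. \<gamma> $ j * (gC i (Inr j) \<bullet> u i))" for i
  proof -
    have "u i \<bullet> (Hs i *v u i) = - (\<Sum>c\<in>lidx P i. vjoin (v i) \<gamma> $ c * (gC i c \<bullet> u i))"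
      using arg_cong[OF stat[of i], of "\<lambda>y. u i \<bullet> y"]
      by (simp add: inner_add_right inner_sum_right inner_commute[of "u i" "gC i _"] eq_neg_iff_add_eq_0)
    also have "(\<Sum>c\<in>lidx P i. vjoin (v i) \<gamma> $ c * (gC i c \<bullet> u i)) =
        (\<Sum>c\<in>leq_idx P i <+> lin_idx P i. v i $ c * (gC i (Inl c) \<bullet> u i)) +
        (\<Sum>j\<in>didx P. \<gamma> $ j * (gC i (Inr j) \<bullet> u i))"
      unfolding lidx_def by (subst sum.Plus) auto
    finally show ?thesis using loc0 by simp
  qed
  have "(\<Sum>i\<in>UNIV. u i \<bullet> (Hs i *v u i)) = - (\<Sum>i\<in>UNIV. \<Sum>j\<in>didx P. \<gamma> $ j * (gC i (Inr j) \<bullet> u i))"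
    by (simp add: ui sum_negf)
  also have "\<dots> = - (\<Sum>j\<in>didx P. \<gamma> $ j * (\<Sum>i\<in>UNIV. gC i (Inr j) \<bullet> u i))"
    by (subst sum.swap) (simp add: sum_distrib_left)
  finally have "(\<Sum>i\<in>UNIV. u i \<bullet> (Hs i *v u i)) = 0"
    using coup by simp
  \<comment> \<open>Each term is nonnegative, so a zero sum forces every agent's term to vanish;
    this separates the agents again.\<close>
  moreover have "0 \<le> u i \<bullet> (Hs i *v u i)" for i
    using pos[of i] by (cases "u i = 0") auto
  ultimately have "u i \<bullet> (Hs i *v u i) = 0" for i
    by (simp add: sum_nonneg_eq_0_iff)
  then have u0: "u i = 0" for i
    using pos[of i] by fastforce
  then show "u i = 0" .
  have zero: "(\<Sum>c\<in>lidx P i. vjoin (v i) \<gamma> $ c *\<^sub>R gC i c) = 0" for i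
    using stat[of i] u0[of i] by simp
  show "v i = 0" "\<gamma> = 0"
    by (rule gradient_combination_zero[OF v \<gamma> inact nbc zero]; assumption)+
qed

end

section \<open>Derivatives of the subproblem and coupling equations\<close>

lemma bounded_linear_nhds: "bounded_linear f \<Longrightarrow> filterlim f (nhds (f a)) (nhds a)"
  by (rule isCont_nhds[OF linear_continuous_at])

lemma has_derivative_coord:
  assumes d: "(f has_derivative f') (at x)" and ev: "\<forall>\<^sub>F q in nhds x. f q \<in> coord S"
  shows "f' h \<in> coord S"
proof -
  have "f' h $ k = 0" if k: "k \<notin> S" for k
  proof -
    have 1: "((\<lambda>q. f q $ k) has_derivative (\<lambda>h. f' h $ k)) (at x)"
      by (rule bounded_linear.has_derivative[OF bounded_linear_vec_nth d])
    have ev': "\<forall>\<^sub>F q in nhds x. f q $ k = 0"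
      using ev by (rule eventually_mono) (use k in \<open>simp add: coord_def\<close>)
    have "((\<lambda>q. 0) has_derivative (\<lambda>h. f' h $ k)) (at x)"
      using 1 ev' eventually_nhds_x_imp_x[OF ev']
      by (intro has_derivative_transform_eventually[OF 1, of "\<lambda>q. 0"])
        (auto simp: eventually_at_filter elim: eventually_mono)
    from has_derivative_unique[OF this, of "\<lambda>h. 0"] show ?thesis
      by (metis has_derivative_const)
  qed
  then show ?thesis by (simp add: coord_def)
qed

section \<open>Linearized KKT equations of a single subproblem\<close>

context regular_kkt_point
begin

text \<open>Rearranges unknown and parameter of a subproblem into the arguments of
  \<open>lagr\<close>: the coupling multipliers, parameters of the subproblem, join the local
  ones.\<close>

definition lift ::
  "(real^('v + 'e + 'g)) \<times> (real^('p + 'h + 'k)) \<Rightarrow> (real^'v) \<times> (real^(('e + 'g) + ('h + 'k))) \<times> (real^'p)" where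
  "lift q = (vfst (fst q), (vjoin (vsnd (fst q)) (vsnd (snd q)), vfst (snd q)))"

definition pr ::
  "(real^('v + 'e + 'g)) \<times> (real^('p + 'h + 'k)) \<Rightarrow> (real^'v) \<times> (real^'p)" where
  "pr q = (vfst (fst q), vfst (snd q))"

lemma bounded_linear_lift: "bounded_linear lift"
proof -
  have "linear lift"
    by (intro linearI) (simp_all add: lift_def vjoin_add vjoin_scaleR)
  then show ?thesis by (simp add: linear_conv_bounded_linear)
qed

lemma bounded_linear_pr: "bounded_linear pr"
proof -
  have "linear pr" by (intro linearI) (simp_all add: pr_def)
  then show ?thesis by (simp add: linear_conv_bounded_linear)
qed

lemma lift_base: "lift (z0 i, \<tau>0) = (xi i, (m0 i, \<theta>0))"
  and pr_base: "pr (z0 i, \<tau>0) = (xi i, \<theta>0)"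
  by (simp_all add: lift_def pr_def)

lemma Gsub_lift:
  "vfst (Gsub P i (fst q) (snd q)) = grad (\<lambda>x. sub_lagr P i x (snd (lift q))) (fst (lift q))"
  by (simp add: Gsub_simps lift_def)

lemma Gsub_pr:
  "j \<in> leq_idx P i \<Longrightarrow>
    Gsub P i (fst q) (snd q) $ Inr (Inl j) = lcon P i (Inl (Inl j)) (fst (pr q)) (snd (pr q))"
  "j' \<in> lin_idx P i \<Longrightarrow>
    Gsub P i (fst q) (snd q) $ Inr (Inr j') =
      fst q $ Inr (Inr j') * lcon P i (Inl (Inr j')) (fst (pr q)) (snd (pr q))"
  by (simp_all add: Gsub_nth pr_def)

lemma Gsub_near:
  "\<forall>\<^sub>F q in nhds (z0 i, \<tau>0). (\<lambda>q. Gsub P i (fst q) (snd q)) differentiable (at q) \<and>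
     Gsub P i (fst q) (snd q) \<in> coord (zidx P i)"
proof -
  have "\<forall>\<^sub>F q in nhds (z0 i, \<tau>0). grad_differentiable (sub_lagr P i) (lift q)"
    using sub_lagr_near[of i, folded lift_base]
    by (rule eventually_compose_filterlim) (rule bounded_linear_nhds[OF bounded_linear_lift])
  moreover have "\<forall>\<^sub>F q in nhds (xi i, \<theta>0). \<forall>c\<in>lidx P i. grad_differentiable (lcon P i c) q"
    using data_near_block by (intro eventually_ball_finite) auto
  then have "\<forall>\<^sub>F q in nhds (z0 i, \<tau>0). \<forall>c\<in>lidx P i. grad_differentiable (lcon P i c) (pr q)"
    unfolding pr_base[symmetric]
    by (rule eventually_compose_filterlim) (rule bounded_linear_nhds[OF bounded_linear_pr])
  ultimately show ?thesis
  proof eventually_elim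
    case (elim q)
    have L: "(\<lambda>q. vfst (Gsub P i (fst q) (snd q))) differentiable (at q)"
      unfolding Gsub_lift
      by (rule differentiable_compose[of "\<lambda>p. grad (\<lambda>x. sub_lagr P i x (snd p)) (fst p)" lift])
        (use elim(1) bounded_linear_lift in
          \<open>auto simp: grad_differentiable_def intro: bounded_linear_imp_differentiable\<close>)
    have c: "(\<lambda>q. lcon P i c (fst (pr q)) (snd (pr q))) differentiable (at q)" if "c \<in> lidx P i" for c
      by (rule differentiable_compose[of "\<lambda>p. lcon P i c (fst p) (snd p)" pr])
        (use elim(2) that bounded_linear_pr in
          \<open>auto simp: grad_differentiable_def intro: bounded_linear_imp_differentiable\<close>)
    have "(\<lambda>q. Gsub P i (fst q) (snd q) $ k) differentiable (at q)" for k
    proof (cases k)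
      case (Inl v)
      have "(\<lambda>q. vfst (Gsub P i (fst q) (snd q)) $ v) differentiable (at q)"
        by (rule differentiable_compose[of "\<lambda>y. y $ v"])
          (auto intro: bounded_linear_imp_differentiable bounded_linear_vec_nth L)
      then show ?thesis using Inl by simp
    next
      case (Inr a)
      show ?thesis
      proof (cases a)
        fix j assume j: "a = Inl j"
        show ?thesis
        proof (cases "j \<in> leq_idx P i")
          case True
          then show ?thesis using c[of "Inl (Inl j)"] by (simp only: Inr j Gsub_pr lidx_simps)
        qed (simp add: Inr j Gsub_nth)
      next
        fix j assume j: "a = Inr j"
        have "(\<lambda>q. fst q $ Inr (Inr j)) differentiable (at q)"
          by (intro bounded_linear_imp_differentiable bounded_linear_compose[OF bounded_linear_vec_nth]
              bounded_linear_intros)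
        then show ?thesis
          using c[of "Inl (Inr j)"]
          by (cases "j \<in> lin_idx P i") (simp_all only: Inr j Gsub_pr lidx_simps differentiable_mult,
              simp add: Gsub_nth)
      qed
    qed
    then have "(\<lambda>q. Gsub P i (fst q) (snd q)) differentiable (at q)"
      by (rule differentiable_vecI)
    moreover have "(\<lambda>x. sub_lagr P i x (snd (lift q))) differentiable (at (fst (lift q)))"
      by (rule differentiable_partial) (use elim(1) in \<open>simp add: grad_differentiable_def\<close>)
    then have "vfst (Gsub P i (fst q) (snd q)) \<in> coord (xblk P i)"
      unfolding Gsub_lift by (rule grad_coord) simp
    then have "Gsub P i (fst q) (snd q) \<in> coord (zidx P i)"
      unfolding zidx_def coord_Plus Gsub_simps by simp
    ultimately show ?case by simp
  qed
qed

definition D :: "'i \<Rightarrow> (real^('v + 'e + 'g)) \<times> (real^('p + 'h + 'k)) \<Rightarrow> real^('v + 'e + 'g)" where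
  "D i = frechet_derivative (\<lambda>q. Gsub P i (fst q) (snd q)) (at (z0 i, \<tau>0))"

lemma D: "((\<lambda>q. Gsub P i (fst q) (snd q)) has_derivative D i) (at (z0 i, \<tau>0))"
  using eventually_nhds_x_imp_x[OF Gsub_near[of i]] by (simp add: D_def flip: frechet_derivative_works)

lemma D_coord: "D i q \<in> coord (zidx P i)"
  by (rule has_derivative_coord[OF D], rule eventually_mono[OF Gsub_near]) blast

lemma D_linear: "linear (D i)"
  using D by (rule has_derivative_linear)

text \<open>Moving the coupling multipliers affects stationarity just as moving local ones does,
  through the agent's shares of the coupling gradients. Hence a single sum contains both.\<close>

lemma D_stationarity:
  assumes "vfst t = 0"
  shows "vfst (D i (w, t)) =
    Hs i *v vfst w + (\<Sum>c\<in>lidx P i. vjoin (vsnd w) (vsnd t) $ c *\<^sub>R gC i c)"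
proof -
  obtain DL where DL: "((\<lambda>p. grad (\<lambda>x. sub_lagr P i x (snd p)) (fst p)) has_derivative DL)
      (at (xi i, (m0 i, \<theta>0)))"
    using eventually_nhds_x_imp_x[OF sub_lagr_near[of i]]
    by (auto simp: grad_differentiable_def differentiable_def)
  have "((\<lambda>q. vfst (Gsub P i (fst q) (snd q))) has_derivative (\<lambda>q. DL (lift q))) (at (z0 i, \<tau>0))"
    unfolding Gsub_lift
    by (rule has_derivative_compose[where f = lift and f' = lift and g' = DL
          and g = "\<lambda>p. grad (\<lambda>x. sub_lagr P i x (snd p)) (fst p)"])
      (use DL in \<open>simp_all only: lift_base bounded_linear_imp_has_derivative bounded_linear_lift\<close>)
  moreover have "((\<lambda>q. vfst (Gsub P i (fst q) (snd q))) has_derivative (\<lambda>q. vfst (D i q))) (at (z0 i, \<tau>0))"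
    by (rule bounded_linear.has_derivative[OF bounded_linear_vfst D])
  ultimately have "vfst (D i (w, t)) = DL (lift (w, t))"
    using has_derivative_unique by (metis (no_types, lifting))
  also have "lift (w, t) = (vfst w, (vjoin (vsnd w) (vsnd t), 0))"
    using assms by (simp add: lift_def)
  also have "DL \<dots> = hessian (\<lambda>x. sub_lagr P i x (m0 i, \<theta>0)) (xi i) *v vfst w +
      (\<Sum>c\<in>lidx P i. vjoin (vsnd w) (vsnd t) $ c *\<^sub>R grad (\<lambda>x. lcon P i c x \<theta>0) (xi i))"
  proof (rule derivative_grad_lagr[OF DL])
    show "(\<lambda>x. objf P i x \<theta>0) differentiable (at (xi i))"
      by (rule differentiable_partial)
        (use eventually_nhds_x_imp_x[OF data_near_block(1)] in \<open>simp add: grad_differentiable_def\<close>)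
    show "(\<lambda>x. lcon P i c x \<theta>0) differentiable (at (xi i))" if "c \<in> lidx P i" for c
      by (rule differentiable_partial)
        (use eventually_nhds_x_imp_x[OF data_near_block(2)[OF that]] in \<open>simp add: grad_differentiable_def\<close>)
  qed
  \<comment> \<open>The equations are linearized at the block \<open>xi i\<close>, while the second
    order condition is stated at the stacked \<open>x\<close>.\<close>
  also have "hessian (\<lambda>x. sub_lagr P i x (m0 i, \<theta>0)) (xi i) = Hs i"
    unfolding Hs_def by (rule hessian_block) simp
  finally show ?thesis by (simp only: gC_block)
qed

lemma lcon_pr_derivative:
  assumes "c \<in> lidx P i"
  obtains Dc where
    "((\<lambda>q. lcon P i c (fst (pr q)) (snd (pr q))) has_derivative (\<lambda>q. Dc (pr q))) (at (z0 i, \<tau>0))"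
    "\<And>h. Dc (h, 0) = gC i c \<bullet> h"
proof -
  obtain Dc where Dc: "((\<lambda>q. lcon P i c (fst q) (snd q)) has_derivative Dc) (at (xi i, \<theta>0))"
    using eventually_nhds_x_imp_x[OF data_near_block(2)[OF assms]]
    by (auto simp: grad_differentiable_def differentiable_def)
  have "((\<lambda>q. lcon P i c (fst (pr q)) (snd (pr q))) has_derivative (\<lambda>q. Dc (pr q))) (at (z0 i, \<tau>0))"
    by (rule has_derivative_compose[where f = pr and f' = pr and g' = Dc
          and g = "\<lambda>p. lcon P i c (fst p) (snd p)"])
      (use Dc in \<open>simp_all only: pr_base bounded_linear_imp_has_derivative bounded_linear_pr\<close>)
  moreover have "Dc (h, 0) = gC i c \<bullet> h" for h
    unfolding gC_block by (rule derivative_partial_grad[OF Dc])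
  ultimately show thesis by (rule that)
qed

lemma D_nth:
  "((\<lambda>q. Gsub P i (fst q) (snd q) $ k) has_derivative (\<lambda>q. D i q $ k)) (at (z0 i, \<tau>0))"
  by (rule bounded_linear.has_derivative[OF bounded_linear_vec_nth D])

lemma D_equality:
  assumes "vfst t = 0" "j \<in> leq_idx P i"
  shows "D i (w, t) $ Inr (Inl j) = gC i (Inl (Inl j)) \<bullet> vfst w"
proof -
  obtain Dc where Dc: "((\<lambda>q. lcon P i (Inl (Inl j)) (fst (pr q)) (snd (pr q))) has_derivative (\<lambda>q. Dc (pr q)))
      (at (z0 i, \<tau>0))" "\<And>h. Dc (h, 0) = gC i (Inl (Inl j)) \<bullet> h"
    using lcon_pr_derivative[of "Inl (Inl j)" i] assms(2) by auto
  have "(\<lambda>q. Dc (pr q)) = (\<lambda>q. D i q $ Inr (Inl j))"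
    using has_derivative_unique[OF Dc(1)] D_nth[of i "Inr (Inl j)"] assms(2)
    by (simp only: Gsub_pr)
  from fun_cong[OF this, of "(w, t)"]
  have "D i (w, t) $ Inr (Inl j) = Dc (pr (w, t))" by simp
  then show ?thesis using assms(1) Dc(2) by (simp add: pr_def)
qed

lemma D_complementarity:
  assumes "vfst t = 0" "j \<in> lin_idx P i"
  shows "D i (w, t) $ Inr (Inr j) =
    w $ Inr (Inr j) * gloc P i x \<theta>0 $ j + \<mu> i $ j * (gC i (Inl (Inr j)) \<bullet> vfst w)"
proof -
  obtain Dc where Dc: "((\<lambda>q. lcon P i (Inl (Inr j)) (fst (pr q)) (snd (pr q))) has_derivative (\<lambda>q. Dc (pr q)))
      (at (z0 i, \<tau>0))" "\<And>h. Dc (h, 0) = gC i (Inl (Inr j)) \<bullet> h"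
    using lcon_pr_derivative[of "Inl (Inr j)" i] assms(2) by auto
  have "((\<lambda>q. fst q $ Inr (Inr j)) has_derivative (\<lambda>q. fst q $ Inr (Inr j))) (at (z0 i, \<tau>0))"
    by (intro bounded_linear_imp_has_derivative bounded_linear_compose[OF bounded_linear_vec_nth]
        bounded_linear_intros)
  from has_derivative_mult[OF this Dc(1)] D_nth[of i "Inr (Inr j)"]
  have "(\<lambda>q. fst (z0 i, \<tau>0) $ Inr (Inr j) * Dc (pr q) + fst q $ Inr (Inr j) *
      lcon P i (Inl (Inr j)) (fst (pr (z0 i, \<tau>0))) (snd (pr (z0 i, \<tau>0)))) = (\<lambda>q. D i q $ Inr (Inr j))"
    unfolding Gsub_pr(2)[OF assms(2)] by (rule has_derivative_unique)
  from fun_cong[OF this, of "(w, t)"] show ?thesis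
    using assms(1) Dc(2) by (simp add: pr_base z_of_def) (simp add: pr_def)
qed

section \<open>Linearized coupling equations\<close>

definition DC :: "(real^'v) \<times> (real^'k) \<times> (real^'p) \<Rightarrow> real^('h + 'k)" where
  "DC = frechet_derivative (\<lambda>q. Ccp P (fst q) (fst (snd q)) (snd (snd q))) (at (x, (lam, \<theta>0)))"

definition prC :: "(real^'v) \<times> (real^'k) \<times> (real^'p) \<Rightarrow> (real^'v) \<times> (real^'p)" where
  "prC q = (fst q, snd (snd q))"

lemma bounded_linear_prC: "bounded_linear prC"
  unfolding prC_def by (intro bounded_linear_intros)

lemma Ccp_prC:
  "j \<in> ceq_idx P \<Longrightarrow> Ccp P (fst q) (fst (snd q)) (snd (snd q)) $ Inl j =
    (\<Sum>i\<in>UNIV. lcon P i (Inr (Inl j)) (fst (prC q)) (snd (prC q)))"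
  "j' \<in> cin_idx P \<Longrightarrow> Ccp P (fst q) (fst (snd q)) (snd (snd q)) $ Inr j' =
    fst (snd q) $ j' * (\<Sum>i\<in>UNIV. lcon P i (Inr (Inr j')) (fst (prC q)) (snd (prC q)))"
  by (simp_all add: Ccp_nth prC_def)

lemma Ccp_near:
  "\<forall>\<^sub>F q in nhds (x, (lam, \<theta>0)).
     (\<lambda>q. Ccp P (fst q) (fst (snd q)) (snd (snd q))) differentiable (at q)"
proof -
  have "\<forall>\<^sub>F q in nhds (x, \<theta>0). \<forall>i\<in>UNIV. \<forall>c\<in>didx P. grad_differentiable (lcon P i (Inr c)) q"
    using data_near(2) by (intro eventually_ball_finite ballI) simp_all
  then have "\<forall>\<^sub>F q in nhds (prC (x, (lam, \<theta>0))). \<forall>i\<in>UNIV. \<forall>c\<in>didx P. grad_differentiable (lcon P i (Inr c)) q"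
    by (simp add: prC_def)
  then have "\<forall>\<^sub>F q in nhds (x, (lam, \<theta>0)). \<forall>i\<in>UNIV. \<forall>c\<in>didx P. grad_differentiable (lcon P i (Inr c)) (prC q)"
    by (rule eventually_compose_filterlim) (rule bounded_linear_nhds[OF bounded_linear_prC])
  then show ?thesis
  proof eventually_elim
    case (elim q)
    have c: "(\<lambda>q. lcon P i (Inr c) (fst (prC q)) (snd (prC q))) differentiable (at q)"
      if "c \<in> didx P" for c i
      by (rule differentiable_compose[of "\<lambda>p. lcon P i (Inr c) (fst p) (snd p)" prC])
        (use elim that bounded_linear_prC in
          \<open>auto simp: grad_differentiable_def intro: bounded_linear_imp_differentiable\<close>)
    have s: "(\<lambda>q. \<Sum>i\<in>UNIV. lcon P i (Inr c) (fst (prC q)) (snd (prC q))) differentiable (at q)"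
      if "c \<in> didx P" for c
      using c[OF that] by (intro differentiable_sum) auto
    have "(\<lambda>q. Ccp P (fst q) (fst (snd q)) (snd (snd q)) $ k) differentiable (at q)" for k
    proof (cases k)
      case (Inl j)
      show ?thesis
      proof (cases "j \<in> ceq_idx P")
        case True
        then show ?thesis using s[of "Inl j"] by (simp only: Inl Ccp_prC didx_simps)
      qed (simp add: Inl Ccp_nth)
    next
      case (Inr j)
      have l: "(\<lambda>q. fst (snd q) $ j) differentiable (at q)"
        by (intro bounded_linear_imp_differentiable bounded_linear_compose[OF bounded_linear_vec_nth]
            bounded_linear_intros)
      show ?thesis
      proof (cases "j \<in> cin_idx P")
        case True
        then show ?thesis
          using differentiable_mult[OF l s[of "Inr j"]] by (simp only: Inr Ccp_prC didx_simps)
      qed (simp add: Inr Ccp_nth)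
    qed
    then show ?case by (rule differentiable_vecI)
  qed
qed

lemma DC: "((\<lambda>q. Ccp P (fst q) (fst (snd q)) (snd (snd q))) has_derivative DC) (at (x, (lam, \<theta>0)))"
  using eventually_nhds_x_imp_x[OF Ccp_near] by (simp add: DC_def flip: frechet_derivative_works)

lemma DC_linear: "linear DC"
  using DC by (rule has_derivative_linear)

lemma DC_coord: "DC q \<in> coord (didx P)"
  by (rule has_derivative_coord[OF DC]) (simp add: Ccp_coord)

lemma DC_nth:
  "((\<lambda>q. Ccp P (fst q) (fst (snd q)) (snd (snd q)) $ k) has_derivative (\<lambda>q. DC q $ k)) (at (x, (lam, \<theta>0)))"
  by (rule bounded_linear.has_derivative[OF bounded_linear_vec_nth DC])

lemma lcon_prC_derivative:
  assumes "c \<in> didx P"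
  obtains Dc where
    "((\<lambda>q. \<Sum>i\<in>UNIV. lcon P i (Inr c) (fst (prC q)) (snd (prC q))) has_derivative (\<lambda>q. Dc (prC q)))
      (at (x, (lam, \<theta>0)))"
    "\<And>h. Dc (h, 0) = (\<Sum>i\<in>UNIV. gC i (Inr c) \<bullet> h)"
proof -
  have "\<exists>Dc. ((\<lambda>q. lcon P i (Inr c) (fst q) (snd q)) has_derivative Dc) (at (x, \<theta>0))" for i
    using eventually_nhds_x_imp_x[OF data_near(2)[of "Inr c" i]] assms
    by (auto simp: grad_differentiable_def differentiable_def)
  then obtain Dc where Dc: "\<And>i. ((\<lambda>q. lcon P i (Inr c) (fst q) (snd q)) has_derivative Dc i) (at (x, \<theta>0))"
    by metis
  have "((\<lambda>q. lcon P i (Inr c) (fst (prC q)) (snd (prC q))) has_derivative (\<lambda>q. Dc i (prC q)))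
      (at (x, (lam, \<theta>0)))" for i
    by (rule has_derivative_compose[where f = prC and f' = prC and g' = "Dc i"
          and g = "\<lambda>p. lcon P i (Inr c) (fst p) (snd p)"])
      (use Dc[of i] in \<open>simp_all add: bounded_linear_imp_has_derivative bounded_linear_prC, simp add: prC_def\<close>)
  then have "((\<lambda>q. \<Sum>i\<in>UNIV. lcon P i (Inr c) (fst (prC q)) (snd (prC q))) has_derivative
      (\<lambda>q. \<Sum>i\<in>UNIV. Dc i (prC q))) (at (x, (lam, \<theta>0)))"
    by (intro has_derivative_sum)
  moreover have "Dc i (h, 0) = gC i (Inr c) \<bullet> h" for h i
    unfolding gC_def by (rule derivative_partial_grad[OF Dc])
  ultimately show thesis
    by (intro that[of "\<lambda>p. \<Sum>i\<in>UNIV. Dc i p"]) simp_all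
qed

lemma DC_equality:
  assumes "j \<in> ceq_idx P"
  shows "DC (h, (b, 0)) $ Inl j = (\<Sum>i\<in>UNIV. gC i (Inr (Inl j)) \<bullet> h)"
proof -
  obtain Dc where Dc:
    "((\<lambda>q. \<Sum>i\<in>UNIV. lcon P i (Inr (Inl j)) (fst (prC q)) (snd (prC q))) has_derivative (\<lambda>q. Dc (prC q)))
      (at (x, (lam, \<theta>0)))"
    "\<And>h. Dc (h, 0) = (\<Sum>i\<in>UNIV. gC i (Inr (Inl j)) \<bullet> h)"
    using lcon_prC_derivative[of "Inl j"] assms by auto
  have "(\<lambda>q. Dc (prC q)) = (\<lambda>q. DC q $ Inl j)"
    using has_derivative_unique[OF Dc(1)] DC_nth[of "Inl j"] assms by (simp only: Ccp_prC)
  from fun_cong[OF this, of "(h, (b, 0))"]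
  have "DC (h, (b, 0)) $ Inl j = Dc (prC (h, (b, 0)))" by simp
  then show ?thesis using Dc(2) by (simp add: prC_def)
qed

lemma DC_complementarity:
  assumes "j \<in> cin_idx P"
  shows "DC (h, (b, 0)) $ Inr j =
    lam $ j * (\<Sum>i\<in>UNIV. gC i (Inr (Inr j)) \<bullet> h) + b $ j * (\<Sum>i\<in>UNIV. Fcp P i x \<theta>0 $ j)"
proof -
  obtain Dc where Dc:
    "((\<lambda>q. \<Sum>i\<in>UNIV. lcon P i (Inr (Inr j)) (fst (prC q)) (snd (prC q))) has_derivative (\<lambda>q. Dc (prC q)))
      (at (x, (lam, \<theta>0)))"
    "\<And>h. Dc (h, 0) = (\<Sum>i\<in>UNIV. gC i (Inr (Inr j)) \<bullet> h)"
    using lcon_prC_derivative[of "Inr j"] assms by auto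
  have "((\<lambda>q. fst (snd q) $ j) has_derivative (\<lambda>q. fst (snd q) $ j)) (at (x, (lam, \<theta>0)))"
    by (intro bounded_linear_imp_has_derivative bounded_linear_compose[OF bounded_linear_vec_nth]
        bounded_linear_intros)
  from has_derivative_mult[OF this Dc(1)] DC_nth[of "Inr j"]
  have "(\<lambda>q. fst (snd (x, (lam, \<theta>0))) $ j * Dc (prC q) + fst (snd q) $ j *
      (\<Sum>i\<in>UNIV. lcon P i (Inr (Inr j)) (fst (prC (x, (lam, \<theta>0)))) (snd (prC (x, (lam, \<theta>0)))))) =
      (\<lambda>q. DC q $ Inr j)"
    unfolding Ccp_prC(2)[OF assms] by (rule has_derivative_unique)
  from fun_cong[OF this, of "(h, (b, 0))"] show ?thesis
    using Dc(2) by (simp add: prC_def)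
qed

end

section \<open>Local Jacobians\<close>

text \<open>The two summands lie in complementary coordinate subspaces, so nothing can
  cancel.\<close>

lemma residual_eq_0_iff:
  assumes "a \<in> coord S"
  shows "a + (w - vrestr S w) = 0 \<longleftrightarrow> a = 0 \<and> w \<in> coord S"
proof
  assume *: "a + (w - vrestr S w) = 0"
  have "a $ k = 0 \<and> (k \<notin> S \<longrightarrow> w $ k = 0)" for k
    using assms arg_cong[OF *, of "\<lambda>v. v $ k"]
    by (cases "k \<in> S") (auto simp: coord_def vrestr_nth)
  then show "a = 0 \<and> w \<in> coord S"
    by (simp add: coord_def vec_eq_iff)
qed simp

lemma matrix_vector_mult_minus: "(- A) *v (v :: real^'n) = - (A *v v)" for A :: "real^'n^'m"
  by (simp add: matrix_vector_mult_def vec_eq_iff sum_negf)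

text \<open>Whichever of the strict signs holds at \<open>q\<close> persists nearby, and the
  vanishing product then makes the other factor zero. This recovers the KKT inequalities from the
  KKT equations.\<close>

lemma eventually_signs:
  fixes a b :: "'a::t2_space \<Rightarrow> real"
  assumes "isCont a q" "isCont b q" "a q < 0 \<or> 0 < b q"
  shows "\<forall>\<^sub>F q' in nhds q. b q' * a q' = 0 \<longrightarrow> a q' \<le> 0 \<and> 0 \<le> b q'"
  using assms(3)
proof
  assume "a q < 0"
  then have "\<forall>\<^sub>F q' in nhds q. a q' < 0"
    using order_tendstoD(2)[OF isCont_nhds[OF assms(1)]] by blast
  then show ?thesis by eventually_elim auto
next
  assume "0 < b q"
  then have "\<forall>\<^sub>F q' in nhds q. 0 < b q'"
    using order_tendstoD(1)[OF isCont_nhds[OF assms(2)]] by blast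
  then show ?thesis by eventually_elim auto
qed

context regular_kkt_point
begin

text \<open>The direction \<open>vjoin 0 \<gamma>\<close> keeps the problem data fixed and moves
  only the coupling multipliers.\<close>

lemma linearized_system_zero:
  assumes w: "\<And>i. w i \<in> coord (zidx P i)" and \<gamma>: "\<gamma> \<in> coord (didx P)"
    and D0: "\<And>i. D i (w i, vjoin 0 \<gamma>) = 0"
    and coup: "\<And>j. j \<in> didx P \<Longrightarrow> \<gamma> $ j * (\<Sum>i\<in>UNIV. gC i (Inr j) \<bullet> vfst (w i)) = 0"
    and nbc: "\<And>j. j \<in> cin_idx P \<Longrightarrow> (\<Sum>i\<in>UNIV. Fcp P i x \<theta>0 $ j) \<noteq> 0 \<Longrightarrow> \<gamma> $ Inr j = 0"
  shows "w i = 0" "\<gamma> = 0"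
proof -
  have u: "vfst (w i) \<in> coord (xblk P i)" and v: "vsnd (w i) \<in> coord (leq_idx P i <+> lin_idx P i)" for i
    using w[of i] by (simp_all add: zidx_def coord_Plus)
  have st: "Hs i *v vfst (w i) + (\<Sum>c\<in>lidx P i. vjoin (vsnd (w i)) \<gamma> $ c *\<^sub>R gC i c) = 0" for i
    using D_stationarity[of "vjoin 0 \<gamma>" i "w i"] D0[of i] by simp
  have eq: "gC i (Inl (Inl j)) \<bullet> vfst (w i) = 0" if "j \<in> leq_idx P i" for i j
    using D_equality[of "vjoin 0 \<gamma>" j i "w i"] D0[of i] that by simp
  have co: "vsnd (w i) $ Inr j * gloc P i x \<theta>0 $ j + \<mu> i $ j * (gC i (Inl (Inr j)) \<bullet> vfst (w i)) = 0"
    if "j \<in> lin_idx P i" for i j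
    using D_complementarity[of "vjoin 0 \<gamma>" j i "w i"] D0[of i] that by simp
  note z = linearized_kkt_zero[of "\<lambda>i. vfst (w i)" "\<lambda>i. vsnd (w i)" \<gamma>, OF u v \<gamma> st eq co coup nbc]
  show "w i = 0" using z(1)[of i] z(2)[of i] by (simp add: vec_sum_eq_iff)
  show "\<gamma> = 0" by (rule z(3))
qed

lemma local_system_zero:
  assumes "w \<in> coord (zidx P i)" "D i (w, 0) = 0"
  shows "w = 0"
proof -
  \<comment> \<open>All other agents stay at rest, which lets the independence of the global
    gradients be applied to a single subproblem.\<close>
  have "(if k = i then w else 0) \<in> coord (zidx P k)" for k
    using assms(1) by simp
  moreover have "D k (if k = i then w else 0, vjoin 0 0) = 0" for k
    using assms(2) linear_0[OF D_linear[of k]] by (simp add: zero_prod_def)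
  ultimately show ?thesis
    using linearized_system_zero(1)[of "\<lambda>k. if k = i then w else 0" 0 i] by simp
qed

lemma coupled_system_zero:
  assumes w: "\<And>i. w i \<in> coord (zidx P i)" and \<gamma>: "\<gamma> \<in> coord (didx P)"
    and D0: "\<And>i. D i (w i, vjoin 0 \<gamma>) = 0"
    and DC0: "DC (\<Sum>i\<in>UNIV. vfst (w i), (vsnd \<gamma>, 0)) = 0"
  shows "w i = 0" "\<gamma> = 0"
proof -
  let ?u = "\<Sum>i\<in>UNIV. vfst (w i)"
  have "vfst (w i) \<in> coord (xblk P i)" for i
    using w[of i] by (simp add: zidx_def coord_Plus)
  then have vr: "vrestr (xblk P i) ?u = vfst (w i)" for i
    by (rule vrestr_xblk_sum)
  have inner: "gC i (Inr j) \<bullet> ?u = gC i (Inr j) \<bullet> vfst (w i)" if "j \<in> didx P" for i j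
    using inner_vrestr[OF gC_coord[of "Inr j" i], of ?u] that by (simp add: vr)
  have eq: "(\<Sum>i\<in>UNIV. gC i (Inr (Inl j)) \<bullet> vfst (w i)) = 0" if "j \<in> ceq_idx P" for j
    using DC_equality[OF that, of ?u "vsnd \<gamma>"] DC0 inner[of "Inl j"] that by simp
  have ineq: "lam $ j * (\<Sum>i\<in>UNIV. gC i (Inr (Inr j)) \<bullet> vfst (w i)) +
      \<gamma> $ Inr j * (\<Sum>i\<in>UNIV. Fcp P i x \<theta>0 $ j) = 0" if "j \<in> cin_idx P" for j
    using DC_complementarity[OF that, of ?u "vsnd \<gamma>"] DC0 inner[of "Inr j"] that by simp
  \<comment> \<open>For an active inequality the row \<open>ineq\<close> makes the sum of shares
    zero; for an inactive one it makes \<gamma> zero. The product vanishes either way.\<close>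
  have coup: "\<gamma> $ j * (\<Sum>i\<in>UNIV. gC i (Inr j) \<bullet> vfst (w i)) = 0" if "j \<in> didx P" for j
  proof (cases j)
    case (Inl l)
    then show ?thesis using eq[of l] that by simp
  next
    case (Inr l)
    then have l: "l \<in> cin_idx P" using that by simp
    show ?thesis using complementarity(2)[OF l] ineq[OF l] Inr by auto
  qed
  have nbc: "\<gamma> $ Inr j = 0" if "j \<in> cin_idx P" "(\<Sum>i\<in>UNIV. Fcp P i x \<theta>0 $ j) \<noteq> 0" for j
    using complementarity(2)[OF that(1)] ineq[OF that(1)] that(2) by auto
  show "w i = 0" "\<gamma> = 0"
    by (rule linearized_system_zero[of w \<gamma>, OF w \<gamma> D0 coup nbc]; assumption)+
qed

section \<open>The local matrix and the local Jacobian\<close>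

lemma DzG_mult: "DzG P i (z0 i) \<tau>0 *v w = D i (w, 0)"
  unfolding DzG_def by (rule jacobian_mult_vec[OF has_derivative_partial[OF D]])

lemma DtG_mult: "DtG P i (z0 i) \<tau>0 *v t = D i (0, t)"
  unfolding DtG_def by (rule jacobian_mult_vec[OF has_derivative_partial2[OF D]])

lemma D_add: "D i (a, b) + D i (c, d) = D i (a + c, b + d)"
  using linear_add[OF D_linear, of i "(a, b)" "(c, d)"] by simp

lemma invertible_DzG: "invertible_on (zidx P i) (DzG P i (z0 i) \<tau>0)"
  by (rule invertible_onI) (metis DzG_mult D_coord in_coord_0_iff local_system_zero)

lemmas DzG_inverse = inverse_on[OF invertible_DzG]

text \<open>Characterizes the explicit formula with the inverse matrix by the linearized equation
  \<open>D i (w, t) = 0\<close>. Both branch derivatives and the coupling matrix are identified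
  through it.\<close>

lemma local_jacobian_mult:
  assumes "w \<in> coord (zidx P i)" "D i (w, t) = 0"
  shows "local_jacobian P i (z0 i) \<tau>0 *v t = vfst w"
proof -
  let ?A = "DzG P i (z0 i) \<tau>0" and ?B = "inverse_on (zidx P i) (DzG P i (z0 i) \<tau>0)"
  have "?A *v w + DtG P i (z0 i) \<tau>0 *v t = 0"
    unfolding DzG_mult DtG_mult D_add using assms(2) by simp
  then have "DtG P i (z0 i) \<tau>0 *v t = ?A *v (- w)"
    by (simp add: eq_neg_iff_add_eq_0 add.commute linear_neg)
  moreover have "?B *v (?A *v (- w)) = - w"
    by (rule is_inverse_on_left[OF DzG_inverse]) (use assms(1) in \<open>simp add: coord_def\<close>)
  ultimately show ?thesis
    by (simp add: local_jacobian_def matrix_vector_mult_minus hcat_mult_vec flip: matrix_vector_mul_assoc)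
qed

lemma local_system_solvable:
  obtains w where "w \<in> coord (zidx P i)" "D i (w, t) = 0"
proof -
  let ?A = "DzG P i (z0 i) \<tau>0" and ?B = "inverse_on (zidx P i) (DzG P i (z0 i) \<tau>0)"
  let ?y = "D i (0, t)"
  define w where "w = ?B *v (- ?y)"
  have y: "- ?y \<in> coord (zidx P i)"
    using D_coord[of i "(0, t)"] by (simp add: coord_def)
  \<comment> \<open>The inverse controls only the rows in \<open>zidx P i\<close>; the remaining
    rows vanish because \<open>D i\<close> takes values in that coordinate subspace.\<close>
  have "?A *v w = - ?y"
    unfolding w_def by (rule is_inverse_on_right_coord[OF DzG_inverse y]) (simp only: DzG_mult D_coord)
  then have "D i (w, t) = 0"
    using D_add[of i w 0 0 t] by (simp add: DzG_mult)
  moreover have "w \<in> coord (zidx P i)"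
    unfolding w_def by (rule is_inverse_on_coord[OF DzG_inverse])
  ultimately show thesis by (rule that[rotated])
qed

abbreviation J where "J \<equiv> stacked_jacobian P (z_of P x \<pi> \<mu>) \<tau>0"

lemma stacked_jacobian_mult:
  assumes "\<And>i. w i \<in> coord (zidx P i)" "\<And>i. D i (w i, t) = 0"
  shows "J *v t = (\<Sum>i\<in>UNIV. vfst (w i))"
proof -
  have u: "vfst (w i) \<in> coord (xblk P i)" for i
    using assms(1)[of i] by (simp add: zidx_def coord_Plus)
  have "(J *v t) $ v = (\<Sum>i\<in>UNIV. vfst (w i)) $ v" for v
  proof -
    have "(J *v t) $ v = (local_jacobian P (var_owner P v) (z0 (var_owner P v)) \<tau>0 *v t) $ v"
      by (simp add: stacked_jacobian_def matrix_vector_mult_def)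
    also have "\<dots> = vfst (w (var_owner P v)) $ v"
      by (simp only: local_jacobian_mult[OF assms])
    also have "\<dots> = vrestr (xblk P (var_owner P v)) (\<Sum>i\<in>UNIV. vfst (w i)) $ v"
      by (simp only: vrestr_xblk_sum[of "\<lambda>i. vfst (w i)", OF u])
    also have "\<dots> = (\<Sum>i\<in>UNIV. vfst (w i)) $ v"
      by (simp add: vrestr_nth xblk_def)
    finally show ?thesis .
  qed
  then show ?thesis by (simp add: vec_eq_iff)
qed

text \<open>
  The term added to the KKT equations vanishes exactly on the coordinate subspace and turns them
  into a square system on the ambient space.
\<close>

definition R where
  "R i q = Gsub P i (fst q) (snd q) + (fst q - vrestr (zidx P i) (fst q))"

definition R' where
  "R' i h = D i h + (fst h - vrestr (zidx P i) (fst h))"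

lemma R_derivative: "(R i has_derivative R' i) (at (z0 i, \<tau>0))"
  unfolding R_def[abs_def] R'_def[abs_def]
  by (intro derivative_intros D bounded_linear.has_derivative[OF bounded_linear_vrestr])

lemma R'_eq_0_iff: "R' i h = 0 \<longleftrightarrow> D i h = 0 \<and> fst h \<in> coord (zidx P i)"
  unfolding R'_def by (rule residual_eq_0_iff[OF D_coord])

lemma R_differentiable_near: "\<forall>\<^sub>F q in nhds (z0 i, \<tau>0). R i differentiable (at q)"
  using Gsub_near
proof eventually_elim
  case (elim q)
  have "(\<lambda>q. vrestr (zidx P i) (fst q)) differentiable (at q)"
    by (intro bounded_linear_imp_differentiable bounded_linear_compose[OF bounded_linear_vrestr]
        bounded_linear_intros)
  moreover have "fst differentiable (at q)"
    by (intro bounded_linear_imp_differentiable bounded_linear_intros)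
  ultimately show ?case
    unfolding R_def[abs_def] using elim by (intro differentiable_add differentiable_diff) auto
qed

text \<open>\<open>R i q = 0\<close> encodes the equations and membership in the coordinate
  subspace. The sign conditions then hold automatically near the base point, by strict
  complementarity.\<close>

lemma sub_kkt_near:
  "\<forall>\<^sub>F q in nhds (z0 i, \<tau>0). sub_kkt P i (fst q) (snd q) \<longleftrightarrow> R i q = 0"
proof -
  have "\<forall>\<^sub>F q in nhds (z0 i, \<tau>0). vsnd (vsnd (fst q)) $ j * gloc P i (vfst (fst q)) (vfst (snd q)) $ j = 0 \<longrightarrow>
      gloc P i (vfst (fst q)) (vfst (snd q)) $ j \<le> 0 \<and> 0 \<le> vsnd (vsnd (fst q)) $ j"
    if j: "j \<in> lin_idx P i" for j
  proof -
    obtain Dc where "((\<lambda>q. lcon P i (Inl (Inr j)) (fst (pr q)) (snd (pr q))) has_derivative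
        (\<lambda>q. Dc (pr q))) (at (z0 i, \<tau>0))"
      using lcon_pr_derivative[of "Inl (Inr j)" i] j by auto
    then have 1: "isCont (\<lambda>q. gloc P i (vfst (fst q)) (vfst (snd q)) $ j) (z0 i, \<tau>0)"
      by (simp add: pr_def has_derivative_continuous)
    have 2: "isCont (\<lambda>q. vsnd (vsnd (fst q)) $ j) (z0 i, \<tau>0)"
      by (intro linear_continuous_at bounded_linear_compose[OF bounded_linear_vec_nth]
          bounded_linear_compose[OF bounded_linear_vsnd] bounded_linear_intros)
    show ?thesis
      by (rule eventually_signs[OF 1 2]) (use complementarity(1)[OF j] in \<open>auto simp: z_of_def\<close>)
  qed
  then have "\<forall>\<^sub>F q in nhds (z0 i, \<tau>0). \<forall>j\<in>lin_idx P i.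
      vsnd (vsnd (fst q)) $ j * gloc P i (vfst (fst q)) (vfst (snd q)) $ j = 0 \<longrightarrow>
      gloc P i (vfst (fst q)) (vfst (snd q)) $ j \<le> 0 \<and> 0 \<le> vsnd (vsnd (fst q)) $ j"
    by (intro eventually_ball_finite) auto
  then show ?thesis
    using Gsub_near
  proof eventually_elim
    case (elim q)
    have "vsnd (vsnd (fst q)) $ j * gloc P i (vfst (fst q)) (vfst (snd q)) $ j = 0"
      if "Gsub P i (fst q) (snd q) = 0" "j \<in> lin_idx P i" for j
      using that Gsub_nth(3)[of P i "fst q" "snd q" j] by simp
    then show ?case
      using elim residual_eq_0_iff[of "Gsub P i (fst q) (snd q)" "zidx P i" "fst q"]
      unfolding sub_kkt_def R_def by blast
  qed
qed

lemma local_branch_iff: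
  "local_branch P i (z0 i) \<tau>0 Z \<longleftrightarrow>
    Z \<tau>0 = z0 i \<and> isCont Z \<tau>0 \<and> (\<forall>\<^sub>F \<tau> in nhds \<tau>0. R i (Z \<tau>, \<tau>) = 0)"
proof -
  have "(\<forall>\<^sub>F \<tau> in nhds \<tau>0. sub_kkt P i (Z \<tau>) \<tau>) \<longleftrightarrow> (\<forall>\<^sub>F \<tau> in nhds \<tau>0. R i (Z \<tau>, \<tau>) = 0)"
    if "Z \<tau>0 = z0 i" "isCont Z \<tau>0"
  proof -
    have "filterlim (\<lambda>\<tau>. (Z \<tau>, \<tau>)) (nhds (z0 i, \<tau>0)) (nhds \<tau>0)"
      using isCont_nhds[OF that(2)] that(1) by (intro tendsto_Pair filterlim_ident) simp
    from eventually_compose_filterlim[OF sub_kkt_near this]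
    have "\<forall>\<^sub>F \<tau> in nhds \<tau>0. sub_kkt P i (Z \<tau>) \<tau> \<longleftrightarrow> R i (Z \<tau>, \<tau>) = 0"
      by simp
    then show ?thesis by (rule eventually_cong)
  qed
  then show ?thesis
    unfolding local_branch_def by blast
qed

lemma R_base: "R i (z0 i, \<tau>0) = 0"
  using eventually_nhds_x_imp_x[OF sub_kkt_near[of i]] sub_kkt0[of i] by simp

lemma R'_inj: "R' i (w, 0) = 0 \<Longrightarrow> w = 0"
  using local_system_zero[of w i] by (simp add: R'_eq_0_iff)

lemma local_branch_exists: "\<exists>Z. local_branch P i (z0 i) \<tau>0 Z"
  unfolding local_branch_iff
  by (rule implicit_branch_exists[OF R_differentiable_near R_derivative R'_inj[of i] R_base])

text \<open>The derivative of any branch satisfies the linearized equation, which singles out the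
  local Jacobian.\<close>

lemma local_branch_derivative:
  assumes "local_branch P i (z0 i) \<tau>0 Z"
  shows "((\<lambda>t. vfst (Z t)) has_derivative (\<lambda>d. local_jacobian P i (z0 i) \<tau>0 *v d)) (at \<tau>0)"
proof -
  have Z: "Z \<tau>0 = z0 i" "isCont Z \<tau>0" "\<forall>\<^sub>F \<tau> in nhds \<tau>0. R i (Z \<tau>, \<tau>) = 0"
    using assms by (auto simp: local_branch_iff)
  obtain g where g: "(Z has_derivative g) (at \<tau>0)" "\<And>d. R' i (g d, d) = 0"
    using implicit_branch_has_derivative[OF R_derivative R'_inj[of i] Z] by blast
  have "local_jacobian P i (z0 i) \<tau>0 *v d = vfst (g d)" for d
    using g(2)[of d] by (intro local_jacobian_mult) (simp_all add: R'_eq_0_iff)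
  then show ?thesis
    using bounded_linear.has_derivative[OF bounded_linear_vfst g(1)] by simp
qed

end

section \<open>The coupling system\<close>

lemma vec_lambda_eq_0_iff: "(\<chi> i. f i) = 0 \<longleftrightarrow> (\<forall>i. f i = 0)"
  for f :: "'n::finite \<Rightarrow> 'b::zero"
  by (simp add: vec_eq_iff)

context regular_kkt_point
begin

abbreviation N where "N \<equiv> coupling_matrix P \<theta>0 x \<pi> \<mu> \<nu> lam"
abbreviation Q where "Q \<equiv> coupling_rhs P \<theta>0 x \<pi> \<mu> \<nu> lam"

section \<open>The coupling matrix as a linear map\<close>

lemma DC_add: "DC (a, (b, c)) + DC (a', (b', c')) = DC (a + a', (b + b', c + c'))"
  using linear_add[OF DC_linear, of "(a, (b, c))" "(a', (b', c'))"] by simp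

lemma DxC_mult: "jacobian (\<lambda>x. Ccp P x lam \<theta>0) (at x) *v h = DC (h, 0)"
  using jacobian_mult_vec[OF has_derivative_partial[of "\<lambda>x p. Ccp P x (fst p) (snd p)", OF DC]]
  by simp

lemma DlC_mult: "jacobian (\<lambda>lam. Ccp P x lam \<theta>0) (at lam) *v b = DC (0, (b, 0))"
  using jacobian_mult_vec[OF has_derivative_partial[of "\<lambda>l t. Ccp P x l t",
        OF has_derivative_partial2[of "\<lambda>x p. Ccp P x (fst p) (snd p)", OF DC]]]
  by simp

lemma DtC_mult: "jacobian (\<lambda>\<theta>. Ccp P x lam \<theta>) (at \<theta>0) *v d = DC (0, (0, d))"
  using jacobian_mult_vec[OF has_derivative_partial2[of "\<lambda>l t. Ccp P x l t",
        OF has_derivative_partial2[of "\<lambda>x p. Ccp P x (fst p) (snd p)", OF DC]]]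
  by simp

text \<open>The coupling matrix is minus the derivative of the coupling equations along a dual
  displacement followed by the primal response \<open>J\<close> to it. \<nu> acts only through that
  response; \<lambda> also acts directly.\<close>

lemma coupling_matrix_mult: "N *v \<gamma> = - DC (J *v vjoin 0 \<gamma>, (vsnd \<gamma>, 0))"
proof -
  have J: "J *v vjoin 0 (vjoin (vfst \<gamma>) 0) + J *v vjoin 0 (vjoin 0 (vsnd \<gamma>)) = J *v vjoin 0 \<gamma>"
    by (simp flip: matrix_vector_right_distrib vjoin_add)
  have "N *v \<gamma> = - (DC (J *v vjoin 0 (vjoin (vfst \<gamma>) 0), 0) +
      (DC (J *v vjoin 0 (vjoin 0 (vsnd \<gamma>)), 0) + DC (0, (vsnd \<gamma>, 0))))"
    unfolding coupling_matrix_def Let_def matrix_vector_mult_minus hcat_mult_vec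
      matrix_vector_mult_add_rdistrib matrix_vector_mul_assoc[symmetric] lcols_mult_vec rcols_mult_vec
      DxC_mult DlC_mult ..
  then show ?thesis
    by (simp add: zero_prod_def DC_add flip: J)
qed

lemma coupling_rhs_mult: "Q *v d = DC (J *v vjoin d 0, (0, d))"
proof -
  have "Q *v d = DC (J *v vjoin d 0, 0) + DC (0, (0, d))"
    unfolding coupling_rhs_def Let_def matrix_vector_mult_add_rdistrib
      matrix_vector_mul_assoc[symmetric] lcols_mult_vec DxC_mult DtC_mult ..
  then show ?thesis
    by (simp add: zero_prod_def DC_add)
qed

lemma coupling_matrix_coord: "N *v \<gamma> \<in> coord (didx P)"
  unfolding coupling_matrix_mult using DC_coord by (simp add: coord_def)

lemma coupling_rhs_coord: "Q *v d \<in> coord (didx P)"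
  unfolding coupling_rhs_mult by (rule DC_coord)

lemma coupling_system_zero:
  assumes "\<gamma> \<in> coord (didx P)" "N *v \<gamma> = 0"
  shows "\<gamma> = 0"
proof -
  have "\<exists>w. w \<in> coord (zidx P i) \<and> D i (w, vjoin 0 \<gamma>) = 0" for i
    using local_system_solvable by metis
  \<comment> \<open>The local responses to \<gamma> extend it to a solution of the full linearized
    system, where the kernel is already known to be trivial.\<close>
  then obtain w where w: "\<And>i. w i \<in> coord (zidx P i)" "\<And>i. D i (w i, vjoin 0 \<gamma>) = 0"
    by metis
  have "DC (\<Sum>i\<in>UNIV. vfst (w i), (vsnd \<gamma>, 0)) = 0"
    using assms(2) unfolding coupling_matrix_mult stacked_jacobian_mult[OF w] by simp
  then show ?thesis
    by (rule coupled_system_zero(2)[OF w(1) assms(1) w(2)])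
qed

lemma invertible_coupling_matrix: "invertible_on (didx P) N"
  by (rule invertible_onI)
    (use coupling_system_zero in_coord_0_iff[OF coupling_matrix_coord] in blast)

lemmas N_inverse = inverse_on[OF invertible_coupling_matrix]

lemma row_zero_iff: "(\<forall>r. r \<notin> S \<longrightarrow> y $ r = 0) \<longleftrightarrow> (\<forall>d. y *v d \<in> coord S)"
  for y :: "real^'b^'c"
proof
  assume "\<forall>d. y *v d \<in> coord S"
  then have "(y *v axis k 1) $ r = 0" if "r \<notin> S" for r k
    using that by (simp add: coord_def)
  then show "\<forall>r. r \<notin> S \<longrightarrow> y $ r = 0"
    by (simp add: matrix_vector_mult_basis column_def vec_eq_iff)
qed (simp add: coord_def matrix_vector_mult_def)

lemma solves_coupling_iff:
  "solves_coupling P \<theta>0 x \<pi> \<mu> \<nu> lam y \<longleftrightarrow>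
    (\<forall>d. y *v d \<in> coord (didx P) \<and> N *v (y *v d) = Q *v d)"
  unfolding solves_coupling_def row_zero_iff
  by (auto simp: matrix_eq matrix_vector_mul_assoc)

text \<open>The matrix equation ranges over the ambient type, but both sides vanish outside
  \<open>didx P\<close>, so the inverse of the principal part solves all of it.\<close>

lemma solves_coupling_iff_inverse:
  "solves_coupling P \<theta>0 x \<pi> \<mu> \<nu> lam y \<longleftrightarrow> y = inverse_on (didx P) N ** Q"
proof
  assume y: "solves_coupling P \<theta>0 x \<pi> \<mu> \<nu> lam y"
  then have "inverse_on (didx P) N *v (Q *v d) = y *v d" for d
    using is_inverse_on_left[OF N_inverse, of "y *v d"] by (simp add: solves_coupling_iff)
  then show "y = inverse_on (didx P) N ** Q"
    by (simp add: matrix_eq flip: matrix_vector_mul_assoc)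
next
  assume "y = inverse_on (didx P) N ** Q"
  then have y: "y *v d = inverse_on (didx P) N *v (Q *v d)" for d
    by (simp add: matrix_vector_mul_assoc)
  then show "solves_coupling P \<theta>0 x \<pi> \<mu> \<nu> lam y"
    unfolding solves_coupling_iff y
    using is_inverse_on_coord[OF N_inverse]
      is_inverse_on_right_coord[OF N_inverse coupling_rhs_coord coupling_matrix_coord] by blast
qed

section \<open>Branches of the coupled problem\<close>

text \<open>The joint unknown is a family of primal-dual vectors with the coupling multipliers. For
  agent i the latter move into the parameter of its subproblem.\<close>

definition lift_loc ::
  "'i \<Rightarrow> ((real^('v + 'e + 'g)^'i) \<times> (real^('h + 'k))) \<times> (real^'p) \<Rightarrow>
    (real^('v + 'e + 'g)) \<times> (real^('p + 'h + 'k))" where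
  "lift_loc i q = (fst (fst q) $ i, vjoin (snd q) (snd (fst q)))"

text \<open>The stacked x is not an unknown of its own: it is the sum of the agents' primal
  blocks.\<close>

definition lift_cp ::
  "((real^('v + 'e + 'g)^'i) \<times> (real^('h + 'k))) \<times> (real^'p) \<Rightarrow> (real^'v) \<times> (real^'k) \<times> (real^'p)" where
  "lift_cp q = (\<Sum>i\<in>UNIV. vfst (fst (fst q) $ i), (vsnd (snd (fst q)), snd q))"

lemma bounded_linear_lift_loc: "bounded_linear (lift_loc i)"
proof -
  have "linear (lift_loc i)"
    by (intro linearI) (simp_all add: lift_loc_def vjoin_add vjoin_scaleR)
  then show ?thesis by (simp add: linear_conv_bounded_linear)
qed

lemma bounded_linear_lift_cp: "bounded_linear lift_cp"
proof -
  have "linear lift_cp"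
    by (intro linearI) (simp_all add: lift_cp_def sum.distrib scaleR_sum_right)
  then show ?thesis by (simp add: linear_conv_bounded_linear)
qed

definition w0 :: "(real^('v + 'e + 'g)^'i) \<times> (real^('h + 'k))" where
  "w0 = ((\<chi> i. z0 i), vjoin \<nu> lam)"

lemma lift_loc_base: "lift_loc i (w0, \<theta>0) = (z0 i, \<tau>0)"
  and lift_cp_base: "lift_cp (w0, \<theta>0) = (x, (lam, \<theta>0))"
  by (simp_all add: lift_loc_def lift_cp_def w0_def tau_of_def sum_vrestr_xblk)

definition C where
  "C q = Ccp P (fst (lift_cp q)) (fst (snd (lift_cp q))) (snd (snd (lift_cp q)))"

text \<open>The coupled KKT equations as a square system. The difference added to \<open>C q\<close>
  confines the coupling multipliers to \<open>didx P\<close>, just as in \<open>R\<close> for the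
  local unknowns.\<close>

definition F where
  "F q = ((\<chi> i. R i (lift_loc i q)), C q + (snd (fst q) - vrestr (didx P) (snd (fst q))))"

definition F' where
  "F' h = ((\<chi> i. R' i (lift_loc i h)),
    DC (lift_cp h) + (snd (fst h) - vrestr (didx P) (snd (fst h))))"

lemma C_derivative: "(C has_derivative (\<lambda>h. DC (lift_cp h))) (at (w0, \<theta>0))"
  unfolding C_def[abs_def]
  by (rule has_derivative_compose[where f = lift_cp and f' = lift_cp and g' = DC
        and g = "\<lambda>q. Ccp P (fst q) (fst (snd q)) (snd (snd q))"])
    (simp_all only: lift_cp_base DC bounded_linear_imp_has_derivative bounded_linear_lift_cp)

lemma R_lift_derivative:
  "((\<lambda>q. R i (lift_loc i q)) has_derivative (\<lambda>h. R' i (lift_loc i h))) (at (w0, \<theta>0))"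
  by (rule has_derivative_compose[where f = "lift_loc i" and f' = "lift_loc i" and g' = "R' i" and g = "R i"])
    (simp_all only: lift_loc_base R_derivative bounded_linear_imp_has_derivative bounded_linear_lift_loc)

lemma F_derivative: "(F has_derivative F') (at (w0, \<theta>0))"
  unfolding F_def[abs_def] F'_def[abs_def]
proof (rule has_derivative_Pair)
  show "((\<lambda>q. \<chi> i. R i (lift_loc i q)) has_derivative (\<lambda>h. \<chi> i. R' i (lift_loc i h))) (at (w0, \<theta>0))"
    by (rule has_derivative_vecI) (simp add: R_lift_derivative)
  show "((\<lambda>q. C q + (snd (fst q) - vrestr (didx P) (snd (fst q)))) has_derivative
      (\<lambda>h. DC (lift_cp h) + (snd (fst h) - vrestr (didx P) (snd (fst h))))) (at (w0, \<theta>0))"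
    by (intro has_derivative_add has_derivative_diff C_derivative bounded_linear_imp_has_derivative
        bounded_linear_compose[OF bounded_linear_vrestr] bounded_linear_intros)
qed

lemma F_differentiable_near: "\<forall>\<^sub>F q in nhds (w0, \<theta>0). F differentiable (at q)"
proof -
  have "\<forall>\<^sub>F q in nhds (w0, \<theta>0). R i differentiable (at (lift_loc i q))" for i
    using R_differentiable_near[of i, folded lift_loc_base]
    by (rule eventually_compose_filterlim) (rule bounded_linear_nhds[OF bounded_linear_lift_loc])
  then have "\<forall>\<^sub>F q in nhds (w0, \<theta>0). \<forall>i\<in>UNIV. R i differentiable (at (lift_loc i q))"
    by (intro eventually_ball_finite) auto
  moreover have "\<forall>\<^sub>F q in nhds (w0, \<theta>0).
      (\<lambda>q. Ccp P (fst q) (fst (snd q)) (snd (snd q))) differentiable (at (lift_cp q))"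
    using Ccp_near[folded lift_cp_base]
    by (rule eventually_compose_filterlim) (rule bounded_linear_nhds[OF bounded_linear_lift_cp])
  ultimately show ?thesis
  proof eventually_elim
    case (elim q)
    have "C differentiable (at q)"
      unfolding C_def[abs_def]
      by (rule differentiable_compose[of "\<lambda>q. Ccp P (fst q) (fst (snd q)) (snd (snd q))" lift_cp])
        (auto intro: elim bounded_linear_imp_differentiable bounded_linear_lift_cp)
    moreover have "(\<lambda>q. R i (lift_loc i q)) differentiable (at q)" for i
      by (rule differentiable_compose[of "R i" "lift_loc i"])
        (use elim in \<open>auto intro: bounded_linear_imp_differentiable bounded_linear_lift_loc\<close>)
    then have "(\<lambda>q. \<chi> i. R i (lift_loc i q)) differentiable (at q)"
      by - (rule differentiable_vecI, simp)
    moreover have "(\<lambda>q::((real^('v + 'e + 'g)^'i) \<times> (real^('h + 'k))) \<times> (real^'p). snd (fst q)) differentiable (at q)"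
      by (intro bounded_linear_imp_differentiable bounded_linear_intros)
    moreover have "(\<lambda>q::((real^('v + 'e + 'g)^'i) \<times> (real^('h + 'k))) \<times> (real^'p). vrestr (didx P) (snd (fst q)))
        differentiable (at q)"
      by (intro bounded_linear_imp_differentiable bounded_linear_compose[OF bounded_linear_vrestr]
          bounded_linear_intros)
    ultimately show ?case
      unfolding F_def[abs_def] by (intro differentiable_Pair differentiable_add differentiable_diff)
  qed
qed

lemma F_eq_0_iff:
  "F q = 0 \<longleftrightarrow> (\<forall>i. R i (lift_loc i q) = 0) \<and> C q = 0 \<and> snd (fst q) \<in> coord (didx P)"
  using residual_eq_0_iff[of "C q" "didx P" "snd (fst q)"]
  by (simp add: F_def C_def Ccp_coord prod_eq_iff vec_lambda_eq_0_iff)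

lemma F'_eq_0_iff:
  "F' h = 0 \<longleftrightarrow> (\<forall>i. D i (lift_loc i h) = 0 \<and> fst (fst h) $ i \<in> coord (zidx P i)) \<and>
    DC (lift_cp h) = 0 \<and> snd (fst h) \<in> coord (didx P)"
  using residual_eq_0_iff[of "DC (lift_cp h)" "didx P" "snd (fst h)"]
  by (simp add: F'_def DC_coord prod_eq_iff vec_lambda_eq_0_iff R'_eq_0_iff)
    (simp add: lift_loc_def)

lemma F'_inj:
  assumes "F' (w, 0) = 0"
  shows "w = 0"
proof -
  have "fst w $ i = 0" "snd w = 0" for i
    by (rule coupled_system_zero[of "\<lambda>i. fst w $ i" "snd w"];
        use assms in \<open>simp add: F'_eq_0_iff lift_loc_def lift_cp_def\<close>)+
  then show ?thesis by (simp add: prod_eq_iff vec_eq_iff)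
qed

lemma coupling_signs_near:
  "\<forall>\<^sub>F q in nhds (w0, \<theta>0). C q = 0 \<longrightarrow> (\<forall>j\<in>cin_idx P.
     (\<Sum>i\<in>UNIV. Fcp P i (fst (lift_cp q)) (snd q) $ j) \<le> 0 \<and> 0 \<le> snd (fst q) $ Inr j)"
proof -
  have "\<forall>\<^sub>F q in nhds (x, (lam, \<theta>0)).
      fst (snd q) $ j * (\<Sum>i\<in>UNIV. Fcp P i (fst q) (snd (snd q)) $ j) = 0 \<longrightarrow>
      (\<Sum>i\<in>UNIV. Fcp P i (fst q) (snd (snd q)) $ j) \<le> 0 \<and> 0 \<le> fst (snd q) $ j"
    if j: "j \<in> cin_idx P" for j
  proof -
    obtain Dc where "((\<lambda>q. \<Sum>i\<in>UNIV. lcon P i (Inr (Inr j)) (fst (prC q)) (snd (prC q))) has_derivative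
        (\<lambda>q. Dc (prC q))) (at (x, (lam, \<theta>0)))"
      using lcon_prC_derivative[of "Inr j"] j by auto
    then have 1: "isCont (\<lambda>q. \<Sum>i\<in>UNIV. Fcp P i (fst q) (snd (snd q)) $ j) (x, (lam, \<theta>0))"
      by (simp add: prC_def has_derivative_continuous)
    have 2: "isCont (\<lambda>q. fst (snd q) $ j) (x, (lam, \<theta>0))"
      by (intro linear_continuous_at bounded_linear_compose[OF bounded_linear_vec_nth]
          bounded_linear_intros)
    show ?thesis
      by (rule eventually_signs[OF 1 2]) (use complementarity(2)[OF j] in auto)
  qed
  then have "\<forall>\<^sub>F q in nhds (x, (lam, \<theta>0)). \<forall>j\<in>cin_idx P.
      fst (snd q) $ j * (\<Sum>i\<in>UNIV. Fcp P i (fst q) (snd (snd q)) $ j) = 0 \<longrightarrow>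
      (\<Sum>i\<in>UNIV. Fcp P i (fst q) (snd (snd q)) $ j) \<le> 0 \<and> 0 \<le> fst (snd q) $ j"
    by (intro eventually_ball_finite) auto
  from eventually_compose_filterlim[OF this[folded lift_cp_base] bounded_linear_nhds[OF bounded_linear_lift_cp]]
  show ?thesis
  proof eventually_elim
    case (elim q)
    show ?case
    proof (intro impI ballI)
      fix j assume C: "C q = 0" and j: "j \<in> cin_idx P"
      have "fst (snd (lift_cp q)) $ j *
          (\<Sum>i\<in>UNIV. Fcp P i (fst (lift_cp q)) (snd (snd (lift_cp q))) $ j) = C q $ Inr j"
        using j by (simp add: C_def Ccp_nth)
      then show "(\<Sum>i\<in>UNIV. Fcp P i (fst (lift_cp q)) (snd q) $ j) \<le> 0 \<and> 0 \<le> snd (fst q) $ Inr j"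
        using elim j C by (auto simp: lift_cp_def)
    qed
  qed
qed

text \<open>The facts that make \<open>F q = 0\<close> equivalent to the global KKT conditions,
  bundled so that one neighbourhood can be pulled back along a branch.\<close>

definition KKT_near where
  "KKT_near q \<longleftrightarrow> x_differentiable P (fst (lift_cp q)) (snd q) \<and>
    (\<forall>i. sub_kkt P i (fst (fst q) $ i) (vjoin (snd q) (snd (fst q))) \<longleftrightarrow> R i (lift_loc i q) = 0) \<and>
    (C q = 0 \<longrightarrow> (\<forall>j\<in>cin_idx P.
      (\<Sum>i\<in>UNIV. Fcp P i (fst (lift_cp q)) (snd q) $ j) \<le> 0 \<and> 0 \<le> snd (fst q) $ Inr j))"

lemma KKT_near: "\<forall>\<^sub>F q in nhds (w0, \<theta>0). KKT_near q"
proof -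
  have "\<forall>\<^sub>F q in nhds (w0, \<theta>0). x_differentiable P (fst (lift_cp q)) (snd q)"
  proof -
    have "filterlim (\<lambda>q. (fst (lift_cp q), snd q)) (nhds (fst (lift_cp (w0, \<theta>0)), snd (w0, \<theta>0))) (nhds (w0, \<theta>0))"
      by (rule bounded_linear_nhds) (intro bounded_linear_intros bounded_linear_lift_cp
          bounded_linear_compose[OF bounded_linear_fst])
    then have "filterlim (\<lambda>q. (fst (lift_cp q), snd q)) (nhds (x, \<theta>0)) (nhds (w0, \<theta>0))"
      by (simp add: lift_cp_base)
    from eventually_compose_filterlim[OF x_differentiable_near this] show ?thesis by simp
  qed
  moreover have "\<forall>\<^sub>F q in nhds (w0, \<theta>0). \<forall>i\<in>UNIV. sub_kkt P i (fst (lift_loc i q)) (snd (lift_loc i q)) \<longleftrightarrow>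
      R i (lift_loc i q) = 0"
    by (intro eventually_ball_finite ballI finite_class.finite_UNIV
        eventually_compose_filterlim[OF sub_kkt_near[folded lift_loc_base]]
        bounded_linear_nhds bounded_linear_lift_loc)
  ultimately show ?thesis
    using coupling_signs_near by eventually_elim (simp add: KKT_near_def lift_loc_def)
qed

lemma global_kkt_iff_F:
  assumes near: "KKT_near (((\<chi> i. z_of P X PI MU i), vjoin NU LA), \<theta>)"
  shows "global_kkt P \<theta> X PI MU NU LA \<longleftrightarrow> F (((\<chi> i. z_of P X PI MU i), vjoin NU LA), \<theta>) = 0"
proof -
  let ?q = "(((\<chi> i. z_of P X PI MU i), vjoin NU LA), \<theta>)"
  have l: "lift_cp ?q = (X, (LA, \<theta>))"
    by (simp add: lift_cp_def sum_vrestr_xblk)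
  show ?thesis
    using near global_kkt_iff[of P X \<theta> PI MU NU LA]
    unfolding F_eq_0_iff KKT_near_def by (auto simp: l C_def tau_of_def)
qed

lemma branch_limit:
  assumes "W \<theta>0 = w0" "isCont W \<theta>0"
  shows "filterlim (\<lambda>\<theta>. (W \<theta>, \<theta>)) (nhds (w0, \<theta>0)) (nhds \<theta>0)"
  using isCont_nhds[OF assms(2)] assms(1) by (intro tendsto_Pair filterlim_ident) simp

lemma global_branch_exists: "\<exists>X PI MU NU LA. global_branch P \<theta>0 x \<pi> \<mu> \<nu> lam X PI MU NU LA"
proof -
  have "F (w0, \<theta>0) = 0"
    using global_kkt_iff_F[of x \<pi> \<mu> \<nu> lam \<theta>0] eventually_nhds_x_imp_x[OF KKT_near] kkt
    by (simp add: w0_def)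
  from implicit_branch_exists[OF F_differentiable_near F_derivative F'_inj this]
  obtain W where W: "W \<theta>0 = w0" "isCont W \<theta>0" "\<forall>\<^sub>F \<theta> in nhds \<theta>0. F (W \<theta>, \<theta>) = 0"
    by blast
  define X where "X \<theta> = (\<Sum>i\<in>UNIV. vfst (fst (W \<theta>) $ i))" for \<theta>
  define PI where "PI \<theta> i = vfst (vsnd (fst (W \<theta>) $ i))" for \<theta> i
  define MU where "MU \<theta> i = vsnd (vsnd (fst (W \<theta>) $ i))" for \<theta> i
  define NU where "NU \<theta> = vfst (snd (W \<theta>))" for \<theta>
  define LA where "LA \<theta> = vsnd (snd (W \<theta>))" for \<theta>
  have contW: "isCont (\<lambda>\<theta>. f (W \<theta>)) \<theta>0" if "bounded_linear f" for f :: "_ \<Rightarrow> real^'z"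
    using bounded_linear.continuous[OF that W(2)] .
  have bl: "bounded_linear (\<lambda>w. fst w $ i)" for i
    by (intro bounded_linear_compose[OF bounded_linear_vec_nth] bounded_linear_intros)
  have "isCont X \<theta>0"
    unfolding X_def[abs_def]
    by (rule contW) (intro bounded_linear_sum bounded_linear_compose[OF bounded_linear_vfst] bl)
  moreover have "isCont (\<lambda>\<theta>. PI \<theta> i) \<theta>0" for i
    unfolding PI_def by (rule contW)
      (intro bounded_linear_compose[OF bounded_linear_vfst] bounded_linear_compose[OF bounded_linear_vsnd] bl)
  moreover have "isCont (\<lambda>\<theta>. MU \<theta> i) \<theta>0" for i
    unfolding MU_def by (rule contW)
      (intro bounded_linear_compose[OF bounded_linear_vsnd] bl)
  moreover have "isCont NU \<theta>0" "isCont LA \<theta>0"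
    unfolding NU_def[abs_def] LA_def[abs_def]
    by (rule contW, intro bounded_linear_compose[OF bounded_linear_vfst]
        bounded_linear_compose[OF bounded_linear_vsnd] bounded_linear_intros)+
  moreover have "X \<theta>0 = x" "PI \<theta>0 = \<pi>" "MU \<theta>0 = \<mu>" "NU \<theta>0 = \<nu>" "LA \<theta>0 = lam"
    by (simp_all add: fun_eq_iff X_def PI_def MU_def NU_def LA_def W(1) w0_def sum_vrestr_xblk)
  moreover have "\<forall>\<^sub>F \<theta> in nhds \<theta>0. global_kkt P \<theta> (X \<theta>) (PI \<theta>) (MU \<theta>) (NU \<theta>) (LA \<theta>)"
    using eventually_compose_filterlim[OF KKT_near branch_limit[OF W(1,2)]] W(3)
  proof eventually_elim
    case (elim \<theta>)
    have R0: "R i (lift_loc i (W \<theta>, \<theta>)) = 0" for i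
      using elim(2) by (simp add: F_eq_0_iff)
    \<comment> \<open>A zero of \<open>F\<close> is a family of ambient vectors. Their membership in
      the coordinate subspaces is what lets the sum \<open>X \<theta>\<close> be split into the
      original blocks and \<open>W \<theta>\<close> be rewritten through
      \<open>z_of\<close>.\<close>
    have "sub_kkt P i (fst (W \<theta>) $ i) (vjoin \<theta> (snd (W \<theta>)))" for i
      using elim(1) R0[of i] by (simp add: KKT_near_def)
    then have "fst (W \<theta>) $ i \<in> coord (zidx P i)" for i
      by (simp add: sub_kkt_def)
    then have "vfst (fst (W \<theta>) $ i) \<in> coord (xblk P i)" for i
      by (simp add: zidx_def coord_Plus)
    then have "vrestr (xblk P i) (X \<theta>) = vfst (fst (W \<theta>) $ i)" for i
      unfolding X_def by (rule vrestr_xblk_sum)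
    then have "W \<theta> = ((\<chi> i. z_of P (X \<theta>) (PI \<theta>) (MU \<theta>) i), vjoin (NU \<theta>) (LA \<theta>))"
      by (simp add: prod_eq_iff vec_eq_iff[of "fst (W \<theta>)"] z_of_def PI_def MU_def NU_def LA_def)
    then show ?case
      using elim global_kkt_iff_F[of "X \<theta>" "PI \<theta>" "MU \<theta>" "NU \<theta>" "LA \<theta>" \<theta>] by simp
  qed
  ultimately show ?thesis
    unfolding global_branch_def by blast
qed

text \<open>The local rows of the linearized system express the primal displacement by
  \<open>J\<close>; substituting it into the coupling row gives
  \<open>N *v \<gamma> = Q *v d\<close>, which \<open>y *v d\<close> also solves.\<close>

lemma global_branch_derivative:
  assumes br: "global_branch P \<theta>0 x \<pi> \<mu> \<nu> lam X PI MU NU LA"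
    and y: "solves_coupling P \<theta>0 x \<pi> \<mu> \<nu> lam y"
  shows "((\<lambda>\<theta>. vjoin (NU \<theta>) (LA \<theta>)) has_derivative (\<lambda>d. y *v d)) (at \<theta>0)"
proof -
  have b: "X \<theta>0 = x" "PI \<theta>0 = \<pi>" "MU \<theta>0 = \<mu>" "NU \<theta>0 = \<nu>" "LA \<theta>0 = lam"
    "isCont X \<theta>0" "\<And>i. isCont (\<lambda>\<theta>. PI \<theta> i) \<theta>0" "\<And>i. isCont (\<lambda>\<theta>. MU \<theta> i) \<theta>0"
    "isCont NU \<theta>0" "isCont LA \<theta>0"
    "\<forall>\<^sub>F \<theta> in nhds \<theta>0. global_kkt P \<theta> (X \<theta>) (PI \<theta>) (MU \<theta>) (NU \<theta>) (LA \<theta>)"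
    using br unfolding global_branch_def by auto
  define W where "W \<theta> = ((\<chi> i. z_of P (X \<theta>) (PI \<theta>) (MU \<theta>) i), vjoin (NU \<theta>) (LA \<theta>))" for \<theta>
  have W0: "W \<theta>0 = w0"
    by (simp add: W_def w0_def b)
  have vj: "isCont (\<lambda>\<theta>. vjoin (f \<theta>) (g \<theta>)) \<theta>0" if "isCont f \<theta>0" "isCont g \<theta>0"
    for f :: "_ \<Rightarrow> real^'y::finite" and g :: "_ \<Rightarrow> real^'z::finite"
    using bounded_linear.continuous[OF bounded_linear_vjoin continuous_Pair[OF that]] by simp
  have "isCont (\<lambda>\<theta>. z_of P (X \<theta>) (PI \<theta>) (MU \<theta>) i) \<theta>0" for i
    unfolding z_of_def
    by (intro vj bounded_linear.continuous[OF bounded_linear_vrestr] b)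
  then have "isCont (\<lambda>\<theta>. \<chi> i. z_of P (X \<theta>) (PI \<theta>) (MU \<theta>) i) \<theta>0"
    unfolding isCont_def by - (rule vec_tendstoI, simp)
  then have contW: "isCont W \<theta>0"
    unfolding W_def[abs_def] by (intro continuous_Pair vj b)
  have FW: "\<forall>\<^sub>F \<theta> in nhds \<theta>0. F (W \<theta>, \<theta>) = 0"
    using eventually_compose_filterlim[OF KKT_near branch_limit[OF W0 contW]] b(11)
    by eventually_elim (simp add: W_def global_kkt_iff_F)
  obtain g where g: "(W has_derivative g) (at \<theta>0)" "\<And>d. F' (g d, d) = 0"
    using implicit_branch_has_derivative[OF F_derivative F'_inj W0 contW FW] by blast
  have "snd (g d) = y *v d" for d
  proof -
    define \<gamma> where "\<gamma> = snd (g d)"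
    have Fd: "\<And>i. fst (g d) $ i \<in> coord (zidx P i)" "\<And>i. D i (fst (g d) $ i, vjoin d \<gamma>) = 0"
      "DC (\<Sum>i\<in>UNIV. vfst (fst (g d) $ i), (vsnd \<gamma>, d)) = 0" "\<gamma> \<in> coord (didx P)"
      using g(2)[of d] by (simp_all add: F'_eq_0_iff lift_loc_def lift_cp_def \<gamma>_def)
    have "DC (J *v vjoin d \<gamma>, (vsnd \<gamma>, d)) = 0"
      using Fd(3) by (simp only: stacked_jacobian_mult[OF Fd(1,2)])
    \<comment> \<open>Linearity separates the response to the data direction, which becomes the
      right-hand side, from the response to \<gamma>, which becomes the coupling matrix.\<close>
    moreover have "J *v vjoin d \<gamma> = J *v vjoin d 0 + J *v vjoin 0 \<gamma>"
      by (simp flip: matrix_vector_right_distrib vjoin_add)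
    ultimately have "N *v \<gamma> = Q *v d"
      unfolding coupling_matrix_mult coupling_rhs_mult
      by (simp add: DC_add eq_neg_iff_add_eq_0 neg_eq_iff_add_eq_0 add.commute)
    then have "N *v (\<gamma> - y *v d) = 0"
      using y by (simp add: solves_coupling_iff matrix_vector_mult_diff_distrib)
    moreover have "\<gamma> - y *v d \<in> coord (didx P)"
      using Fd(4) y by (intro subspace_diff[OF subspace_coord]) (simp_all add: solves_coupling_iff)
    ultimately have "\<gamma> - y *v d = 0"
      by (rule coupling_system_zero[rotated])
    then show ?thesis by (simp add: \<gamma>_def)
  qed
  moreover have "((\<lambda>\<theta>. snd (W \<theta>)) has_derivative (\<lambda>d. snd (g d))) (at \<theta>0)"
    using g(1) by (rule has_derivative_snd)
  ultimately show ?thesis by (simp add: W_def)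
qed

end

theorem theorem1:
  fixes P :: "('i::finite,'v::finite,'p::finite,'e::finite,'g::finite,'h::finite,'k::finite) problem"
    and \<theta>0 :: "real^'p" and x :: "real^'v"
    and \<pi> :: "'i \<Rightarrow> real^'e" and \<mu> :: "'i \<Rightarrow> real^'g"
    and \<nu> :: "real^'h" and lam :: "real^'k"
  assumes "convex_local_problems P"
    and "is_minimizer P \<theta>0 x"
    and A1: "smooth_data P \<theta>0 x"
    and A2: "global_kkt P \<theta>0 x \<pi> \<mu> \<nu> lam"
    and A4: "binding_independent P \<theta>0 x"
    and A5: "strict_complementarity P \<theta>0 x \<mu> lam"
    and A3: "\<And>i. second_order P i x (\<pi> i) (\<mu> i) \<nu> lam \<theta>0"
  shows "(\<forall>i. let z = z_of P x \<pi> \<mu> i; \<tau> = tau_of \<theta>0 \<nu> lam in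
            invertible_on (zidx P i) (DzG P i z \<tau>) \<and>
            (\<exists>Z. local_branch P i z \<tau> Z) \<and>
            (\<forall>Z. local_branch P i z \<tau> Z \<longrightarrow>
               ((\<lambda>t. vfst (Z t)) has_derivative (\<lambda>d. local_jacobian P i z \<tau> *v d)) (at \<tau>))) \<and>
         invertible_on (didx P) (coupling_matrix P \<theta>0 x \<pi> \<mu> \<nu> lam) \<and>
         (\<exists>!y. solves_coupling P \<theta>0 x \<pi> \<mu> \<nu> lam y) \<and>
         (\<exists>X PI MU NU LA. global_branch P \<theta>0 x \<pi> \<mu> \<nu> lam X PI MU NU LA) \<and>
         (\<forall>X PI MU NU LA y. global_branch P \<theta>0 x \<pi> \<mu> \<nu> lam X PI MU NU LA \<longrightarrow>
            solves_coupling P \<theta>0 x \<pi> \<mu> \<nu> lam y \<longrightarrow>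
            ((\<lambda>\<theta>. vjoin (NU \<theta>) (LA \<theta>)) has_derivative (\<lambda>d. y *v d)) (at \<theta>0))"
proof -
  interpret regular_kkt_point P \<theta>0 x \<pi> \<mu> \<nu> lam
    using A1 A2 A4 A5 A3 by unfold_locales
  show ?thesis
    unfolding Let_def
  proof (intro conjI allI impI)
    show "\<exists>!y. solves_coupling P \<theta>0 x \<pi> \<mu> \<nu> lam y"
      unfolding solves_coupling_iff_inverse by simp
  qed (rule invertible_DzG local_branch_exists local_branch_derivative invertible_coupling_matrix
      global_branch_exists global_branch_derivative; assumption?)+
qed

end
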